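(* Let $\Gamma$ be a countably infinite discrete group. The following statements are equivalent for a Polish $\Gamma$-flow $X$: (1) $X$ is disjoint from some infinite $\Gamma$-flow; (2) $X$ is disjoint from some free minimal subflow of $2^\Gamma$; (3) $X$ has no wandering points.
   Context: A $\Gamma$-flow is a nonempty compact Hausdorff space $X$ equipped with a continuous action of $\Gamma$; it is a Polish $\Gamma$-flow if the underlying space is Polish (equivalently, metrizable), and infinite if the underlying set is infinite. A subflow of $X$ is a nonempty closed $\Gamma$-invariant subset; $X$ is minimal if its only subflow is $X$ itself. A $\Gamma$-flow is free if $\gamma\cdot x\neq x$ for all points $x$ and all non-identity $\gamma\in\Gamma$. The space $2^\Gamma$ of functions $x:\Gamma\to\{0,1\}$ has the product topology and the shift action $(\gamma\cdot x)(\delta)=x(\delta\gamma)$. For $\Gamma$-flows $X,Y$, the product $X\times Y$ is a $\Gamma$-flow with the diagonal action; a joining of $X$ and $Y$ is a subflow $Z\subseteq X\times Y$ that projects onto $X$ and onto $Y$. $X$ and $Y$ are disjoint if their only joining is $X\times Y$. A subset $U\subseteq X$ is wandering if $U\cap(\gamma\cdot U)=\varnothing$ for all but finitely many $\gamma\in\Gamma$; a point $x\in X$ is wandering if it has a wandering neighborhood. *)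

theory Defs
  imports "HOL-Analysis.Analysis" "HOL-Algebra.Group_Action"
begin

section \<open>Flows\<close>

text \<open>
  The acting group carries the discrete topology. As in \<^locale>\<open>group_action\<close>, each
  \<^term>\<open>\<phi> g\<close> is a permutation of the underlying set \<^term>\<open>topspace X\<close>, extended by
  \<^const>\<open>undefined\<close> outside of it.
\<close>

locale flow = group_action G "topspace X" \<phi>
  for G :: "('g, 'm) monoid_scheme" (structure)
    and X :: "'x topology" and \<phi> :: "'g \<Rightarrow> 'x \<Rightarrow> 'x" +
  assumes nonempty: "topspace X \<noteq> {}"
    and compact: "compact_space X"
    and Hausdorff: "Hausdorff_space X"
    and continuous_action:
      "continuous_map (prod_topology (discrete_topology (carrier G)) X) X (\<lambda>(g, x). \<phi> g x)"

definition polish_top :: "'x topology \<Rightarrow> bool" where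
  "polish_top X \<longleftrightarrow> completely_metrizable_space X \<and> separable_space X"

definition subflow :: "('g, 'm) monoid_scheme \<Rightarrow> 'x topology \<Rightarrow> ('g \<Rightarrow> 'x \<Rightarrow> 'x) \<Rightarrow> 'x set \<Rightarrow> bool" where
  "subflow G X \<phi> Z \<longleftrightarrow> closedin X Z \<and> Z \<noteq> {} \<and> (\<forall>g\<in>carrier G. \<phi> g ` Z \<subseteq> Z)"

text \<open>
  A subflow \<^term>\<open>Z\<close> of \<^term>\<open>X\<close> is itself the flow on \<^term>\<open>subtopology X Z\<close> with the
  following action.
\<close>

definition restrict_action :: "('g \<Rightarrow> 'x \<Rightarrow> 'x) \<Rightarrow> 'x set \<Rightarrow> 'g \<Rightarrow> 'x \<Rightarrow> 'x" where
  "restrict_action \<phi> Z g = restrict (\<phi> g) Z"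

definition minimal_flow :: "('g, 'm) monoid_scheme \<Rightarrow> 'x topology \<Rightarrow> ('g \<Rightarrow> 'x \<Rightarrow> 'x) \<Rightarrow> bool" where
  "minimal_flow G X \<phi> \<longleftrightarrow> (\<forall>Z. subflow G X \<phi> Z \<longrightarrow> Z = topspace X)"

definition free_flow :: "('g, 'm) monoid_scheme \<Rightarrow> 'x topology \<Rightarrow> ('g \<Rightarrow> 'x \<Rightarrow> 'x) \<Rightarrow> bool" where
  "free_flow G X \<phi> \<longleftrightarrow>
     (\<forall>x\<in>topspace X. \<forall>g\<in>carrier G. g \<noteq> \<one>\<^bsub>G\<^esub> \<longrightarrow> \<phi> g x \<noteq> x)"


section \<open>The Bernoulli shift\<close>

definition shift_space :: "('g, 'm) monoid_scheme \<Rightarrow> ('g \<Rightarrow> bool) topology" where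
  "shift_space G = product_topology (\<lambda>_. discrete_topology UNIV) (carrier G)"

definition shift_action :: "('g, 'm) monoid_scheme \<Rightarrow> 'g \<Rightarrow> ('g \<Rightarrow> bool) \<Rightarrow> 'g \<Rightarrow> bool" where
  "shift_action G g = (\<lambda>x\<in>topspace (shift_space G). \<lambda>d\<in>carrier G. x (d \<otimes>\<^bsub>G\<^esub> g))"


section \<open>Joinings and disjointness\<close>

definition diagonal_action ::
  "'x set \<Rightarrow> ('g \<Rightarrow> 'x \<Rightarrow> 'x) \<Rightarrow> 'y set \<Rightarrow> ('g \<Rightarrow> 'y \<Rightarrow> 'y) \<Rightarrow> 'g \<Rightarrow> 'x \<times> 'y \<Rightarrow> 'x \<times> 'y" where
  "diagonal_action A \<phi> B \<psi> g = (\<lambda>(x, y)\<in>A \<times> B. (\<phi> g x, \<psi> g y))"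

definition joining ::
  "('g, 'm) monoid_scheme \<Rightarrow> 'x topology \<Rightarrow> ('g \<Rightarrow> 'x \<Rightarrow> 'x) \<Rightarrow> 'y topology \<Rightarrow> ('g \<Rightarrow> 'y \<Rightarrow> 'y)
     \<Rightarrow> ('x \<times> 'y) set \<Rightarrow> bool" where
  "joining G X \<phi> Y \<psi> Z \<longleftrightarrow>
     subflow G (prod_topology X Y) (diagonal_action (topspace X) \<phi> (topspace Y) \<psi>) Z \<and>
     fst ` Z = topspace X \<and> snd ` Z = topspace Y"

definition disjoint_flows ::
  "('g, 'm) monoid_scheme \<Rightarrow> 'x topology \<Rightarrow> ('g \<Rightarrow> 'x \<Rightarrow> 'x) \<Rightarrow> 'y topology \<Rightarrow> ('g \<Rightarrow> 'y \<Rightarrow> 'y) \<Rightarrow> bool" where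
  "disjoint_flows G X \<phi> Y \<psi> \<longleftrightarrow>
     (\<forall>Z. joining G X \<phi> Y \<psi> Z \<longrightarrow> Z = topspace X \<times> topspace Y)"


section \<open>Wandering sets and points\<close>

definition wandering_set ::
  "('g, 'm) monoid_scheme \<Rightarrow> 'x topology \<Rightarrow> ('g \<Rightarrow> 'x \<Rightarrow> 'x) \<Rightarrow> 'x set \<Rightarrow> bool" where
  "wandering_set G X \<phi> U \<longleftrightarrow>
     U \<subseteq> topspace X \<and> finite {g \<in> carrier G. U \<inter> \<phi> g ` U \<noteq> {}}"

definition wandering_point ::
  "('g, 'm) monoid_scheme \<Rightarrow> 'x topology \<Rightarrow> ('g \<Rightarrow> 'x \<Rightarrow> 'x) \<Rightarrow> 'x \<Rightarrow> bool" where
  "wandering_point G X \<phi> x \<longleftrightarrow>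
     (\<exists>U V. openin X V \<and> x \<in> V \<and> V \<subseteq> U \<and> wandering_set G X \<phi> U)"


section \<open>A universe for existentially quantified flows\<close>

text \<open>
  HOL cannot quantify existentially over types, so ``there is a flow'' (with no bound on
  its cardinality) has to name a type that carries it. Here \<open>'y\<close> is meant to stay a free
  type variable of the theorem: every type embeds into the universe for a suitable \<open>'y\<close>,
  so no flow is excluded, and the second summand provides enough room for the subflows of
  the shift whatever \<open>'y\<close> is.
\<close>

type_synonym ('g, 'y) flow_universe = "'y + ('g \<Rightarrow> bool)"


section \<open>The constructions above yield flows\<close>

lemma group_actionI:
  assumes "group G"
    and c: "\<And>g x. g \<in> carrier G \<Longrightarrow> x \<in> E \<Longrightarrow> \<phi> g x \<in> E"
    and e: "\<And>g. g \<in> carrier G \<Longrightarrow> \<phi> g \<in> extensional E"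
    and o: "\<And>x. x \<in> E \<Longrightarrow> \<phi> \<one>\<^bsub>G\<^esub> x = x"
    and m: "\<And>g h x. g \<in> carrier G \<Longrightarrow> h \<in> carrier G \<Longrightarrow> x \<in> E \<Longrightarrow> \<phi> (g \<otimes>\<^bsub>G\<^esub> h) x = \<phi> g (\<phi> h x)"
  shows "group_action G E \<phi>"
proof -
  interpret group G by fact
  have B: "\<phi> g \<in> Bij E" if "g \<in> carrier G" for g
  proof -
    have "bij_betw (\<phi> g) E E"
      by (rule bij_betw_byWitness[where f' = "\<phi> (inv\<^bsub>G\<^esub> g)"])
        (use that c in \<open>auto simp: m[symmetric] o\<close>)
    then show ?thesis using e that by (simp add: Bij_def)
  qed
  have "\<phi> (g \<otimes>\<^bsub>G\<^esub> h) = compose E (\<phi> g) (\<phi> h)" if "g \<in> carrier G" "h \<in> carrier G" for g h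
    by (rule extensionalityI[of _ E]) (use that e in \<open>auto simp: compose_def m\<close>)
  then have "\<phi> \<in> hom G (BijGroup E)"
    by (auto simp: hom_def BijGroup_def B)
  then show ?thesis
    by (simp add: group_action_def group_hom_def group_hom_axioms_def group_BijGroup \<open>group G\<close>)
qed

lemma continuous_map_discrete_prod:
  assumes "\<And>g. g \<in> A \<Longrightarrow> continuous_map X Y (\<phi> g)"
  shows "continuous_map (prod_topology (discrete_topology A) X) Y (\<lambda>(g, x). \<phi> g x)"
  unfolding continuous_map_openin_preimage_eq
proof (intro conjI allI impI)
  show "(\<lambda>(g, x). \<phi> g x) \<in> topspace (prod_topology (discrete_topology A) X) \<rightarrow> topspace Y"
    using assms by (auto simp: continuous_map_def Pi_iff)
  fix U assume U: "openin Y U"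
  have "topspace (prod_topology (discrete_topology A) X) \<inter> (\<lambda>(g, x). \<phi> g x) -` U
      = (\<Union>g\<in>A. {g} \<times> {x \<in> topspace X. \<phi> g x \<in> U})"
    by auto
  moreover have "openin (prod_topology (discrete_topology A) X) \<dots>"
    using assms U by (intro openin_Union) (auto simp: openin_prod_Times_iff continuous_map_def)
  ultimately show "openin (prod_topology (discrete_topology A) X)
      (topspace (prod_topology (discrete_topology A) X) \<inter> (\<lambda>(g, x). \<phi> g x) -` U)"
    by simp
qed

lemma (in flow) continuous_map_action:
  assumes "g \<in> carrier G"
  shows "continuous_map X X (\<phi> g)"
proof -
  have "continuous_map X (prod_topology (discrete_topology (carrier G)) X) (\<lambda>x. (g, x))"
    using assms by (auto intro: continuous_map_pairedI)
  from continuous_map_compose[OF this continuous_action] show ?thesis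
    by (simp add: o_def)
qed

lemma (in flow) action_one: "x \<in> topspace X \<Longrightarrow> \<phi> \<one> x = x"
  using id_eq_one by (metis restrict_apply')

lemma (in flow) action_closed: "g \<in> carrier G \<Longrightarrow> x \<in> topspace X \<Longrightarrow> \<phi> g x \<in> topspace X"
  using surj_prop by blast

lemma (in flow) is_group: "group G"
  using group_hom by (simp add: group_hom_def)

lemma flow_subflow:
  assumes "flow G X \<phi>" "subflow G X \<phi> Z"
  shows "flow G (subtopology X Z) (restrict_action \<phi> Z)"
proof -
  interpret flow G X \<phi> by fact
  interpret group G by (rule is_group)
  have Z: "closedin X Z" "Z \<noteq> {}" "Z \<subseteq> topspace X"
    and inv: "\<And>g x. g \<in> carrier G \<Longrightarrow> x \<in> Z \<Longrightarrow> \<phi> g x \<in> Z"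
    using assms(2) by (auto simp: subflow_def dest: closedin_subset)
  have T: "topspace X \<inter> Z = Z" using Z(3) by auto
  have "continuous_map (subtopology X Z) (subtopology X Z) (restrict_action \<phi> Z g)"
    if "g \<in> carrier G" for g
  proof -
    have "continuous_map (subtopology X Z) (subtopology X Z) (\<phi> g)"
      using that inv continuous_map_action[OF that]
      by (auto simp: continuous_map_in_subtopology continuous_map_from_subtopology)
    then show ?thesis
      by (rule continuous_map_eq) (auto simp: restrict_action_def)
  qed
  moreover have "group_action G Z (restrict_action \<phi> Z)"
    using Z(3) by (intro group_actionI)
      (auto simp: is_group restrict_action_def inv action_one composition_rule subset_iff)
  ultimately show ?thesis
    using Z compact Hausdorff
    by (intro flow.intro flow_axioms.intro continuous_map_discrete_prod)
      (auto simp: T closedin_compact_space compact_space_subtopology Hausdorff_space_subtopology)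
qed

lemma flow_diagonal_action:
  assumes "flow G X \<phi>" "flow G Y \<psi>"
  shows "flow G (prod_topology X Y) (diagonal_action (topspace X) \<phi> (topspace Y) \<psi>)"
proof -
  interpret X: flow G X \<phi> by fact
  interpret Y: flow G Y \<psi> by fact
  interpret group G by (rule X.is_group)
  let ?D = "diagonal_action (topspace X) \<phi> (topspace Y) \<psi>"
  have "continuous_map (prod_topology X Y) (prod_topology X Y) (?D g)" if "g \<in> carrier G" for g
  proof -
    have "continuous_map (prod_topology X Y) (prod_topology X Y) (\<lambda>(x, y). (\<phi> g x, \<psi> g y))"
      using X.continuous_map_action[OF that] Y.continuous_map_action[OF that]
      by (simp add: continuous_map_prod_top)
    then show ?thesis
      by (rule continuous_map_eq) (auto simp: diagonal_action_def)
  qed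
  moreover have "group_action G (topspace X \<times> topspace Y) ?D"
    by (intro group_actionI)
      (auto simp: X.is_group diagonal_action_def X.action_one Y.action_one X.composition_rule
        Y.composition_rule X.action_closed Y.action_closed)
  ultimately show ?thesis
    using X.nonempty Y.nonempty X.compact Y.compact X.Hausdorff Y.Hausdorff
    by (intro flow.intro flow_axioms.intro continuous_map_discrete_prod)
      (auto simp: compact_space_prod_topology Hausdorff_space_prod_topology)
qed

lemma flow_shift:
  assumes "group G"
  shows "flow G (shift_space G) (shift_action G)"
proof -
  interpret group G by fact
  have T: "topspace (shift_space G) = carrier G \<rightarrow>\<^sub>E UNIV"
    by (simp add: shift_space_def)
  have "continuous_map (shift_space G) (shift_space G) (shift_action G g)"
    if "g \<in> carrier G" for g
  proof -
    have "continuous_map (shift_space G) (shift_space G) (\<lambda>x. \<lambda>d\<in>carrier G. x (d \<otimes>\<^bsub>G\<^esub> g))"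
      unfolding shift_space_def continuous_map_componentwise
      using that by (auto intro: continuous_map_product_projection)
    then show ?thesis
      by (rule continuous_map_eq) (auto simp: shift_action_def)
  qed
  moreover have "group_action G (topspace (shift_space G)) (shift_action G)"
    by (intro group_actionI)
      (auto simp: assms T shift_action_def m_assoc PiE_iff extensional_def fun_eq_iff)
  ultimately show ?thesis
    by (intro flow.intro flow_axioms.intro continuous_map_discrete_prod)
      (auto simp: shift_space_def compact_space_product_topology compact_space_discrete_topology
        Hausdorff_space_product_topology PiE_eq_empty_iff)
qed

end

theory Submission
  imports Defs "HOL-Probability.Probability_Mass_Function" "HOL-Real_Asymp.Real_Asymp"
begin

text \<open>
  A flow with a wandering open set \<open>V\<close> is disjoint from no infinite flow \<open>Y\<close>: only finitely many
  translates of \<open>V\<close> meet \<open>V\<close>, so for a suitable cofinite set \<open>W\<close> of points of \<open>Y\<close> the orbit of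
  \<open>V \<times> W\<close> in \<open>X \<times> Y\<close> leaves room in every fibre, and its complement is a proper joining
  (\<open>wandering_not_disjoint\<close>).

  Conversely, suppose that \<open>X\<close> has no wandering points. By Baire category every nonempty open set
  \<open>U\<close> contains a point whose set of return times to \<open>U\<close> is infinite
  (\<open>nonwandering_infinite_return\<close>). Applied to a countable family of open sets that refines
  all others, this gives countably many infinite sets \<open>R\<close> of return times. If \<open>Z\<close> is a subflow of the
  shift in which \<open>{r \<cdot> y | r \<in> R}\<close> is dense for every point \<open>y\<close> and each of these sets \<open>R\<close>, then \<open>Z\<close>
  is minimal, and a joining of \<open>X\<close> and \<open>Z\<close> meets every open box \<open>U \<times> W\<close>, hence is everything: start
  from a point of the joining above the recurrent point of \<open>U\<close> and move it by a suitable return time.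
  This reduces the problem to a combinatorial statement about the group (\<open>recurrent_free_point\<close>): there is a 0-1 colouring \<open>z\<close> of \<open>\<Gamma>\<close> each of
  whose finite patterns recurs, within a bounded part of every prescribed set \<open>R\<close>, around every
  group element, and such that every nontrivial translation changes \<open>z\<close> everywhere within bounded
  distance. The orbit closure of \<open>z\<close> is the required subflow.

  The colouring \<open>z\<close> is a union of finite partial colourings (patterns) \<open>w 0, w 1, \<dots>\<close>. Along
  with them a decreasing sequence of families of admissible patterns is chosen; each family is
  translation invariant, closed under unions of patterns with far apart domains, and allows every
  pattern to be extended to one more point by a change within bounded distance
  (\<open>pattern_family\<close>). One step (\<open>recurrence_step\<close>) takes a pattern \<open>w\<close> of the current
  family and an infinite set \<open>R\<close>, fixes a large finite part of \<open>R\<close>, and keeps those patterns \<open>p\<close> for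
  which each group element \<open>h\<close> either is served, meaning that \<open>p\<close> contains a copy of \<open>w\<close> at
  \<open>f \<cdot> h\<close> for some chosen \<open>f\<close>, or has most of its places \<open>f \<cdot> h\<close> still free. Serving all elements near a pattern
  must use up few places of all other elements. That this is possible is the content of
  \<open>site_selection\<close>, a consequence of the Lovasz local lemma: choose places at random with small
  density and discard those that lie close to each other.
\<close>

section \<open>Random colourings and the local lemma\<close>

definition determined_by :: "'v set \<Rightarrow> ('v \<Rightarrow> 'c) set \<Rightarrow> bool" where
  "determined_by W E \<longleftrightarrow> (\<forall>x y. (\<forall>v\<in>W. x v = y v) \<longrightarrow> (x \<in> E \<longleftrightarrow> y \<in> E))"

lemma determined_by_mono: "determined_by W E \<Longrightarrow> W \<subseteq> W' \<Longrightarrow> determined_by W' E"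
  unfolding determined_by_def by blast

lemma determined_by_INT:
  "(\<And>i. i \<in> I \<Longrightarrow> determined_by W (E i)) \<Longrightarrow> determined_by W (\<Inter>i\<in>I. E i)"
  unfolding determined_by_def by blast

locale random_colouring =
  fixes V :: "'v set" and C :: "'c set"
  assumes finite_V: "finite V" and finite_C: "finite C" and C_nonempty: "C \<noteq> {}"
begin

definition colourings :: "('v \<Rightarrow> 'c) set" where
  "colourings = (\<Pi>\<^sub>E v\<in>V. C)"

definition P :: "('v \<Rightarrow> 'c) set \<Rightarrow> real" where
  "P = measure_pmf.prob (pmf_of_set colourings)"

lemma finite_colourings: "finite colourings" and colourings_nonempty: "colourings \<noteq> {}"
  using finite_V finite_C C_nonempty
  by (auto simp: colourings_def PiE_eq_empty_iff intro: finite_PiE)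

lemma P_eq: "P E = card (colourings \<inter> E) / card colourings"
  unfolding P_def using finite_colourings colourings_nonempty by (simp add: measure_pmf_of_set)

lemma P_nonneg: "0 \<le> P E" by (simp add: P_def)

lemma P_mono: "E \<subseteq> F \<Longrightarrow> P E \<le> P F"
  unfolding P_def by (rule measure_pmf.finite_measure_mono) auto

lemma P_union_bound: "finite I \<Longrightarrow> P (\<Union>i\<in>I. E i) \<le> (\<Sum>i\<in>I. P (E i))"
  unfolding P_def by (rule measure_pmf.finite_measure_subadditive_finite) auto

lemma P_Diff: "P (E - F) = P E - P (E \<inter> F)"
  unfolding P_def using measure_pmf.finite_measure_Diff'[of E _ F] by simp

lemma P_UNIV: "P UNIV = 1" by (simp add: P_def)

text \<open>
  Exchanging the colours outside \<open>W\<close> between two independent colourings is a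
  bijection that turns the event \<open>E \<times> F\<close> into \<open>(E \<inter> F)
  \<times> UNIV\<close>; counting gives the product formula.
\<close>

lemma P_indep:
  assumes "determined_by W E" "determined_by W' F" "W \<inter> W' = {}"
  shows "P (E \<inter> F) = P E * P F"
proof -
  define swap where "swap = (\<lambda>(x, y). ((\<lambda>v. if v \<in> W then x v else y v :: 'c), (\<lambda>v. if v \<in> W then y v else x v)))"
  have ss: "swap (swap q) = q" for q by (auto simp: swap_def split: prod.splits)
  have E: "fst (swap (x, y)) \<in> E \<longleftrightarrow> x \<in> E" for x y
    using assms(1) unfolding determined_by_def swap_def by (auto; metis)
  have F: "fst (swap (x, y)) \<in> F \<longleftrightarrow> y \<in> F" for x y
  proof -
    have "\<forall>v\<in>W'. fst (swap (x, y)) v = y v" using assms(3) by (auto simp: swap_def)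
    then show ?thesis using assms(2) unfolding determined_by_def by blast
  qed
  have O: "swap (x, y) \<in> colourings \<times> colourings" if "x \<in> colourings" "y \<in> colourings" for x y
    using that by (auto simp: swap_def colourings_def PiE_iff extensional_def)
  have "bij_betw swap ((colourings \<inter> E) \<times> (colourings \<inter> F)) ((colourings \<inter> (E \<inter> F)) \<times> colourings)"
  proof (rule bij_betw_byWitness[where f' = swap])
    show "swap ` ((colourings \<inter> E) \<times> (colourings \<inter> F)) \<subseteq> (colourings \<inter> (E \<inter> F)) \<times> colourings"
    proof (rule image_subsetI)
      fix q assume "q \<in> (colourings \<inter> E) \<times> (colourings \<inter> F)"
      then show "swap q \<in> (colourings \<inter> (E \<inter> F)) \<times> colourings"
        using E[of "fst q" "snd q"] F[of "fst q" "snd q"] O[of "fst q" "snd q"] by (simp add: mem_Times_iff)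
    qed
    show "swap ` ((colourings \<inter> (E \<inter> F)) \<times> colourings) \<subseteq> (colourings \<inter> E) \<times> (colourings \<inter> F)"
    proof (rule image_subsetI)
      fix q assume "q \<in> (colourings \<inter> (E \<inter> F)) \<times> colourings"
      then show "swap q \<in> (colourings \<inter> E) \<times> (colourings \<inter> F)"
        using E[of "fst (swap q)" "snd (swap q)"] F[of "fst (swap q)" "snd (swap q)"]
          O[of "fst q" "snd q"] ss[of q]
        by (simp add: mem_Times_iff)
    qed
  qed (auto simp: ss)
  then have "card (colourings \<inter> E) * card (colourings \<inter> F) = card (colourings \<inter> (E \<inter> F)) * card colourings"
    using bij_betw_same_card by (fastforce simp: card_cartesian_product)
  then have "real (card (colourings \<inter> E)) * card (colourings \<inter> F) = real (card (colourings \<inter> (E \<inter> F))) * card colourings"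
    by (metis of_nat_mult)
  moreover have "card colourings > 0" using finite_colourings colourings_nonempty by (simp add: card_gt_0_iff)
  ultimately show ?thesis unfolding P_eq by (simp add: field_simps)
qed

lemma P_INT_le:
  assumes "finite J" "\<And>i. i \<in> J \<Longrightarrow> determined_by (W i) (E i)" "\<And>i. i \<in> J \<Longrightarrow> P (E i) \<le> r"
    and "disjoint_family_on W J"
  shows "P (\<Inter>i\<in>J. E i) \<le> r ^ card J"
  using assms
proof (induction J rule: finite_induct)
  case empty
  then show ?case by (simp add: P_UNIV)
next
  case (insert i J)
  have IH: "P (\<Inter>i\<in>J. E i) \<le> r ^ card J"
    using insert.prems by (intro insert.IH) (auto simp: disjoint_family_on_def)
  have "determined_by (\<Union>i\<in>J. W i) (\<Inter>i\<in>J. E i)"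
    using insert.prems(1) by (intro determined_by_INT) (blast intro: determined_by_mono)
  moreover have "W i \<inter> (\<Union>i\<in>J. W i) = {}"
    using insert.prems(3) insert.hyps(2) by (auto simp: disjoint_family_on_def)
  ultimately have "P (E i \<inter> (\<Inter>i\<in>J. E i)) = P (E i) * P (\<Inter>i\<in>J. E i)"
    using insert.prems(1) by (intro P_indep) auto
  also have "\<dots> \<le> r * r ^ card J"
    using IH insert.prems(2)[of i] P_nonneg order_trans[OF P_nonneg insert.prems(2)[of i]]
    by (intro mult_mono) auto
  finally show ?case using insert.hyps by simp
qed

lemma P_cylinder:
  assumes "B \<subseteq> V" "\<And>t. t \<in> B \<Longrightarrow> f t \<in> C"
  shows "P {x. \<forall>t\<in>B. x t = f t} = (1 / card C) ^ card B"
proof -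
  have "colourings \<inter> {x. \<forall>t\<in>B. x t = f t} = (\<Pi>\<^sub>E s\<in>V. if s \<in> B then {f s} else C)"
    using assms by (auto simp: colourings_def PiE_iff split: if_splits)
  then have "card (colourings \<inter> {x. \<forall>t\<in>B. x t = f t}) = (\<Prod>s\<in>V. if s \<in> B then 1 else card C)"
    using finite_V by (simp add: card_PiE if_distrib cong: if_cong)
  also have "\<dots> = card C ^ card (V - B)"
  proof -
    have "(\<Prod>s\<in>V. if s \<in> B then 1 else card C) = (\<Prod>s\<in>V-B. card C)"
      using finite_V by (intro prod.mono_neutral_cong_right) auto
    then show ?thesis by simp
  qed
  finally have 1: "card (colourings \<inter> {x. \<forall>t\<in>B. x t = f t}) = card C ^ card (V - B)" .
  have 2: "card colourings = card C ^ card V" using finite_V by (simp add: colourings_def card_PiE)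
  have "card V = card B + card (V - B)"
    using assms(1) finite_V by (metis card_Diff_subset card_mono finite_subset le_add_diff_inverse)
  moreover have "card C > 0" using finite_C C_nonempty by (simp add: card_gt_0_iff)
  ultimately show ?thesis
    unfolding P_eq 1 2 by (simp add: power_add power_one_over)
qed

text \<open>
  The symmetric local lemma. The standard induction shows that, conditional on avoiding any
  other events, each event has at most twice its original bound: the events independent of it
  do not change its probability, and the remaining ones, at most \<open>d\<close> of them,
  together have conditional probability at most one half.
\<close>

lemma local_lemma:
  assumes "finite I"
    and det: "\<And>i. i \<in> I \<Longrightarrow> determined_by (W i) (E i)"
    and p: "\<And>i. i \<in> I \<Longrightarrow> P (E i) \<le> p"
    and d: "\<And>i. i \<in> I \<Longrightarrow> card {j\<in>I. W i \<inter> W j \<noteq> {}} \<le> d"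
    and "4 * p * real d \<le> 1" "1 \<le> d" "0 \<le> p"
  shows "\<exists>x\<in>colourings. \<forall>i\<in>I. x \<notin> E i"
proof -
  define avoid where "avoid J = {x. \<forall>j\<in>J. x \<notin> E j}" for J
  have "p * 1 \<le> p * real d" using assms by (intro mult_left_mono) auto
  then have p4: "4 * p \<le> 1" using assms by linarith
  have avoid_det: "determined_by W' (avoid J)" if "J \<subseteq> I" "\<And>j. j \<in> J \<Longrightarrow> W j \<subseteq> W'" for J W'
  proof -
    have "determined_by W' (E j)" if "j \<in> J" for j
      using determined_by_mono[OF det] that \<open>J \<subseteq> I\<close> \<open>\<And>j. j \<in> J \<Longrightarrow> W j \<subseteq> W'\<close> by blast
    then show ?thesis unfolding determined_by_def avoid_def by blast
  qed
  have main: "P (E i \<inter> avoid J) \<le> 2 * p * P (avoid J)" if "finite J" "J \<subseteq> I" "i \<in> I" for i J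
    using that
  proof (induction J arbitrary: i rule: finite_psubset_induct)
    case (psubset J)
    \<comment> \<open>the events that may depend on the i-th one are those outside J2\<close>
    define J2 where "J2 = {j\<in>J. W i \<inter> W j = {}}"
    have J2: "J2 \<subseteq> I" using psubset.prems by (auto simp: J2_def)
    have "P (E i \<inter> avoid J2) = P (E i) * P (avoid J2)"
      by (rule P_indep[of "W i" _ "\<Union>j\<in>J2. W j"])
        (use psubset.prems J2 in \<open>auto simp: J2_def intro!: det avoid_det\<close>)
    moreover have "P (E i \<inter> avoid J) \<le> P (E i \<inter> avoid J2)"
      by (rule P_mono) (auto simp: avoid_def J2_def)
    moreover have "P (E i) * P (avoid J2) \<le> p * P (avoid J2)"
      using p psubset.prems P_nonneg by (intro mult_right_mono) auto
    ultimately have 1: "P (E i \<inter> avoid J) \<le> p * P (avoid J2)" by linarith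
    have 2: "P (avoid J2) \<le> 2 * P (avoid J)"
    proof (cases "J2 = J")
      case True then show ?thesis using P_nonneg[of "avoid J"] by simp
    next
      case False
      then have J2J: "J2 \<subset> J" by (auto simp: J2_def)
      have fin: "finite (J - J2)" using psubset.hyps by simp
      have "avoid J2 - (\<Union>j\<in>J-J2. E j \<inter> avoid J2) \<subseteq> avoid J" by (auto simp: avoid_def)
      then have "P (avoid J2 - (\<Union>j\<in>J-J2. E j \<inter> avoid J2)) \<le> P (avoid J)" by (rule P_mono)
      moreover have "P (avoid J2 - (\<Union>j\<in>J-J2. E j \<inter> avoid J2)) \<ge> P (avoid J2) - P (\<Union>j\<in>J-J2. E j \<inter> avoid J2)"
        unfolding P_Diff using P_mono[of "avoid J2 \<inter> (\<Union>j\<in>J-J2. E j \<inter> avoid J2)" "\<Union>j\<in>J-J2. E j \<inter> avoid J2"]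
        by auto
      moreover have "P (\<Union>j\<in>J-J2. E j \<inter> avoid J2) \<le> (\<Sum>j\<in>J-J2. P (E j \<inter> avoid J2))"
        by (rule P_union_bound[OF fin])
      moreover have "(\<Sum>j\<in>J-J2. P (E j \<inter> avoid J2)) \<le> (\<Sum>j\<in>J-J2. 2 * p * P (avoid J2))"
        using psubset.IH[OF J2J J2] psubset.prems by (intro sum_mono) auto
      moreover have "(\<Sum>j\<in>J-J2. 2 * p * P (avoid J2)) \<le> real d * (2 * p * P (avoid J2))"
      proof -
        have "J - J2 \<subseteq> {j\<in>I. W i \<inter> W j \<noteq> {}}" using psubset.prems by (auto simp: J2_def)
        then have "card (J - J2) \<le> d"
          by (intro order_trans[OF card_mono d[OF psubset.prems(2)]]) (use \<open>finite I\<close> in auto)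
        then show ?thesis using \<open>0 \<le> p\<close> P_nonneg by (auto intro!: mult_right_mono)
      qed
      moreover have "real d * (2 * p * P (avoid J2)) \<le> P (avoid J2) / 2"
      proof -
        have "(4 * p * real d) * P (avoid J2) \<le> 1 * P (avoid J2)"
          using assms P_nonneg by (intro mult_right_mono) auto
        then show ?thesis by (simp add: algebra_simps)
      qed
      ultimately show ?thesis by linarith
    qed
    have "p * P (avoid J2) \<le> p * (2 * P (avoid J))" using 2 \<open>0 \<le> p\<close> by (rule mult_left_mono)
    then show ?case using 1 by simp
  qed
  have "0 < P (avoid J)" if "finite J" "J \<subseteq> I" for J
    using that
  proof (induction J rule: finite_induct)
    case empty then show ?case by (simp add: avoid_def P_UNIV)
  next
    case (insert i J)
    have "avoid (insert i J) = avoid J - E i" by (auto simp: avoid_def)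
    then have "P (avoid (insert i J)) = P (avoid J) - P (E i \<inter> avoid J)" by (simp add: P_Diff Int_commute)
    moreover have "P (E i \<inter> avoid J) \<le> 2 * p * P (avoid J)" using insert by (intro main) auto
    moreover have "2 * p * P (avoid J) \<le> 1/2 * P (avoid J)" using p4 P_nonneg by (intro mult_right_mono) auto
    moreover have "0 < P (avoid J)" using insert by auto
    ultimately show ?case by linarith
  qed
  then have "P (avoid I) > 0" using \<open>finite I\<close> by auto
  then have "colourings \<inter> avoid I \<noteq> {}" unfolding P_eq by (metis card.empty div_0 of_nat_0 less_irrefl)
  then show ?thesis by (auto simp: avoid_def)
qed

end

section \<open>Choosing sparse sites that meet many constraints\<close>

text \<open>
  Each constraint \<open>c\<close> owns \<open>4 m\<close> pairs of places \<open>u c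
  i\<close>, \<open>v c i\<close>, any two of which are far apart. The conclusion provides
  sets \<open>S0\<close>, \<open>S1\<close> of isolated places such that each constraint in
  \<open>T\<close> is served (a first place lies in \<open>S0\<close> and its partner in
  \<open>S1\<close>), although up to \<open>m\<close> of its pairs may be forbidden by
  \<open>X\<close>, while no constraint in \<open>T'\<close> sees more than \<open>m\<close>
  of its pairs come close to a chosen place.

  Colour all points uniformly with \<open>q\<close> colours, of which 0 and 1 mean ``put into
  \<open>S0\<close>, \<open>S1\<close>''; a place is chosen if no other point of its
  neighbourhood has colour 0 or 1. A constraint fails to be served only if none of at least
  \<open>3 m\<close> independent pairs is coloured ideally, which has probability
  exponentially small in \<open>m\<close>. As \<open>q\<close> is large compared with the size
  of a neighbourhood, a pair sees colour 0 or 1 with probability at most 1/64, so the union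
  bound over all sets of \<open>m\<close> pairs shows that seeing it in more than
  \<open>m\<close> of them has probability at most \<open>(1/4) ^ m\<close>. The degree of
  dependence \<open>d\<close> will grow only polynomially in \<open>m\<close>.
\<close>

lemma site_selection:
  fixes N :: "'v \<Rightarrow> 'v set" and u v :: "'c \<Rightarrow> 'i \<Rightarrow> 'v" and m d \<kappa> q :: nat
  defines "block \<equiv> \<lambda>c i. N (u c i) \<union> N (v c i)"
  assumes opts: "finite I" "card I = 4 * m" and T: "finite T'" "T \<subseteq> T'"
    and fin: "\<And>x. finite (N x)" and card: "\<And>x. card (N x) \<le> \<kappa>"
    and self: "\<And>c i. c \<in> T' \<Longrightarrow> i \<in> I \<Longrightarrow> u c i \<in> N (u c i) \<and> v c i \<in> N (v c i)"
    and uv: "\<And>c i. c \<in> T' \<Longrightarrow> i \<in> I \<Longrightarrow> N (u c i) \<inter> N (v c i) = {}"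
    and disj: "\<And>c. c \<in> T' \<Longrightarrow> disjoint_family_on (block c) I"
    and deg: "\<And>c. c \<in> T' \<Longrightarrow> card {c'\<in>T'. (\<Union>i\<in>I. block c i) \<inter> (\<Union>i\<in>I. block c' i) \<noteq> {}} \<le> d"
    and free: "\<And>c. c \<in> T \<Longrightarrow> card {i\<in>I. u c i \<in> X \<or> v c i \<in> X} \<le> m"
    and num: "q = 256 * \<kappa>" "1 \<le> \<kappa>" "1 \<le> d"
      "4 * ((1 - (1 / real q) ^ (2 * \<kappa>)) ^ m + (1/4) ^ m) * real d \<le> 1"
  obtains S0 S1 where
    "S0 \<union> S1 \<subseteq> (\<Union>c\<in>T. \<Union>i\<in>I. {u c i, v c i})" "(S0 \<union> S1) \<inter> X = {}" "S0 \<inter> S1 = {}"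
    "\<And>s s'. s \<in> S0 \<union> S1 \<Longrightarrow> s' \<in> S0 \<union> S1 \<Longrightarrow> s \<noteq> s' \<Longrightarrow> s' \<notin> N s"
    "\<And>c. c \<in> T \<Longrightarrow> \<exists>i\<in>I. u c i \<in> S0 \<and> v c i \<in> S1"
    "\<And>c. c \<in> T' \<Longrightarrow> card {i\<in>I. block c i \<inter> (S0 \<union> S1) \<noteq> {}} \<le> m"
proof -
  define V where "V = (\<Union>c\<in>T'. \<Union>i\<in>I. block c i)"
  have fin_block: "finite (block c i)" for c i using fin by (simp add: block_def)
  have card_block: "card (block c i) \<le> 2 * \<kappa>" for c i
    unfolding block_def using card_Un_le[of "N (u c i)" "N (v c i)"] card[of "u c i"] card[of "v c i"] by linarith
  have q: "q \<ge> 256" using num by simp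
  interpret random_colouring V "{..<q}"
    using opts(1) T(1) fin_block q by unfold_locales (auto simp: V_def lessThan_empty_iff)
  define coloured where "coloured c i = {x. \<exists>t\<in>block c i. x t < (2::nat)}" for c i
  define hit where "hit c i = {x. \<forall>t\<in>block c i. x t = (if t = u c i then 0 else if t = v c i then 1 else 2::nat)}" for c i
  \<comment> \<open>D: too many pairs see one of the colours 0 and 1; M: the constraint is missed\<close>
  define D where "D c = {x. m < card {i\<in>I. x \<in> coloured c i}}" for c
  define M where "M c = {x. c \<in> T \<and> (\<forall>i\<in>I. u c i \<notin> X \<and> v c i \<notin> X \<longrightarrow> x \<notin> hit c i)}" for c
  define W where "W c = (\<Union>i\<in>I. block c i)" for c
  define r where "r = 1 - (1 / real q) ^ (2 * \<kappa>)"
  have r: "0 \<le> r" "r \<le> 1" using q by (auto simp: r_def power_le_one)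

  have block_V: "block c i \<subseteq> V" if "c \<in> T'" "i \<in> I" for c i using that by (auto simp: V_def)
  have det_col: "determined_by (block c i) (coloured c i)" for c i
    by (auto simp: determined_by_def coloured_def)
  have det_hit: "determined_by (block c i) (- hit c i)" for c i
    by (auto simp: determined_by_def hit_def)
  have P_col: "P (coloured c i) \<le> 1/64" if "c \<in> T'" "i \<in> I" for c i
  proof -
    have single: "P {x. x t = k} = 1 / q" if "t \<in> block c i" "k < 2" for t k
      using P_cylinder[of "{t}" "\<lambda>_. k"] block_V[OF \<open>c \<in> T'\<close> \<open>i \<in> I\<close>] that q by auto
    have "coloured c i = (\<Union>(t, k)\<in>block c i \<times> {..<2}. {x. x t = k})"
      by (auto simp: coloured_def)
    then have "P (coloured c i) \<le> (\<Sum>a\<in>block c i \<times> {..<2}. P (case a of (t, k) \<Rightarrow> {x. x t = k}))"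
      using P_union_bound[of "block c i \<times> {..<2::nat}" "\<lambda>(t, k). {x. x t = k}"] fin_block by auto
    also have "\<dots> = (\<Sum>a\<in>block c i \<times> {..<2::nat}. 1 / q)"
      by (rule sum.cong) (auto simp: single)
    also have "\<dots> = card (block c i) * 2 / q" by (simp add: card_cartesian_product)
    also have "\<dots> \<le> (2 * \<kappa>) * 2 / q" using card_block[of c i] by (intro divide_right_mono) auto
    also have "\<dots> = 1/64" using num by simp
    finally show ?thesis .
  qed
  have P_hit: "P (- hit c i) \<le> r" if "c \<in> T'" "i \<in> I" for c i
  proof -
    have "P (hit c i) = (1 / card {..<q}) ^ card (block c i)"
      unfolding hit_def using block_V[OF that] q by (intro P_cylinder) auto
    moreover have "(1 / real q) ^ (2 * \<kappa>) \<le> (1 / real q) ^ card (block c i)"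
      using card_block[of c i] q by (intro power_decreasing) auto
    moreover have "P (- hit c i) = 1 - P (hit c i)" using P_Diff[of UNIV "hit c i"] P_UNIV by (simp add: Compl_eq_Diff_UNIV)
    ultimately show ?thesis by (simp add: r_def)
  qed
  have P_D: "P (D c) \<le> (1/4) ^ m" if "c \<in> T'" for c
  proof -
    define \<J> where "\<J> = {J. J \<subseteq> I \<and> card J = m}"
    have \<J>: "finite \<J>" "card \<J> \<le> 2 ^ (4 * m)"
    proof -
      show "finite \<J>" using opts by (simp add: \<J>_def)
      have "card \<J> \<le> card (Pow I)" using opts by (intro card_mono) (auto simp: \<J>_def)
      then show "card \<J> \<le> 2 ^ (4 * m)" using opts by (simp add: card_Pow)
    qed
    have "D c \<subseteq> (\<Union>J\<in>\<J>. \<Inter>i\<in>J. coloured c i)"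
    proof
      fix x assume "x \<in> D c"
      then have "m \<le> card {i\<in>I. x \<in> coloured c i}" by (simp add: D_def)
      then obtain J where "J \<subseteq> {i\<in>I. x \<in> coloured c i}" "card J = m"
        by (metis obtain_subset_with_card_n)
      then show "x \<in> (\<Union>J\<in>\<J>. \<Inter>i\<in>J. coloured c i)" by (auto simp: \<J>_def)
    qed
    then have "P (D c) \<le> P (\<Union>J\<in>\<J>. \<Inter>i\<in>J. coloured c i)" by (rule P_mono)
    also have "\<dots> \<le> (\<Sum>J\<in>\<J>. P (\<Inter>i\<in>J. coloured c i))" by (rule P_union_bound[OF \<J>(1)])
    also have "\<dots> \<le> (\<Sum>J\<in>\<J>. (1/64) ^ m)"
    proof (rule sum_mono)
      fix J assume J: "J \<in> \<J>"
      then have "finite J" using opts finite_subset by (auto simp: \<J>_def)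
      then have "P (\<Inter>i\<in>J. coloured c i) \<le> (1/64) ^ card J"
        using J disj[OF that] by (intro P_INT_le[where W = "block c"])
          (use P_col[OF that] in \<open>auto simp: \<J>_def det_col intro: disjoint_family_on_mono\<close>)
      then show "P (\<Inter>i\<in>J. coloured c i) \<le> (1/64) ^ m" using J by (simp add: \<J>_def)
    qed
    also have "\<dots> = real (card \<J>) * (1/64) ^ m" by simp
    also have "\<dots> \<le> 2 ^ (4 * m) * (1/64) ^ m"
      using \<J>(2) of_nat_mono[OF \<J>(2), where 'a = real] by (intro mult_right_mono) auto
    also have "\<dots> = (1/4) ^ m" by (simp add: power_mult power_mult_distrib[symmetric])
    finally show ?thesis .
  qed
  have P_M: "P (M c) \<le> r ^ m" if "c \<in> T'" for c
  proof (cases "c \<in> T")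
    case False
    then have "M c = {}" by (simp add: M_def)
    then show ?thesis using r P_eq[of "{}"] by simp
  next
    case True
    define J where "J = I - {i\<in>I. u c i \<in> X \<or> v c i \<in> X}"
    have J: "finite J" "J \<subseteq> I" using opts by (auto simp: J_def)
    have "card J = card I - card {i\<in>I. u c i \<in> X \<or> v c i \<in> X}"
      unfolding J_def using opts by (intro card_Diff_subset) auto
    then have Jm: "m \<le> card J" using free[OF True] opts by linarith
    have "P (M c) \<le> P (\<Inter>i\<in>J. - hit c i)" by (rule P_mono) (auto simp: M_def J_def)
    also have "\<dots> \<le> r ^ card J"
      using J disj[OF that] by (intro P_INT_le[where W = "block c"])
        (auto intro!: det_hit P_hit that intro: disjoint_family_on_mono)
    also have "\<dots> \<le> r ^ m" using Jm r by (intro power_decreasing) auto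
    finally show ?thesis .
  qed
  have det: "determined_by (W c) (D c \<union> M c)" for c
  proof -
    have "x \<in> D c \<union> M c \<longleftrightarrow> y \<in> D c \<union> M c" if xy: "\<forall>t\<in>W c. x t = y t" for x y
    proof -
      have "x \<in> coloured c i \<longleftrightarrow> y \<in> coloured c i" "x \<in> hit c i \<longleftrightarrow> y \<in> hit c i" if "i \<in> I" for i
        using det_col[of c i] det_hit[of c i] xy that unfolding determined_by_def W_def by blast+
      then have "{i\<in>I. x \<in> coloured c i} = {i\<in>I. y \<in> coloured c i}" "x \<in> M c \<longleftrightarrow> y \<in> M c"
        by (auto simp: M_def)
      then show ?thesis by (simp add: D_def)
    qed
    then show ?thesis unfolding determined_by_def by blast
  qed
  have P_DM: "P (D c \<union> M c) \<le> r ^ m + (1/4) ^ m" if "c \<in> T'" for c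
    using P_union_bound[of "{True, False}" "\<lambda>b. if b then D c else M c"] P_D[OF that] P_M[OF that] by (simp add: Un_commute)
  have "\<exists>x\<in>colourings. \<forall>c\<in>T'. x \<notin> D c \<union> M c"
    by (rule local_lemma[of T' W _ "r ^ m + (1/4) ^ m" d])
      (use det P_DM T(1) deg num r in \<open>auto simp: W_def r_def\<close>)
  then obtain x where x: "\<And>c. c \<in> T' \<Longrightarrow> x \<notin> D c" "\<And>c. c \<in> T' \<Longrightarrow> x \<notin> M c" by blast
  define S where "S k = {s \<in> (\<Union>c\<in>T. \<Union>i\<in>I. {u c i, v c i}). s \<notin> X \<and> x s = k \<and> (\<forall>t\<in>N s. t \<noteq> s \<longrightarrow> \<not> x t < 2)}" for k
  show thesis
  proof
    show "S 0 \<union> S 1 \<subseteq> (\<Union>c\<in>T. \<Union>i\<in>I. {u c i, v c i})" "(S 0 \<union> S 1) \<inter> X = {}" "S 0 \<inter> S 1 = {}"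
      by (auto simp: S_def)
    show "s' \<notin> N s" if "s \<in> S 0 \<union> S 1" "s' \<in> S 0 \<union> S 1" "s \<noteq> s'" for s s'
    proof
      assume "s' \<in> N s"
      then have "\<not> x s' < 2" using that(1,3) by (auto simp: S_def)
      then show False using that(2) by (auto simp: S_def)
    qed
    show "\<exists>i\<in>I. u c i \<in> S 0 \<and> v c i \<in> S 1" if c: "c \<in> T" for c
    proof -
      obtain i where i: "i \<in> I" "u c i \<notin> X" "v c i \<notin> X" "x \<in> hit c i"
        using x(2)[of c] c T(2) by (auto simp: M_def)
      have c': "c \<in> T'" using c T(2) by auto
      have u: "u c i \<in> block c i" "v c i \<in> block c i" "u c i \<noteq> v c i" "u c i \<notin> N (v c i)" "v c i \<notin> N (u c i)"
        using self[OF c' i(1)] uv[OF c' i(1)] by (auto simp: block_def)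
      have *: "x t = (if t = u c i then 0 else if t = v c i then 1 else 2)" if "t \<in> block c i" for t
        using i(4) that by (simp add: hit_def)
      have "\<forall>t\<in>N (u c i). t \<noteq> u c i \<longrightarrow> \<not> x t < 2" "\<forall>t\<in>N (v c i). t \<noteq> v c i \<longrightarrow> \<not> x t < 2"
        using * u(4,5) by (auto simp: block_def)
      moreover have "x (u c i) = 0" "x (v c i) = 1" using *[OF u(1)] *[OF u(2)] u(3) by auto
      ultimately have "u c i \<in> S 0" "v c i \<in> S 1" using i c by (auto simp: S_def)
      then show ?thesis using i(1) by blast
    qed
    show "card {i\<in>I. block c i \<inter> (S 0 \<union> S 1) \<noteq> {}} \<le> m" if "c \<in> T'" for c
    proof -
      have "card {i\<in>I. block c i \<inter> (S 0 \<union> S 1) \<noteq> {}} \<le> card {i\<in>I. x \<in> coloured c i}"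
        using opts(1) by (intro card_mono) (auto simp: S_def coloured_def, (metis less_2_cases_iff One_nat_def)+)
      then show ?thesis using x(1)[OF that] by (auto simp: D_def)
    qed
  qed
qed

lemma eventually_local_lemma_bound:
  fixes r K :: real
  assumes "0 \<le> r" "r < 1"
  shows "\<forall>\<^sub>F m :: nat in sequentially. 4 * (r ^ m + (1/4) ^ m) * (K * real m ^ 2) \<le> 1"
proof -
  have lim: "(\<lambda>m::nat. real m ^ 2 * x ^ m) \<longlonglongrightarrow> 0" if "0 \<le> x" "x < 1" for x :: real
  proof (cases "x = 0")
    case True
    have "\<forall>\<^sub>F m::nat in sequentially. 0 = real m ^ 2 * x ^ m"
      using eventually_gt_at_top[of 0] by eventually_elim (simp add: True)
    then show ?thesis by (rule Lim_transform_eventually[OF tendsto_const])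
  next
    case False
    then have "0 < x" using that by simp
    then show ?thesis using \<open>x < 1\<close> by real_asymp
  qed
  have "(\<lambda>m::nat. 4 * K * (real m ^ 2 * r ^ m + real m ^ 2 * (1/4) ^ m)) \<longlonglongrightarrow> 4 * K * (0 + 0)"
    using assms by (intro tendsto_intros lim) auto
  then have "\<forall>\<^sub>F m::nat in sequentially. 4 * K * (real m ^ 2 * r ^ m + real m ^ 2 * (1/4) ^ m) < 1"
    by (rule order_tendstoD(2)) simp
  then show ?thesis by eventually_elim (simp add: algebra_simps)
qed

context group
begin

lemma mem_set_mult: "x \<in> A <#> B \<longleftrightarrow> (\<exists>a\<in>A. \<exists>b\<in>B. x = a \<otimes> b)"
  by (auto simp: set_mult_def)

lemma inv_mult_cancel: "a \<in> carrier G \<Longrightarrow> x \<in> carrier G \<Longrightarrow> inv a \<otimes> (a \<otimes> x) = x"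
  by (simp add: m_assoc[symmetric])

lemma finite_set_mult: "finite A \<Longrightarrow> finite B \<Longrightarrow> finite (A <#> B)"
  by (auto simp: set_mult_def)

definition nbhd :: "'a set \<Rightarrow> 'a \<Rightarrow> 'a set" where
  "nbhd Q x = (\<lambda>q. q \<otimes> x) ` Q"

definition symmetric_finite :: "'a set \<Rightarrow> bool" where
  "symmetric_finite Q \<longleftrightarrow> finite Q \<and> Q \<subseteq> carrier G \<and> \<one> \<in> Q \<and> (\<forall>q\<in>Q. inv q \<in> Q)"

text \<open>
  A set of pairs is plentiful if one can choose from it, again and again, a pair that is far
  from everything chosen before and whose two entries are far from each other.
\<close>

definition plentiful :: "('a \<times> 'a) set \<Rightarrow> bool" where
  "plentiful R \<longleftrightarrow> R \<subseteq> carrier G \<times> carrier G \<and>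
     (\<forall>Y. finite Y \<longrightarrow> (\<exists>(u, v)\<in>R. u \<notin> Y \<and> v \<notin> Y \<and> v \<otimes> inv u \<notin> Y))"

abbreviation pair_nbhd :: "'a set \<Rightarrow> 'a \<times> 'a \<Rightarrow> 'a \<Rightarrow> 'a set" where
  "pair_nbhd Q i h \<equiv> nbhd Q (fst i \<otimes> h) \<union> nbhd Q (snd i \<otimes> h)"

text \<open>
  The conclusion of \<open>site_selection\<close> for the constraints \<open>h \<in>
  \<Gamma>\<close> with the pairs of places \<open>(u \<otimes> h, v \<otimes> h)\<close>,
  \<open>(u, v) \<in> P\<close>, and \<open>nbhd Q\<close> as the notion of closeness. Only
  finitely many elements ask to be served, but the bound on used pairs holds for all of
  \<open>\<Gamma>\<close>.
\<close>

definition selects_sites :: "'a set \<Rightarrow> nat \<Rightarrow> ('a \<times> 'a) set \<Rightarrow> bool" where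
  "selects_sites Q m P \<longleftrightarrow> (\<forall>T X. finite T \<longrightarrow> T \<subseteq> carrier G \<longrightarrow>
     (\<forall>h\<in>T. card {i\<in>P. fst i \<otimes> h \<in> X \<or> snd i \<otimes> h \<in> X} \<le> m) \<longrightarrow>
     (\<exists>S0 S1. S0 \<union> S1 \<subseteq> (\<Union>h\<in>T. \<Union>i\<in>P. {fst i \<otimes> h, snd i \<otimes> h}) \<and> (S0 \<union> S1) \<inter> X = {} \<and> S0 \<inter> S1 = {} \<and>
        (\<forall>s\<in>S0 \<union> S1. \<forall>s'\<in>S0 \<union> S1. s \<noteq> s' \<longrightarrow> s' \<notin> nbhd Q s) \<and>
        (\<forall>h\<in>T. \<exists>i\<in>P. fst i \<otimes> h \<in> S0 \<and> snd i \<otimes> h \<in> S1) \<and>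
        (\<forall>h\<in>carrier G. card {i\<in>P. pair_nbhd Q i h \<inter> (S0 \<union> S1) \<noteq> {}} \<le> m)))"

lemma nbhd_meet:
  assumes "symmetric_finite Q" "x \<in> carrier G" "y \<in> carrier G" "nbhd Q x \<inter> nbhd Q y \<noteq> {}"
  shows "\<exists>r\<in>Q <#> Q. y = r \<otimes> x"
proof -
  have Q: "Q \<subseteq> carrier G" "\<And>q. q \<in> Q \<Longrightarrow> inv q \<in> Q" using assms by (auto simp: symmetric_finite_def)
  obtain a b where ab: "a \<in> Q" "b \<in> Q" "a \<otimes> x = b \<otimes> y" using assms(4) by (auto simp: nbhd_def)
  have c: "a \<in> carrier G" "b \<in> carrier G" using ab Q by auto
  have "y = inv b \<otimes> (b \<otimes> y)" using assms c by (simp add: m_assoc[symmetric])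
  also have "\<dots> = (inv b \<otimes> a) \<otimes> x" using assms c ab(3) by (simp add: m_assoc)
  finally have "y = (inv b \<otimes> a) \<otimes> x" .
  moreover have "inv b \<otimes> a \<in> Q <#> Q" using Q(2)[OF ab(2)] ab(1) by (auto simp: mem_set_mult)
  ultimately show ?thesis by blast
qed

lemma nbhd_shift:
  assumes "Q \<subseteq> carrier G" "x \<in> carrier G" "h \<in> carrier G"
  shows "nbhd Q (x \<otimes> h) = (\<lambda>z. z \<otimes> h) ` nbhd Q x"
  using assms by (force simp: nbhd_def m_assoc image_iff)

lemma nbhd_closed: "Q \<subseteq> carrier G \<Longrightarrow> x \<in> carrier G \<Longrightarrow> nbhd Q x \<subseteq> carrier G"
  by (auto simp: nbhd_def)

lemma shift_disjoint:
  assumes "X \<subseteq> carrier G" "Y \<subseteq> carrier G" "h \<in> carrier G" "X \<inter> Y = {}"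
  shows "(\<lambda>z. z \<otimes> h) ` X \<inter> (\<lambda>z. z \<otimes> h) ` Y = {}"
proof -
  have "inj_on (\<lambda>z. z \<otimes> h) (X \<union> Y)" using assms by (auto simp: inj_on_def subset_iff)
  then have "(\<lambda>z. z \<otimes> h) ` (X \<inter> Y) = (\<lambda>z. z \<otimes> h) ` X \<inter> (\<lambda>z. z \<otimes> h) ` Y"
    by (rule inj_on_image_Int) auto
  then show ?thesis using assms(4) by simp
qed

lemma separated_pairs:
  assumes R: "plentiful R" and Q: "symmetric_finite Q"
  shows "\<exists>P. P \<subseteq> R \<and> finite P \<and> card P = n \<and> (\<forall>i\<in>P. nbhd Q (fst i) \<inter> nbhd Q (snd i) = {}) \<and>
    disjoint_family_on (\<lambda>i. nbhd Q (fst i) \<union> nbhd Q (snd i)) P"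
proof (induction n)
  case 0
  show ?case by (intro exI[of _ "{}"]) (auto simp: disjoint_family_on_def)
next
  case (Suc n)
  then obtain P where P: "P \<subseteq> R" "finite P" "card P = n" "\<forall>i\<in>P. nbhd Q (fst i) \<inter> nbhd Q (snd i) = {}"
    "disjoint_family_on (\<lambda>i. nbhd Q (fst i) \<union> nbhd Q (snd i)) P" by blast
  have RC: "R \<subseteq> carrier G \<times> carrier G" using R by (simp add: plentiful_def)
  have Qf: "finite Q" "Q \<subseteq> carrier G" "\<one> \<in> Q" using Q by (auto simp: symmetric_finite_def)
  define U where "U = fst ` P \<union> snd ` P"
  define Y where "Y = (Q <#> Q) \<union> (\<Union>x\<in>U. nbhd (Q <#> Q) x)"
  have UC: "U \<subseteq> carrier G" using P(1) RC by (auto simp: U_def)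
  have "finite Y" using P(2) Qf by (auto simp: Y_def U_def nbhd_def intro: finite_set_mult)
  then obtain u v where uv: "(u, v) \<in> R" "u \<notin> Y" "v \<notin> Y" "v \<otimes> inv u \<notin> Y"
    using R unfolding plentiful_def by blast
  have uvC: "u \<in> carrier G" "v \<in> carrier G" using uv RC by auto
  have old: "nbhd Q x \<inter> nbhd Q y = {}" if "x \<in> U" "y \<in> carrier G" "y \<notin> Y" for x y
    using nbhd_meet[OF Q, of x y] that UC by (auto simp: Y_def nbhd_def)
  have new: "nbhd Q u \<inter> nbhd Q v = {}"
  proof (rule ccontr)
    assume "nbhd Q u \<inter> nbhd Q v \<noteq> {}"
    then obtain r where r: "r \<in> Q <#> Q" "v = r \<otimes> u" using nbhd_meet[OF Q uvC] by auto
    have "r \<in> carrier G" using r Qf set_mult_closed by blast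
    then have "v \<otimes> inv u = r" using r uvC by (simp add: m_assoc)
    then show False using r uv(4) by (simp add: Y_def)
  qed
  have fresh: "(nbhd Q (fst i) \<union> nbhd Q (snd i)) \<inter> (nbhd Q u \<union> nbhd Q v) = {}" if "i \<in> P" for i
  proof -
    have "fst i \<in> U" "snd i \<in> U" using that by (auto simp: U_def)
    then show ?thesis using old[OF _ uvC(1) uv(2)] old[OF _ uvC(2) uv(3)] by (simp add: Int_Un_distrib Int_Un_distrib2)
  qed
  have "(u, v) \<notin> P"
    using fresh[of "(u, v)"] Qf(3) by (auto simp: nbhd_def)
  moreover have "disjoint_family_on (\<lambda>i. nbhd Q (fst i) \<union> nbhd Q (snd i)) (insert (u, v) P)"
    using P(5) fresh by (force simp: disjoint_family_on_def)
  ultimately show ?case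
    using P uv(1) new by (intro exI[of _ "insert (u, v) P"]) auto
qed

text \<open>
  By translation invariance the dependence between constraints is bounded by the number of
  quotients of elements of \<open>Q\<close> and of entries of \<open>P\<close>, which is
  quadratic in \<open>m\<close>, and the exponential bounds of the local lemma win. The lower
  bound \<open>b\<close> lets \<open>m\<close> be as large as desired.
\<close>

lemma sites_in_group:
  assumes R: "plentiful R" and Q: "symmetric_finite Q"
  obtains m P where "b \<le> m" "P \<subseteq> R" "finite P" "card P = 4 * m" "inj_on fst P" "inj_on snd P"
    "selects_sites Q m P"
proof -
  have RC: "R \<subseteq> carrier G \<times> carrier G" using R by (simp add: plentiful_def)
  have Qf: "finite Q" "Q \<subseteq> carrier G" "\<one> \<in> Q" using Q by (auto simp: symmetric_finite_def)
  define \<kappa> where "\<kappa> = card Q"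
  define q where "q = 256 * \<kappa>"
  have \<kappa>: "1 \<le> \<kappa>" using Qf by (auto simp: \<kappa>_def Suc_le_eq card_gt_0_iff)
  define r where "r = 1 - (1 / real q) ^ (2 * \<kappa>)"
  have "0 \<le> r" "r < 1" using \<kappa> by (auto simp: r_def q_def power_le_one)
  then have "\<forall>\<^sub>F m::nat in sequentially. 4 * (r ^ m + (1/4) ^ m) * (64 * real \<kappa> ^ 2 * real m ^ 2) \<le> 1"
    by (rule eventually_local_lemma_bound)
  moreover have "\<forall>\<^sub>F m::nat in sequentially. max 1 b \<le> m" by (rule eventually_ge_at_top)
  ultimately have "\<forall>\<^sub>F m::nat in sequentially. 4 * (r ^ m + (1/4) ^ m) * (64 * real \<kappa> ^ 2 * real m ^ 2) \<le> 1 \<and> max 1 b \<le> m"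
    by (rule eventually_conj)
  then obtain m :: nat where m: "4 * (r ^ m + (1/4) ^ m) * (64 * real \<kappa> ^ 2 * real m ^ 2) \<le> 1" "1 \<le> m" "b \<le> m"
    unfolding eventually_sequentially by (metis le_refl max.bounded_iff)
  define d where "d = (8 * m * \<kappa>) ^ 2"
  have d: "4 * ((1 - (1 / real q) ^ (2 * \<kappa>)) ^ m + (1/4) ^ m) * real d \<le> 1" "1 \<le> d"
    using m \<kappa> by (auto simp: d_def r_def power_mult_distrib algebra_simps)
  obtain P where P: "P \<subseteq> R" "finite P" "card P = 4 * m" "\<forall>i\<in>P. nbhd Q (fst i) \<inter> nbhd Q (snd i) = {}"
    "disjoint_family_on (\<lambda>i. nbhd Q (fst i) \<union> nbhd Q (snd i)) P"
    using separated_pairs[OF R Q, of "4 * m"] by blast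
  have PC: "fst i \<in> carrier G" "snd i \<in> carrier G" if "i \<in> P" for i using that P(1) RC by auto
  have self: "x \<in> nbhd Q x" if "x \<in> carrier G" for x
    using that Qf by (force simp: nbhd_def)
  have inj: "inj_on fst P" "inj_on snd P"
  proof -
    have "i = j" if "i \<in> P" "j \<in> P" "fst i = fst j \<or> snd i = snd j" for i j
    proof (rule ccontr)
      assume "i \<noteq> j"
      then have "(nbhd Q (fst i) \<union> nbhd Q (snd i)) \<inter> (nbhd Q (fst j) \<union> nbhd Q (snd j)) = {}"
        using P(5) that unfolding disjoint_family_on_def by blast
      then show False using self[OF PC(1)[OF that(1)]] self[OF PC(2)[OF that(1)]] that(3) by auto
    qed
    then show "inj_on fst P" "inj_on snd P" by (auto simp: inj_on_def)
  qed
  have finb: "finite (nbhd Q x)" and cardb: "card (nbhd Q x) \<le> \<kappa>" for x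
    using Qf by (auto simp: nbhd_def \<kappa>_def card_image_le)
  have pair_shift: "pair_nbhd Q i h = (\<lambda>z. z \<otimes> h) ` (nbhd Q (fst i) \<union> nbhd Q (snd i))"
    if "i \<in> P" "h \<in> carrier G" for i h
    using nbhd_shift[OF Qf(2) _ that(2)] PC[OF that(1)] by (simp add: image_Un)
  define U where "U = fst ` P \<union> snd ` P"
  have U: "finite U" "U \<subseteq> carrier G" "card U \<le> 8 * m"
  proof -
    show "finite U" "U \<subseteq> carrier G" using P(2) PC by (auto simp: U_def)
    have "card U \<le> card (fst ` P) + card (snd ` P)" unfolding U_def by (rule card_Un_le)
    then show "card U \<le> 8 * m" using card_image_le[OF P(2), of fst] card_image_le[OF P(2), of snd] P(3) by linarith
  qed
  show thesis
  proof (rule that[OF m(3) P(1-3) inj], unfold selects_sites_def, intro allI impI)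
    fix T X
    assume T: "finite T" "T \<subseteq> carrier G"
      and free: "\<forall>h\<in>T. card {i\<in>P. fst i \<otimes> h \<in> X \<or> snd i \<otimes> h \<in> X} \<le> m"
    define Sites where "Sites = (\<Union>h\<in>T. \<Union>i\<in>P. {fst i \<otimes> h, snd i \<otimes> h})"
    have Sites: "finite Sites" "Sites \<subseteq> carrier G" using T P(2) PC by (auto simp: Sites_def)
    \<comment> \<open>constraints whose pairs could come close to a site that serves T\<close>
    define near where "near = (\<lambda>(q, y, s). inv (q \<otimes> y) \<otimes> s) ` (Q \<times> U \<times> Sites)"
    define T' where "T' = T \<union> near"
    have T': "finite T'" "T' \<subseteq> carrier G" "T \<subseteq> T'"
    proof -
      show "finite T'" using T Sites U Qf by (auto simp: T'_def near_def)
      show "T' \<subseteq> carrier G" using T Sites(2) U(2) Qf(2) by (auto simp: T'_def near_def subset_iff)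
      show "T \<subseteq> T'" by (simp add: T'_def)
    qed
    have solve: "h = inv (a \<otimes> y) \<otimes> s" if "a \<otimes> (y \<otimes> h) = s" "a \<in> Q" "y \<in> U" "h \<in> carrier G" for a y h s
    proof -
      have "a \<in> carrier G" "y \<in> carrier G" using that Qf U by auto
      then show ?thesis using that(1,4) by (auto simp: inv_mult_group m_assoc inv_mult_cancel)
    qed
    obtain S0 S1 where S:
      "S0 \<union> S1 \<subseteq> (\<Union>c\<in>T. \<Union>i\<in>P. {fst i \<otimes> c, snd i \<otimes> c})" "(S0 \<union> S1) \<inter> X = {}" "S0 \<inter> S1 = {}"
      "\<And>s s'. s \<in> S0 \<union> S1 \<Longrightarrow> s' \<in> S0 \<union> S1 \<Longrightarrow> s \<noteq> s' \<Longrightarrow> s' \<notin> nbhd Q s"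
      "\<And>c. c \<in> T \<Longrightarrow> \<exists>i\<in>P. fst i \<otimes> c \<in> S0 \<and> snd i \<otimes> c \<in> S1"
      "\<And>c. c \<in> T' \<Longrightarrow> card {i\<in>P. pair_nbhd Q i c \<inter> (S0 \<union> S1) \<noteq> {}} \<le> m"
    proof (rule site_selection[where I = P and m = m and T = T and T' = T' and N = "nbhd Q" and \<kappa> = \<kappa>
          and u = "\<lambda>h i. fst i \<otimes> h" and v = "\<lambda>h i. snd i \<otimes> h" and d = d and X = X and q = q])
      fix c assume c: "c \<in> T'"
      then have cC: "c \<in> carrier G" using T' by auto
      show "disjoint_family_on (\<lambda>i. pair_nbhd Q i c) P"
        unfolding disjoint_family_on_def
      proof (intro ballI impI)
        fix i j assume ij: "i \<in> P" "j \<in> P" "i \<noteq> j"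
        then have "(nbhd Q (fst i) \<union> nbhd Q (snd i)) \<inter> (nbhd Q (fst j) \<union> nbhd Q (snd j)) = {}"
          using P(5) by (auto simp: disjoint_family_on_def)
        then show "pair_nbhd Q i c \<inter> pair_nbhd Q j c = {}"
          unfolding pair_shift[OF ij(1) cC] pair_shift[OF ij(2) cC]
          by (intro shift_disjoint cC) (use PC ij nbhd_closed Qf(2) in auto)
      qed
      show "card {c'\<in>T'. (\<Union>i\<in>P. pair_nbhd Q i c) \<inter> (\<Union>i\<in>P. pair_nbhd Q i c') \<noteq> {}} \<le> d"
      proof -
        let ?f = "\<lambda>((a, y), (b, z)). inv (b \<otimes> z) \<otimes> (a \<otimes> (y \<otimes> c))"
        let ?D = "(Q \<times> U) \<times> (Q \<times> U)"
        have "{c'\<in>T'. (\<Union>i\<in>P. pair_nbhd Q i c) \<inter> (\<Union>i\<in>P. pair_nbhd Q i c') \<noteq> {}} \<subseteq> ?f ` ?D"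
        proof clarify
          fix c' x i j assume c': "c' \<in> T'" and "(\<Union>i\<in>P. pair_nbhd Q i c) \<inter> (\<Union>i\<in>P. pair_nbhd Q i c') \<noteq> {}"
          then obtain x i j where x: "i \<in> P" "j \<in> P" "x \<in> pair_nbhd Q i c" "x \<in> pair_nbhd Q j c'" by blast
          obtain a y where ay: "a \<in> Q" "y \<in> U" "x = a \<otimes> (y \<otimes> c)" using x(1,3) by (auto simp: nbhd_def U_def)
          obtain b z where bz: "b \<in> Q" "z \<in> U" "x = b \<otimes> (z \<otimes> c')" using x(2,4) by (auto simp: nbhd_def U_def)
          have "c' = ?f ((a, y), (b, z))"
            using solve[OF bz(3)[symmetric] bz(1,2)] c' T' ay(3) by auto
          then show "c' \<in> ?f ` ?D" using ay bz by blast
        qed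
        moreover have "finite ?D" using Qf U by auto
        ultimately have "card {c'\<in>T'. (\<Union>i\<in>P. pair_nbhd Q i c) \<inter> (\<Union>i\<in>P. pair_nbhd Q i c') \<noteq> {}} \<le> card ?D"
          by (meson card_image_le card_mono finite_imageI le_trans)
        also have "\<dots> = (\<kappa> * card U) ^ 2" by (simp add: card_cartesian_product \<kappa>_def power2_eq_square)
        also have "\<dots> \<le> d" unfolding d_def using U(3) by (intro power_mono) (simp_all add: mult.commute mult_le_mono)
        finally show ?thesis .
      qed
      fix i assume i: "i \<in> P"
      show "fst i \<otimes> c \<in> nbhd Q (fst i \<otimes> c) \<and> snd i \<otimes> c \<in> nbhd Q (snd i \<otimes> c)"
        using self PC[OF i] cC by simp
      show "nbhd Q (fst i \<otimes> c) \<inter> nbhd Q (snd i \<otimes> c) = {}"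
        using P(4) i PC[OF i] cC nbhd_closed[OF Qf(2)]
        by (simp add: nbhd_shift Qf(2) shift_disjoint)
    next
      show "finite P" "card P = 4 * m" "finite T'" "T \<subseteq> T'" "1 \<le> \<kappa>" "1 \<le> d" "q = 256 * \<kappa>"
        by (fact P T' \<kappa> d q_def)+
      show "4 * ((1 - (1 / real q) ^ (2 * \<kappa>)) ^ m + (1/4) ^ m) * real d \<le> 1" by (fact d)
      show "finite (nbhd Q x)" "card (nbhd Q x) \<le> \<kappa>" for x by (fact finb cardb)+
      show "card {i\<in>P. fst i \<otimes> c \<in> X \<or> snd i \<otimes> c \<in> X} \<le> m" if "c \<in> T" for c using that free by blast
    qed (rule that; assumption)
    have "card {i\<in>P. pair_nbhd Q i h \<inter> (S0 \<union> S1) \<noteq> {}} \<le> m" if h: "h \<in> carrier G" for h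
    proof (cases "h \<in> T'")
      case True then show ?thesis by (rule S(6))
    next
      case False
      have "pair_nbhd Q i h \<inter> (S0 \<union> S1) = {}" if i: "i \<in> P" for i
      proof (rule ccontr)
        assume "pair_nbhd Q i h \<inter> (S0 \<union> S1) \<noteq> {}"
        then obtain s where s: "s \<in> Sites" "s \<in> pair_nbhd Q i h" using S(1) unfolding Sites_def by blast
        then obtain a y where ay: "a \<in> Q" "y \<in> U" "s = a \<otimes> (y \<otimes> h)" using i by (auto simp: nbhd_def U_def)
        then have "h = (\<lambda>(q, y, s). inv (q \<otimes> y) \<otimes> s) (a, y, s)" using solve[OF ay(3)[symmetric] ay(1,2) h] by simp
        then have "h \<in> near" unfolding near_def using ay s by blast
        then show False using False by (simp add: T'_def)
      qed
      then show ?thesis by (simp cong: conj_cong)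
    qed
    then show "\<exists>S0 S1. S0 \<union> S1 \<subseteq> (\<Union>h\<in>T. \<Union>i\<in>P. {fst i \<otimes> h, snd i \<otimes> h}) \<and> (S0 \<union> S1) \<inter> X = {} \<and> S0 \<inter> S1 = {} \<and>
        (\<forall>s\<in>S0 \<union> S1. \<forall>s'\<in>S0 \<union> S1. s \<noteq> s' \<longrightarrow> s' \<notin> nbhd Q s) \<and>
        (\<forall>h\<in>T. \<exists>i\<in>P. fst i \<otimes> h \<in> S0 \<and> snd i \<otimes> h \<in> S1) \<and>
        (\<forall>h\<in>carrier G. card {i\<in>P. pair_nbhd Q i h \<inter> (S0 \<union> S1) \<noteq> {}} \<le> m)"
      using S(1-5) by (intro exI[of _ S0] exI[of _ S1] conjI) auto
  qed
qed

end

section \<open>Finite patterns and their refinement\<close>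

context group
begin

definition translate :: "('a \<rightharpoonup> bool) \<Rightarrow> 'a \<Rightarrow> ('a \<rightharpoonup> bool)" where
  "translate p s = (\<lambda>x. if x \<in> carrier G then p (x \<otimes> inv s) else None)"

definition placed :: "('a \<rightharpoonup> bool) \<Rightarrow> 'a \<Rightarrow> ('a \<rightharpoonup> bool) \<Rightarrow> bool" where
  "placed w s p \<longleftrightarrow> (\<forall>a\<in>dom w. p (a \<otimes> s) = w a)"

text \<open>
  The families of partial colourings that the construction runs through. The window
  \<open>K\<close> measures both how far apart two patterns have to be in order to coexist,
  and how far the extension of a pattern by a new point may reach. The bound on the extension
  is what makes a refinement of the family possible: an extension disturbs only a controlled
  region.
\<close>

definition pattern_family :: "'a set \<Rightarrow> ('a \<rightharpoonup> bool) set \<Rightarrow> bool" where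
  "pattern_family K \<G> \<longleftrightarrow> symmetric_finite K \<and>
     (\<forall>p\<in>\<G>. finite (dom p) \<and> dom p \<subseteq> carrier G) \<and>
     (\<forall>p\<in>\<G>. \<forall>s\<in>carrier G. translate p s \<in> \<G>) \<and>
     (\<forall>p\<in>\<G>. \<forall>q\<in>\<G>. dom p \<inter> (K <#> dom q) = {} \<longrightarrow> p ++ q \<in> \<G>) \<and>
     (\<forall>p\<in>\<G>. \<forall>g\<in>carrier G. \<exists>q\<in>\<G>. p \<subseteq>\<^sub>m q \<and> g \<in> dom q \<and> dom q \<subseteq> K <#> insert g (dom p))"

lemma dom_translate:
  assumes "dom p \<subseteq> carrier G" "s \<in> carrier G"
  shows "dom (translate p s) = (\<lambda>a. a \<otimes> s) ` dom p"
proof (intro subset_antisym subsetI)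
  fix x assume "x \<in> dom (translate p s)"
  then have "x \<in> carrier G" "x \<otimes> inv s \<in> dom p" by (auto simp: translate_def dom_def split: if_splits)
  moreover have "x = (x \<otimes> inv s) \<otimes> s" using calculation assms by (simp add: m_assoc)
  ultimately show "x \<in> (\<lambda>a. a \<otimes> s) ` dom p" by blast
next
  fix x assume "x \<in> (\<lambda>a. a \<otimes> s) ` dom p"
  then obtain a where a: "a \<in> dom p" "x = a \<otimes> s" by auto
  then have "x \<in> carrier G" "x \<otimes> inv s = a" using assms by (auto simp: m_assoc)
  then show "x \<in> dom (translate p s)" using a by (auto simp: translate_def dom_def)
qed

lemma subset_set_mult:
  assumes "\<one> \<in> K" "X \<subseteq> carrier G"
  shows "X \<subseteq> K <#> X"
proof
  fix x assume x: "x \<in> X"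
  then have "x = \<one> \<otimes> x" using assms by auto
  then show "x \<in> K <#> X" unfolding mem_set_mult using x assms(1) by blast
qed

lemma translate_apply:
  assumes "a \<in> carrier G" "s \<in> carrier G"
  shows "translate p s (a \<otimes> s) = p a"
  using assms by (simp add: translate_def m_assoc)

lemma placed_translate: "dom w \<subseteq> carrier G \<Longrightarrow> s \<in> carrier G \<Longrightarrow> placed w s (translate w s)"
  unfolding placed_def using translate_apply by blast

lemma placed_mono: "placed w s p \<Longrightarrow> p \<subseteq>\<^sub>m q \<Longrightarrow> placed w s q"
  unfolding placed_def map_le_def by (metis domD domI)

lemma placed_translate_iff:
  assumes "dom w \<subseteq> carrier G" "s \<in> carrier G" "t \<in> carrier G"
  shows "placed w s (translate p t) \<longleftrightarrow> placed w (s \<otimes> inv t) p"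
proof -
  have "translate p t (a \<otimes> s) = p (a \<otimes> (s \<otimes> inv t))" if "a \<in> dom w" for a
    using that assms by (auto simp: translate_def m_assoc subset_iff)
  then show ?thesis by (simp add: placed_def)
qed

text \<open>
  The sites at which a copy of a pattern with domain in \<open>A\<close> would come
  \<open>K\<close>-close to the set \<open>B\<close>.
\<close>

definition blocked :: "'a set \<Rightarrow> 'a set \<Rightarrow> 'a set \<Rightarrow> 'a set" where
  "blocked A K B = {s \<in> carrier G. \<exists>a\<in>A. \<exists>k\<in>K. \<exists>x\<in>B. a \<otimes> s = k \<otimes> x}"

lemma blocked_Un: "blocked A K (B \<union> C) = blocked A K B \<union> blocked A K C"
  unfolding blocked_def by blast

lemma blocked_subset:
  assumes "A \<subseteq> carrier G"
  shows "blocked A K B \<subseteq> (\<lambda>(a, k, x). inv a \<otimes> (k \<otimes> x)) ` (A \<times> K \<times> B)"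
proof
  fix s assume "s \<in> blocked A K B"
  then obtain a k x where *: "s \<in> carrier G" "a \<in> A" "k \<in> K" "x \<in> B" "a \<otimes> s = k \<otimes> x" by (auto simp: blocked_def)
  then have "s = inv a \<otimes> (k \<otimes> x)" using assms inv_mult_cancel[of a s] by auto
  then show "s \<in> (\<lambda>(a, k, x). inv a \<otimes> (k \<otimes> x)) ` (A \<times> K \<times> B)" using * by force
qed

lemma glue_translates:
  assumes F: "pattern_family K \<G>" and p: "p \<in> \<G>" and "finite S" "S \<subseteq> carrier G"
    and w: "\<And>s. s \<in> S \<Longrightarrow> w s \<in> \<G>" "\<And>s. s \<in> S \<Longrightarrow> dom (w s) \<subseteq> A" and A: "A \<subseteq> carrier G"
    and free: "S \<inter> blocked A K (dom p) = {}"
    and sep: "\<And>s s' a b k. s \<in> S \<Longrightarrow> s' \<in> S \<Longrightarrow> s \<noteq> s' \<Longrightarrow> a \<in> A \<Longrightarrow> b \<in> A \<Longrightarrow> k \<in> K \<Longrightarrow> a \<otimes> s' \<noteq> k \<otimes> (b \<otimes> s)"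
  shows "\<exists>p'\<in>\<G>. p \<subseteq>\<^sub>m p' \<and> (\<forall>s\<in>S. placed (w s) s p') \<and> dom p' \<subseteq> dom p \<union> (\<Union>s\<in>S. \<Union>a\<in>A. {a \<otimes> s})"
  using assms(3,4) w free sep
proof (induction S rule: finite_induct)
  case empty
  then show ?case using p by (intro bexI[of _ p]) auto
next
  case (insert s S)
  have K: "K \<subseteq> carrier G" "\<one> \<in> K" "\<And>k. k \<in> K \<Longrightarrow> inv k \<in> K"
    and D: "\<And>p. p \<in> \<G> \<Longrightarrow> dom p \<subseteq> carrier G"
    using F by (auto simp: pattern_family_def symmetric_finite_def)
  have "\<exists>p'\<in>\<G>. p \<subseteq>\<^sub>m p' \<and> (\<forall>s\<in>S. placed (w s) s p') \<and> dom p' \<subseteq> dom p \<union> (\<Union>s\<in>S. \<Union>a\<in>A. {a \<otimes> s})"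
    by (rule insert.IH) (use insert.prems in auto)
  then obtain p' where p': "p' \<in> \<G>" "p \<subseteq>\<^sub>m p'" "\<forall>s\<in>S. placed (w s) s p'"
    "dom p' \<subseteq> dom p \<union> (\<Union>s\<in>S. \<Union>a\<in>A. {a \<otimes> s})"
    by blast
  have s: "s \<in> carrier G" using insert.prems by simp
  let ?t = "translate (w s) s"
  have ws: "w s \<in> \<G>" "dom (w s) \<subseteq> A" using insert.prems by auto
  have t: "?t \<in> \<G>" using F ws s by (simp add: pattern_family_def)
  have dt: "dom ?t = (\<lambda>a. a \<otimes> s) ` dom (w s)" using dom_translate D ws s by blast
  have disj: "dom p' \<inter> (K <#> dom ?t) = {}"
  proof (rule ccontr)
    assume "dom p' \<inter> (K <#> dom ?t) \<noteq> {}"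
    then obtain y where "y \<in> dom p'" "y \<in> K <#> dom ?t" by blast
    then obtain k x where "k \<in> K" "x \<in> dom ?t" "k \<otimes> x \<in> dom p'" unfolding mem_set_mult by blast
    then obtain b where kb: "k \<in> K" "b \<in> A" "k \<otimes> (b \<otimes> s) \<in> dom p'"
      unfolding dt using ws(2) by blast
    have c: "k \<in> carrier G" "b \<in> carrier G" using kb K A by auto
    from kb(3) p'(4) consider "k \<otimes> (b \<otimes> s) \<in> dom p" | a s' where "s' \<in> S" "a \<in> A" "k \<otimes> (b \<otimes> s) = a \<otimes> s'"
      by blast
    then show False
    proof cases
      case 1
      have "b \<otimes> s = inv k \<otimes> (k \<otimes> (b \<otimes> s))" using c s by (simp add: inv_mult_cancel)
      then have "s \<in> blocked A K (dom p)" using 1 kb K(3)[OF kb(1)] s unfolding blocked_def by blast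
      then show False using insert.prems by blast
    next
      case 2
      moreover have "s \<noteq> s'" using 2 insert.hyps by auto
      ultimately show False using insert.prems(5)[of s s' a b k] kb by auto
    qed
  qed
  have q: "p' ++ ?t \<in> \<G>" using F p'(1) t disj by (simp add: pattern_family_def)
  have "dom ?t \<subseteq> K <#> dom ?t" by (rule subset_set_mult[OF K(2) D[OF t]])
  then have "dom p' \<inter> dom ?t = {}" using disj by blast
  then have le: "p' \<subseteq>\<^sub>m p' ++ ?t" by (metis map_add_comm map_le_map_add)
  have "placed (w s) s (p' ++ ?t)"
    using placed_mono[OF placed_translate[of "w s" s], of "p' ++ ?t"] D ws s by (simp add: map_le_map_add)
  then have "\<forall>r\<in>insert s S. placed (w r) r (p' ++ ?t)" using p'(3) placed_mono[OF _ le] by blast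
  moreover have "dom (p' ++ ?t) \<subseteq> dom p \<union> (\<Union>s\<in>insert s S. \<Union>a\<in>A. {a \<otimes> s})"
    using p'(4) ws(2) dt by (auto simp: dom_map_add)
  moreover have "p \<subseteq>\<^sub>m p' ++ ?t" using p'(2) le map_le_trans by blast
  ultimately show ?case using q by blast
qed

text \<open>
  Closeness of two sites \<open>s\<close>, \<open>s'\<close> at which copies with domain in
  \<open>A\<close> interfere. The window enters twice, because a copy may be extended within
  \<open>K\<close> and the result must still be \<open>K\<close>-separated from the other.
\<close>

definition separation_set :: "'a set \<Rightarrow> 'a set \<Rightarrow> 'a set" where
  "separation_set A K = (\<lambda>(a, k, l, b). inv a \<otimes> (k \<otimes> (l \<otimes> b))) ` (A \<times> K \<times> K \<times> A)"

lemma nbhd_separation_set_iff: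
  assumes A: "A \<subseteq> carrier G" and K: "K \<subseteq> carrier G" and s: "s \<in> carrier G" "s' \<in> carrier G"
  shows "s' \<in> nbhd (separation_set A K) s \<longleftrightarrow>
    (\<exists>a\<in>A. \<exists>k\<in>K. \<exists>l\<in>K. \<exists>b\<in>A. a \<otimes> s' = k \<otimes> (l \<otimes> (b \<otimes> s)))"
proof
  assume "s' \<in> nbhd (separation_set A K) s"
  then obtain a k l b where *: "a \<in> A" "k \<in> K" "l \<in> K" "b \<in> A" "s' = inv a \<otimes> (k \<otimes> (l \<otimes> b)) \<otimes> s"
    by (auto simp: nbhd_def separation_set_def)
  moreover have "a \<in> carrier G" "k \<in> carrier G" "l \<in> carrier G" "b \<in> carrier G" using * A K by auto
  then have "a \<otimes> s' = k \<otimes> (l \<otimes> (b \<otimes> s))"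
    using *(5) s inv_mult_cancel[of "inv a" "k \<otimes> (l \<otimes> (b \<otimes> s))"] by (simp add: m_assoc)
  ultimately show "\<exists>a\<in>A. \<exists>k\<in>K. \<exists>l\<in>K. \<exists>b\<in>A. a \<otimes> s' = k \<otimes> (l \<otimes> (b \<otimes> s))" by blast
next
  assume "\<exists>a\<in>A. \<exists>k\<in>K. \<exists>l\<in>K. \<exists>b\<in>A. a \<otimes> s' = k \<otimes> (l \<otimes> (b \<otimes> s))"
  then obtain a k l b where *: "a \<in> A" "k \<in> K" "l \<in> K" "b \<in> A" "a \<otimes> s' = k \<otimes> (l \<otimes> (b \<otimes> s))" by blast
  have c: "a \<in> carrier G" "k \<in> carrier G" "l \<in> carrier G" "b \<in> carrier G" using * A K by auto
  have "s' = inv a \<otimes> (a \<otimes> s')" using c s by (simp add: inv_mult_cancel)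
  also have "\<dots> = inv a \<otimes> (k \<otimes> (l \<otimes> b)) \<otimes> s" using c s *(5) by (simp add: m_assoc)
  finally show "s' \<in> nbhd (separation_set A K) s"
    using * unfolding nbhd_def separation_set_def by force
qed

lemma symmetric_separation_set:
  assumes A: "finite A" "A \<subseteq> carrier G" "A \<noteq> {}" and "symmetric_finite K"
  shows "symmetric_finite (separation_set A K)"
  unfolding symmetric_finite_def
proof (intro conjI ballI)
  have K: "finite K" "K \<subseteq> carrier G" "\<one> \<in> K" "\<And>k. k \<in> K \<Longrightarrow> inv k \<in> K"
    using assms(4) by (auto simp: symmetric_finite_def)
  have Ac: "a \<in> carrier G" if "a \<in> A" for a using that A by auto
  have Kc: "k \<in> carrier G" if "k \<in> K" for k using that K by auto
  show "finite (separation_set A K)" "separation_set A K \<subseteq> carrier G"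
    using A(1) K(1) by (auto simp: separation_set_def Ac Kc)
  obtain a where "a \<in> A" using A by blast
  then show "\<one> \<in> separation_set A K" unfolding separation_set_def
    using K(3) by (intro image_eqI[of _ _ "(a, \<one>, \<one>, a)"]) (auto simp: Ac)
  fix q assume "q \<in> separation_set A K"
  then obtain a k l c where *: "a \<in> A" "k \<in> K" "l \<in> K" "c \<in> A" "q = inv a \<otimes> (k \<otimes> (l \<otimes> c))"
    by (auto simp: separation_set_def)
  then have "inv q = inv c \<otimes> (inv l \<otimes> (inv k \<otimes> a))" by (simp add: inv_mult_group m_assoc Ac Kc)
  then show "inv q \<in> separation_set A K" unfolding separation_set_def
    using * K(4) by (intro image_eqI[of _ _ "(c, inv l, inv k, a)"]) auto
qed

end

text \<open>
  One refinement of a family: \<open>P\<close> consists of \<open>4 m\<close> pairs, and a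
  group element \<open>h\<close> is hit by a pattern that contains \<open>w0\<close> at
  \<open>u \<otimes> h\<close> and \<open>w1\<close> at \<open>v \<otimes> h\<close> for some
  \<open>(u, v) \<in> P\<close>. With \<open>w0 = w1\<close> this produces recurrence; two
  different patterns serve to break periods.
\<close>

locale recurrence_refinement = group +
  fixes K :: "'a set" and \<G> :: "('a \<rightharpoonup> bool) set" and w0 w1 :: "'a \<rightharpoonup> bool" and m :: nat and P :: "('a \<times> 'a) set"
  assumes family: "pattern_family K \<G>" and w0: "w0 \<in> \<G>" "dom w0 \<noteq> {}" and w1: "w1 \<in> \<G>"
    and P: "finite P" "card P = 4 * m" "1 \<le> m" "inj_on fst P" "inj_on snd P" "P \<subseteq> carrier G \<times> carrier G"
    and sites: "selects_sites (separation_set (dom w0 \<union> dom w1) K) m P"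
begin

definition A :: "'a set" where "A = dom w0 \<union> dom w1"

definition U :: "'a set" where "U = fst ` P \<union> snd ` P"

definition hit :: "('a \<rightharpoonup> bool) \<Rightarrow> 'a \<Rightarrow> bool" where
  "hit p h \<longleftrightarrow> (\<exists>i\<in>P. placed w0 (fst i \<otimes> h) p \<and> placed w1 (snd i \<otimes> h) p)"

text \<open>
  The pairs that can no longer be used to hit \<open>h\<close> without interfering with
  \<open>p\<close>.
\<close>

definition lost :: "('a \<rightharpoonup> bool) \<Rightarrow> 'a \<Rightarrow> ('a \<times> 'a) set" where
  "lost p h = {i\<in>P. fst i \<otimes> h \<in> blocked A K (dom p) \<or> snd i \<otimes> h \<in> blocked A K (dom p)}"

text \<open>
  The tolerance \<open>m\<close> is a quarter of all pairs. Being lost is harmless as long as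
  it happens to few pairs, and an element that loses all pairs, as every element eventually
  does when the domain grows, must have been hit.
\<close>

definition refined :: "('a \<rightharpoonup> bool) set" where
  "refined = {p\<in>\<G>. \<forall>h\<in>carrier G. hit p h \<or> card (lost p h) \<le> m}"

text \<open>
  How far the domain of an extension in the refined family may reach from the original domain:
  from a point \<open>x\<close> through \<open>k' \<otimes> l'\<close> to a place of some
  \<open>h\<close>, on to another place of \<open>h\<close>, to the copy at this place and
  through \<open>k\<close> to its extension. The same products bound the distance of two
  patterns that both make \<open>h\<close> lose pairs.
\<close>

definition reach :: "'a set" where
  "reach = (\<lambda>(k, a, u, a', u', k', l'). (k \<otimes> (a \<otimes> u)) \<otimes> (inv (a' \<otimes> u') \<otimes> (k' \<otimes> l'))) `
     (K \<times> A \<times> U \<times> A \<times> U \<times> K \<times> K)"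

definition extended_window :: "'a set" where
  "extended_window = K \<union> reach \<union> m_inv G ` reach"

lemma K: "finite K" "K \<subseteq> carrier G" "\<one> \<in> K" "\<And>k. k \<in> K \<Longrightarrow> inv k \<in> K"
  using family by (auto simp: pattern_family_def symmetric_finite_def)

lemma dom_pattern: "p \<in> \<G> \<Longrightarrow> finite (dom p)" "p \<in> \<G> \<Longrightarrow> dom p \<subseteq> carrier G"
  using family by (auto simp: pattern_family_def)

lemma A: "finite A" "A \<subseteq> carrier G" "A \<noteq> {}"
  using dom_pattern w0 w1 by (auto simp: A_def)

lemma P_carrier: "i \<in> P \<Longrightarrow> fst i \<in> carrier G" "i \<in> P \<Longrightarrow> snd i \<in> carrier G"
  using P(6) by auto

lemma U: "finite U" "U \<subseteq> carrier G"
  using P(1) P_carrier by (auto simp: U_def)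

lemma A_carrier: "a \<in> A \<Longrightarrow> a \<in> carrier G" and K_carrier: "k \<in> K \<Longrightarrow> k \<in> carrier G" and U_carrier: "u \<in> U \<Longrightarrow> u \<in> carrier G"
  using A(2) K(2) U(2) by auto

lemma solve_shift: "a \<otimes> (u \<otimes> h) = z \<Longrightarrow> a \<in> A \<Longrightarrow> u \<in> U \<Longrightarrow> h \<in> carrier G \<Longrightarrow> h = inv (a \<otimes> u) \<otimes> z"
  by (auto simp: inv_mult_group m_assoc inv_mult_cancel A_carrier U_carrier)

lemma lostE:
  assumes "lost p h \<noteq> {}"
  obtains u a k x where "u \<in> U" "a \<in> A" "k \<in> K" "x \<in> dom p" "a \<otimes> (u \<otimes> h) = k \<otimes> x"
proof -
  obtain i where "i \<in> P" "fst i \<otimes> h \<in> blocked A K (dom p) \<or> snd i \<otimes> h \<in> blocked A K (dom p)"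
    using assms by (auto simp: lost_def)
  then obtain u where "u \<in> U" "u \<otimes> h \<in> blocked A K (dom p)" by (auto simp: U_def)
  then show thesis using that unfolding blocked_def by blast
qed

lemma hit_mono: "hit p h \<Longrightarrow> p \<subseteq>\<^sub>m q \<Longrightarrow> hit q h"
  using placed_mono unfolding hit_def by blast

lemma reachI:
  assumes "k \<in> K" "a \<in> A" "u \<in> U" "a' \<in> A" "u' \<in> U" "k' \<in> K" "l' \<in> K"
  shows "(k \<otimes> (a \<otimes> u)) \<otimes> (inv (a' \<otimes> u') \<otimes> (k' \<otimes> l')) \<in> reach"
  unfolding reach_def using assms by (intro image_eqI[of _ _ "(k, a, u, a', u', k', l')"]) auto

lemma symmetric_extended_window: "symmetric_finite extended_window"
proof -
  have "finite reach" "reach \<subseteq> carrier G" using A K U by (auto simp: reach_def A_carrier K_carrier U_carrier)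
  then show ?thesis using K by (auto simp: extended_window_def symmetric_finite_def subset_iff)
qed

lemma hit_translate:
  assumes "t \<in> carrier G" "h \<in> carrier G"
  shows "hit (translate p t) h \<longleftrightarrow> hit p (h \<otimes> inv t)"
  unfolding hit_def using assms dom_pattern(2)[OF w0(1)] dom_pattern(2)[OF w1] P_carrier
  by (intro bex_cong refl) (simp add: placed_translate_iff m_assoc)

lemma lost_translate:
  assumes "dom p \<subseteq> carrier G" "t \<in> carrier G" "h \<in> carrier G"
  shows "lost (translate p t) h = lost p (h \<otimes> inv t)"
proof -
  have "s \<in> blocked A K (dom (translate p t)) \<longleftrightarrow> s \<otimes> inv t \<in> blocked A K (dom p)" if s: "s \<in> carrier G" for s
  proof -
    have "a \<otimes> s = k \<otimes> (x \<otimes> t) \<longleftrightarrow> a \<otimes> (s \<otimes> inv t) = k \<otimes> x" if "a \<in> A" "k \<in> K" "x \<in> dom p" for a k x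
    proof -
      have c: "a \<in> carrier G" "k \<in> carrier G" "x \<in> carrier G" using that A_carrier K_carrier \<open>dom p \<subseteq> carrier G\<close> by auto
      then have "(a \<otimes> (s \<otimes> inv t)) \<otimes> t = a \<otimes> s" using s \<open>t \<in> carrier G\<close> by (simp add: m_assoc)
      moreover have "(k \<otimes> x) \<otimes> t = k \<otimes> (x \<otimes> t)" using c \<open>t \<in> carrier G\<close> by (simp add: m_assoc)
      ultimately show ?thesis using right_cancel[of t "a \<otimes> (s \<otimes> inv t)" "k \<otimes> x"] c s \<open>t \<in> carrier G\<close> by auto
    qed
    then show ?thesis unfolding blocked_def dom_translate[OF \<open>dom p \<subseteq> carrier G\<close> \<open>t \<in> carrier G\<close>]
      using s \<open>t \<in> carrier G\<close> by auto
  qed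
  then show ?thesis unfolding lost_def using assms P_carrier by (intro Collect_cong conj_cong refl) (simp add: m_assoc)
qed

text \<open>
  The heart of the construction. The elements \<open>h\<close> that are not hit and own a
  place near \<open>p\<close> or near \<open>g\<close> form a finite set \<open>T\<close>, and
  each of them has lost at most \<open>m\<close> pairs to \<open>p\<close>. Serve all of them
  at once at sparse sites \<open>S\<close>, and then extend to \<open>g\<close> inside the old
  family. An element outside \<open>T\<close> has no place near \<open>p\<close> or
  \<open>g\<close>, so it loses pairs only to the new copies, hence at most \<open>m\<close>;
  an element of \<open>T\<close> is hit. So the tolerance is restored completely and does not
  wear off during later extensions.
\<close>

lemma refined_extend:
  assumes p: "p \<in> refined" and g: "g \<in> carrier G"
  shows "\<exists>q\<in>refined. p \<subseteq>\<^sub>m q \<and> g \<in> dom q \<and> dom q \<subseteq> extended_window <#> insert g (dom p)"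
proof -
  have pG: "p \<in> \<G>" using p by (simp add: refined_def)
  define B where "B = insert g (dom p)"
  have B: "finite B" "B \<subseteq> carrier G" using dom_pattern[OF pG] g by (auto simp: B_def)
  have Bc: "x \<in> carrier G" if "x \<in> B" for x using that B by auto
  define T where "T = {h\<in>carrier G. \<not> hit p h \<and> (\<exists>a\<in>A. \<exists>u\<in>U. \<exists>k\<in>K. \<exists>l\<in>K. \<exists>x\<in>B. a \<otimes> (u \<otimes> h) = k \<otimes> (l \<otimes> x))}"
  have "T \<subseteq> (\<lambda>(a, u, k, l, x). inv (a \<otimes> u) \<otimes> (k \<otimes> (l \<otimes> x))) ` (A \<times> U \<times> K \<times> K \<times> B)"
  proof
    fix h assume "h \<in> T"
    then obtain a u k l x where *: "h \<in> carrier G" "a \<in> A" "u \<in> U" "k \<in> K" "l \<in> K" "x \<in> B" "a \<otimes> (u \<otimes> h) = k \<otimes> (l \<otimes> x)"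
      by (auto simp: T_def)
    show "h \<in> (\<lambda>(a, u, k, l, x). inv (a \<otimes> u) \<otimes> (k \<otimes> (l \<otimes> x))) ` (A \<times> U \<times> K \<times> K \<times> B)"
      by (rule image_eqI[of _ _ "(a, u, k, l, x)"]) (use * solve_shift[OF *(7) *(2,3,1)] in auto)
  qed
  then have Tf: "finite T" by (rule finite_subset) (intro finite_imageI finite_cartesian_product A(1) K(1) U(1) B(1))
  have Tc: "T \<subseteq> carrier G" by (auto simp: T_def)
  have "\<forall>h\<in>T. card {i\<in>P. fst i \<otimes> h \<in> blocked A K (dom p) \<or> snd i \<otimes> h \<in> blocked A K (dom p)} \<le> m"
    using p by (auto simp: T_def refined_def lost_def)
  from sites[folded A_def, unfolded selects_sites_def, THEN spec, THEN spec, THEN mp, OF Tf, THEN mp, OF Tc, THEN mp, OF this]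
  obtain S0 S1 where S: "S0 \<union> S1 \<subseteq> (\<Union>h\<in>T. \<Union>i\<in>P. {fst i \<otimes> h, snd i \<otimes> h})"
    "(S0 \<union> S1) \<inter> blocked A K (dom p) = {}" "S0 \<inter> S1 = {}"
    "\<forall>s\<in>S0 \<union> S1. \<forall>s'\<in>S0 \<union> S1. s \<noteq> s' \<longrightarrow> s' \<notin> nbhd (separation_set A K) s"
    "\<forall>h\<in>T. \<exists>i\<in>P. fst i \<otimes> h \<in> S0 \<and> snd i \<otimes> h \<in> S1"
    "\<forall>h\<in>carrier G. card {i\<in>P. pair_nbhd (separation_set A K) i h \<inter> (S0 \<union> S1) \<noteq> {}} \<le> m"
    by (elim exE conjE) (rule that)
  define S where "S = S0 \<union> S1"
  have Sf: "finite S" unfolding S_def by (rule finite_subset[OF S(1)]) (use Tf P(1) in auto)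
  have SU: "\<exists>h\<in>T. \<exists>u\<in>U. s = u \<otimes> h" if "s \<in> S" for s
    using that S(1) unfolding S_def U_def by blast
  have Sc: "S \<subseteq> carrier G" using SU Tc U(2) by blast
  define w where "w s = (if s \<in> S0 then w0 else w1)" for s
  have "\<exists>p'\<in>\<G>. p \<subseteq>\<^sub>m p' \<and> (\<forall>s\<in>S. placed (w s) s p') \<and> dom p' \<subseteq> dom p \<union> (\<Union>s\<in>S. \<Union>a\<in>A. {a \<otimes> s})"
  proof (rule glue_translates[OF family pG Sf Sc _ _ A(2)])
    show "w s \<in> \<G>" "dom (w s) \<subseteq> A" for s using w0 w1 by (auto simp: w_def A_def)
    show "S \<inter> blocked A K (dom p) = {}" using S(2) by (simp add: S_def)
    fix s s' a c k assume *: "s \<in> S" "s' \<in> S" "s \<noteq> s'" "a \<in> A" "c \<in> A" "k \<in> K"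
    have "c \<otimes> s \<in> carrier G" using * Sc A_carrier by auto
    then have "\<one> \<otimes> (c \<otimes> s) = c \<otimes> s" by simp
    then show "a \<otimes> s' \<noteq> k \<otimes> (c \<otimes> s)"
      using S(4) * nbhd_separation_set_iff[OF A(2) K(2), of s s'] Sc K(3) unfolding S_def by (metis subsetD)
  qed
  then obtain p' where p': "p' \<in> \<G>" "p \<subseteq>\<^sub>m p'" "\<And>s. s \<in> S \<Longrightarrow> placed (w s) s p'"
    "dom p' \<subseteq> dom p \<union> (\<Union>s\<in>S. \<Union>a\<in>A. {a \<otimes> s})" by blast
  obtain q where q: "q \<in> \<G>" "p' \<subseteq>\<^sub>m q" "g \<in> dom q" "dom q \<subseteq> K <#> insert g (dom p')"
    using family p'(1) g unfolding pattern_family_def by blast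
  have dq: "(\<exists>l\<in>K. \<exists>x\<in>B. y = l \<otimes> x) \<or> (\<exists>l\<in>K. \<exists>a\<in>A. \<exists>s\<in>S. y = l \<otimes> (a \<otimes> s))" if "y \<in> dom q" for y
    using subsetD[OF q(4) that] p'(4) unfolding mem_set_mult B_def by blast
  have hitq: "hit q h" if "h \<in> T" for h
  proof -
    obtain i where i: "i \<in> P" "fst i \<otimes> h \<in> S0" "snd i \<otimes> h \<in> S1" using S(5) \<open>h \<in> T\<close> by blast
    have "fst i \<otimes> h \<in> S" "snd i \<otimes> h \<in> S" "w (fst i \<otimes> h) = w0" "w (snd i \<otimes> h) = w1"
      unfolding S_def w_def using i(2,3) S(3) by auto
    then have "placed w0 (fst i \<otimes> h) p'" "placed w1 (snd i \<otimes> h) p'"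
      using p'(3)[of "fst i \<otimes> h"] p'(3)[of "snd i \<otimes> h"] by simp_all
    then have "hit p' h" unfolding hit_def using i(1) by blast
    then show ?thesis by (rule hit_mono[OF _ q(2)])
  qed
  have "hit q h \<or> card (lost q h) \<le> m" if h: "h \<in> carrier G" for h
  proof (cases "hit q h")
    case False
    then have "h \<notin> T" "\<not> hit p h" using hitq hit_mono[OF _ map_le_trans[OF p'(2) q(2)]] by auto
    then have far: "a \<otimes> (u \<otimes> h) \<noteq> k \<otimes> (l \<otimes> x)" if "a \<in> A" "u \<in> U" "k \<in> K" "l \<in> K" "x \<in> B" for a u k l x
      using that h unfolding T_def by blast
    have near: "nbhd (separation_set A K) (u \<otimes> h) \<inter> S \<noteq> {}" if u: "u \<in> U" and bu: "u \<otimes> h \<in> blocked A K (dom q)" for u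
    proof -
      obtain a k y where *: "a \<in> A" "k \<in> K" "y \<in> dom q" "a \<otimes> (u \<otimes> h) = k \<otimes> y"
        using bu unfolding blocked_def by blast
      then obtain l c s where **: "l \<in> K" "c \<in> A" "s \<in> S" "y = l \<otimes> (c \<otimes> s)"
        using dq[of y] far[of a u k] u by blast
      have cc: "a \<in> carrier G" "k \<in> carrier G" "l \<in> carrier G" "c \<in> carrier G" "s \<in> carrier G" "u \<otimes> h \<in> carrier G"
        using * ** A_carrier K_carrier Sc U_carrier[OF u] h by auto
      have "inv k \<otimes> (a \<otimes> (u \<otimes> h)) = l \<otimes> (c \<otimes> s)" unfolding *(4) **(4) using cc by (simp add: inv_mult_cancel)
      then have "inv l \<otimes> (inv k \<otimes> (a \<otimes> (u \<otimes> h))) = c \<otimes> s" using cc by (simp add: inv_mult_cancel)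
      then have "s \<in> nbhd (separation_set A K) (u \<otimes> h)"
        using nbhd_separation_set_iff[OF A(2) K(2) cc(6,5)] *(1,2) **(1,2) K(4) by metis
      then show ?thesis using **(3) by blast
    qed
    have "lost q h \<subseteq> {i\<in>P. pair_nbhd (separation_set A K) i h \<inter> S \<noteq> {}}"
      using near unfolding lost_def U_def by blast
    then have "card (lost q h) \<le> card {i\<in>P. pair_nbhd (separation_set A K) i h \<inter> S \<noteq> {}}" by (intro card_mono) (use P(1) in auto)
    also have "\<dots> \<le> m" using S(6) h by (simp add: S_def)
    finally show ?thesis by simp
  qed simp
  then have "q \<in> refined" using q(1) by (simp add: refined_def)
  moreover have "dom q \<subseteq> extended_window <#> insert g (dom p)"
  proof
    fix y assume "y \<in> dom q"
    then consider l x where "l \<in> K" "x \<in> B" "y = l \<otimes> x" | k a s where "k \<in> K" "a \<in> A" "s \<in> S" "y = k \<otimes> (a \<otimes> s)"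
      using dq by blast
    then show "y \<in> extended_window <#> insert g (dom p)"
    proof cases
      case 1 then show ?thesis unfolding mem_set_mult extended_window_def B_def by blast
    next
      case 2
      obtain h u where hu: "h \<in> T" "u \<in> U" "s = u \<otimes> h" using SU 2 by blast
      obtain a' u' k' l' x where *: "h \<in> carrier G" "a' \<in> A" "u' \<in> U" "k' \<in> K" "l' \<in> K" "x \<in> B"
        "a' \<otimes> (u' \<otimes> h) = k' \<otimes> (l' \<otimes> x)" using hu(1) by (auto simp: T_def)
      have "h = inv (a' \<otimes> u') \<otimes> (k' \<otimes> (l' \<otimes> x))" by (rule solve_shift[OF *(7,2,3,1)])
      then have "y = ((k \<otimes> (a \<otimes> u)) \<otimes> (inv (a' \<otimes> u') \<otimes> (k' \<otimes> l'))) \<otimes> x"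
        unfolding 2(4) hu(3) using 2 hu * by (simp add: m_assoc A_carrier K_carrier U_carrier Bc)
      moreover have "(k \<otimes> (a \<otimes> u)) \<otimes> (inv (a' \<otimes> u') \<otimes> (k' \<otimes> l')) \<in> extended_window"
        unfolding extended_window_def using reachI 2 hu * by blast
      ultimately show ?thesis unfolding mem_set_mult using *(6) B_def by blast
    qed
  qed
  moreover have "p \<subseteq>\<^sub>m q" using p'(2) q(2) map_le_trans by blast
  ultimately show ?thesis using q(3) by blast
qed

text \<open>
  Of two patterns far apart, at most one makes a given element lose pairs, so the losses do
  not add up.
\<close>

lemma refined_glue:
  assumes p: "p \<in> refined" and q: "q \<in> refined" and sep: "dom p \<inter> (extended_window <#> dom q) = {}"
  shows "p ++ q \<in> refined"
proof -
  have pq: "p \<in> \<G>" "q \<in> \<G>" using p q by (auto simp: refined_def)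
  have "K <#> dom q \<subseteq> extended_window <#> dom q" unfolding mem_set_mult subset_iff extended_window_def by blast
  then have sepK: "dom p \<inter> (K <#> dom q) = {}" using sep by blast
  then have "p ++ q \<in> \<G>" using family pq by (simp add: pattern_family_def)
  moreover have "dom q \<subseteq> K <#> dom q" by (rule subset_set_mult[OF K(3) dom_pattern(2)[OF pq(2)]])
  then have "dom p \<inter> dom q = {}" using sepK by blast
  then have le: "p \<subseteq>\<^sub>m p ++ q" by (metis map_add_comm map_le_map_add)
  moreover have "hit (p ++ q) h \<or> card (lost (p ++ q) h) \<le> m" if h: "h \<in> carrier G" for h
  proof (cases "hit p h \<or> hit q h")
    case True
    then show ?thesis using hit_mono[OF _ le] hit_mono[of q h "p ++ q"] by (auto simp: map_le_map_add)
  next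
    case False
    then have cards: "card (lost p h) \<le> m" "card (lost q h) \<le> m" using p q h by (auto simp: refined_def)
    have "lost p h = {} \<or> lost q h = {}"
    proof (rule ccontr)
      assume "\<not> (lost p h = {} \<or> lost q h = {})"
      then obtain u a k x u' a' k' x' where *: "u \<in> U" "a \<in> A" "k \<in> K" "x \<in> dom p" "a \<otimes> (u \<otimes> h) = k \<otimes> x"
        "u' \<in> U" "a' \<in> A" "k' \<in> K" "x' \<in> dom q" "a' \<otimes> (u' \<otimes> h) = k' \<otimes> x'"
        using lostE by metis
      have c: "x \<in> carrier G" "x' \<in> carrier G" using * dom_pattern pq by auto
      have "x = inv k \<otimes> (a \<otimes> (u \<otimes> h))" unfolding *(5) using * c by (simp add: inv_mult_cancel K_carrier)
      also have "h = inv (a' \<otimes> u') \<otimes> (k' \<otimes> x')" by (rule solve_shift[OF *(10,7,6) h])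
      finally have "x = ((inv k \<otimes> (a \<otimes> u)) \<otimes> (inv (a' \<otimes> u') \<otimes> (k' \<otimes> \<one>))) \<otimes> x'"
        using * c by (simp add: m_assoc A_carrier K_carrier U_carrier)
      moreover have "(inv k \<otimes> (a \<otimes> u)) \<otimes> (inv (a' \<otimes> u') \<otimes> (k' \<otimes> \<one>)) \<in> extended_window"
        unfolding extended_window_def using reachI * K(3,4) by blast
      ultimately have "x \<in> extended_window <#> dom q" unfolding mem_set_mult using *(9) by blast
      then show False using sep *(4) by blast
    qed
    moreover have "lost (p ++ q) h \<subseteq> lost p h \<union> lost q h"
      unfolding lost_def dom_map_add blocked_Un by blast
    ultimately have "lost (p ++ q) h \<subseteq> lost q h \<or> lost (p ++ q) h \<subseteq> lost p h" by auto
    moreover have "finite (lost p h)" "finite (lost q h)" using P(1) by (simp_all add: lost_def)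
    ultimately have "card (lost (p ++ q) h) \<le> m"
      using cards card_mono[of "lost p h"] card_mono[of "lost q h"] by (metis le_trans)
    then show ?thesis ..
  qed
  ultimately show ?thesis by (simp add: refined_def)
qed

text \<open>
  A pattern with few points blocks few pairs. Hence any finitely many patterns, and even all
  patterns of bounded size, survive a refinement with \<open>m\<close> large.
\<close>

lemma refined_small:
  assumes p: "p \<in> \<G>" and "card (dom p) \<le> b" "2 * (card A * card K * b) \<le> m"
  shows "p \<in> refined"
proof -
  let ?B = "blocked A K (dom p)"
  have "finite (A \<times> K \<times> dom p)"
    by (intro finite_cartesian_product A(1) K(1) dom_pattern(1)[OF p])
  then have finI: "finite ((\<lambda>(a, k, x). inv a \<otimes> (k \<otimes> x)) ` (A \<times> K \<times> dom p))"
    by (rule finite_imageI)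
  have finB: "finite ?B" by (rule finite_subset[OF blocked_subset[OF A(2)] finI])
  have "card ?B \<le> card ((\<lambda>(a, k, x). inv a \<otimes> (k \<otimes> x)) ` (A \<times> K \<times> dom p))"
    by (rule card_mono[OF finI blocked_subset[OF A(2)]])
  also have "\<dots> \<le> card (A \<times> K \<times> dom p)" by (intro card_image_le finite_cartesian_product A(1) K(1) dom_pattern(1)[OF p])
  also have "\<dots> \<le> card A * card K * b" using assms(2) by (simp add: card_cartesian_product mult.assoc)
  finally have cB: "card ?B \<le> card A * card K * b" .
  have "card (lost p h) \<le> m" if h: "h \<in> carrier G" for h
  proof -
    have one: "card {i\<in>P. f i \<otimes> h \<in> ?B} \<le> card ?B" if "inj_on f P" "\<And>i. i \<in> P \<Longrightarrow> f i \<in> carrier G" for f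
      by (rule card_inj_on_le[where f = "\<lambda>i. f i \<otimes> h"])
        (use that h finB in \<open>auto simp: inj_on_def\<close>)
    have "lost p h = {i\<in>P. fst i \<otimes> h \<in> ?B} \<union> {i\<in>P. snd i \<otimes> h \<in> ?B}" by (auto simp: lost_def)
    then have "card (lost p h) \<le> card {i\<in>P. fst i \<otimes> h \<in> ?B} + card {i\<in>P. snd i \<otimes> h \<in> ?B}"
      by (simp add: card_Un_le)
    also have "\<dots> \<le> card ?B + card ?B" using one[OF P(4) P_carrier(1)] one[OF P(5) P_carrier(2)] by (rule add_mono)
    finally show ?thesis using cB assms(3) by linarith
  qed
  then show ?thesis using p by (simp add: refined_def)
qed

lemma pattern_family_refined: "pattern_family extended_window refined"
  unfolding pattern_family_def
proof (intro conjI ballI impI)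
  fix p s assume p: "p \<in> refined" and s: "s \<in> carrier G"
  have pG: "p \<in> \<G>" using p by (simp add: refined_def)
  have "translate p s \<in> \<G>" using family pG s by (simp add: pattern_family_def)
  then show "translate p s \<in> refined"
    using p s by (simp add: refined_def hit_translate lost_translate[OF dom_pattern(2)[OF pG]])
next
  show "symmetric_finite extended_window" by (rule symmetric_extended_window)
  show "finite (dom p)" "dom p \<subseteq> carrier G" if "p \<in> refined" for p
    using that dom_pattern by (auto simp: refined_def)
  show "p ++ q \<in> refined" if "p \<in> refined" "q \<in> refined" "dom p \<inter> (extended_window <#> dom q) = {}" for p q
    using that by (rule refined_glue)
  show "\<exists>q\<in>refined. p \<subseteq>\<^sub>m q \<and> g \<in> dom q \<and> dom q \<subseteq> extended_window <#> insert g (dom p)"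
    if "p \<in> refined" "g \<in> carrier G" for p g
    using that by (rule refined_extend)
qed

lemma refined_hit:
  assumes p: "p \<in> refined" and h: "h \<in> carrier G" and dom: "\<And>a u. a \<in> A \<Longrightarrow> u \<in> U \<Longrightarrow> (a \<otimes> u) \<otimes> h \<in> dom p"
  shows "hit p h"
proof -
  obtain a where a: "a \<in> A" using A(3) by blast
  have bl: "u \<otimes> h \<in> blocked A K (dom p)" if "u \<in> U" for u
  proof -
    have "a \<otimes> (u \<otimes> h) = \<one> \<otimes> ((a \<otimes> u) \<otimes> h)" using that a h by (simp add: m_assoc A_carrier U_carrier)
    moreover have "u \<otimes> h \<in> carrier G" using U_carrier[OF that] h by simp
    ultimately show ?thesis unfolding blocked_def using a K(3) dom[OF a that] by blast
  qed
  have "lost p h = P" unfolding lost_def using bl[unfolded U_def] by blast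
  then have "\<not> card (lost p h) \<le> m" using P(2,3) by simp
  then show ?thesis using p h by (auto simp: refined_def)
qed

end

context group
begin

lemma recurrence_step:
  assumes F: "pattern_family K \<G>" and w: "w0 \<in> \<G>" "w1 \<in> \<G>" "dom w0 \<noteq> {}" and R: "plentiful R"
  shows "\<exists>K' \<G>' P D. pattern_family K' \<G>' \<and> \<G>' \<subseteq> \<G> \<and> (\<forall>p\<in>\<G>. card (dom p) \<le> b \<longrightarrow> p \<in> \<G>') \<and>
    finite P \<and> P \<subseteq> R \<and> finite D \<and> D \<subseteq> carrier G \<and>
    (\<forall>p\<in>\<G>'. \<forall>h\<in>carrier G. (\<forall>x\<in>D. x \<otimes> h \<in> dom p) \<longrightarrow>
       (\<exists>i\<in>P. placed w0 (fst i \<otimes> h) p \<and> placed w1 (snd i \<otimes> h) p))"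
proof -
  let ?A = "dom w0 \<union> dom w1"
  have K: "symmetric_finite K" and D: "\<And>p. p \<in> \<G> \<Longrightarrow> finite (dom p) \<and> dom p \<subseteq> carrier G"
    using F by (auto simp: pattern_family_def)
  have Q: "symmetric_finite (separation_set ?A K)"
    by (rule symmetric_separation_set[OF _ _ _ K]) (use D w in auto)
  obtain m P where P: "2 * (card ?A * card K * b) + 1 \<le> m" "P \<subseteq> R" "finite P" "card P = 4 * m"
    "inj_on fst P" "inj_on snd P" "selects_sites (separation_set ?A K) m P"
    using sites_in_group[OF R Q] by metis
  have b: "2 * (card ?A * card K * b) \<le> m" using P(1) by simp
  interpret recurrence_refinement G K \<G> w0 w1 m P
    using F w R P by unfold_locales (auto simp: plentiful_def)
  show ?thesis
  proof (rule exI[of _ extended_window], rule exI[of _ refined], rule exI[of _ P],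
      rule exI[of _ "(\<lambda>(a, u). a \<otimes> u) ` (A \<times> U)"], intro conjI)
    show "pattern_family extended_window refined" by (rule pattern_family_refined)
    show "refined \<subseteq> \<G>" by (auto simp: refined_def)
    show "finite P" "P \<subseteq> R" by fact+
    show "finite ((\<lambda>(a, u). a \<otimes> u) ` (A \<times> U))" "(\<lambda>(a, u). a \<otimes> u) ` (A \<times> U) \<subseteq> carrier G"
      using A(1) U(1) by (auto simp: A_carrier U_carrier)
    show "\<forall>p\<in>\<G>. card (dom p) \<le> b \<longrightarrow> p \<in> refined"
      using refined_small b by (simp add: A_def)
    show "\<forall>p\<in>refined. \<forall>h\<in>carrier G. (\<forall>x\<in>(\<lambda>(a, u). a \<otimes> u) ` (A \<times> U). x \<otimes> h \<in> dom p) \<longrightarrow>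
       (\<exists>i\<in>P. placed w0 (fst i \<otimes> h) p \<and> placed w1 (snd i \<otimes> h) p)"
      using refined_hit unfolding hit_def by blast
  qed
qed

end

section \<open>A recurrent point of the shift with trivial stabilisers\<close>

context group
begin

lemma plentiful_Times:
  assumes "R \<subseteq> carrier G" "infinite R"
  shows "plentiful (R \<times> R)"
  unfolding plentiful_def
proof (intro conjI allI impI)
  show "R \<times> R \<subseteq> carrier G \<times> carrier G" using assms by blast
  fix Y :: "'a set" assume Y: "finite Y"
  have "R - Y \<noteq> {}" by (rule infinite_imp_nonempty[OF Diff_infinite_finite[OF Y assms(2)]])
  then obtain u where u: "u \<in> R" "u \<notin> Y" by blast
  have "finite (Y \<union> (\<lambda>y. y \<otimes> u) ` Y)" using Y by simp
  then have "R - (Y \<union> (\<lambda>y. y \<otimes> u) ` Y) \<noteq> {}"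
    by (rule infinite_imp_nonempty[OF Diff_infinite_finite[OF _ assms(2)]])
  then obtain v where v: "v \<in> R" "v \<notin> Y" "v \<notin> (\<lambda>y. y \<otimes> u) ` Y" by blast
  have uv: "u \<in> carrier G" "v \<in> carrier G" using u v assms(1) by auto
  have "v \<otimes> inv u \<notin> Y"
  proof
    assume "v \<otimes> inv u \<in> Y"
    then have "(v \<otimes> inv u) \<otimes> u \<in> (\<lambda>y. y \<otimes> u) ` Y" by (rule imageI)
    moreover have "(v \<otimes> inv u) \<otimes> u = v" using uv by (simp add: m_assoc)
    ultimately show False using v(3) by simp
  qed
  then show "\<exists>(u, v)\<in>R \<times> R. u \<notin> Y \<and> v \<notin> Y \<and> v \<otimes> inv u \<notin> Y"
    using u v(1,2) by (intro bexI[of _ "(u, v)"]) simp_all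
qed

text \<open>
  If the centraliser of \<open>g\<close> is finite, then \<open>d \<otimes> g \<otimes> inv
  d\<close> takes each value only finitely often, so \<open>d\<close> and \<open>d \<otimes>
  g\<close> are far apart for all but finitely many \<open>d\<close>.
\<close>

lemma plentiful_translates:
  assumes g: "g \<in> carrier G" and inf: "infinite (carrier G)" and fin: "finite {c \<in> carrier G. c \<otimes> g = g \<otimes> c}"
  shows "plentiful ((\<lambda>d. (d, d \<otimes> g)) ` carrier G)"
  unfolding plentiful_def
proof (intro conjI allI impI)
  show "(\<lambda>d. (d, d \<otimes> g)) ` carrier G \<subseteq> carrier G \<times> carrier G" using g by auto
  fix Y :: "'a set" assume Y: "finite Y"
  define fibre where "fibre y = {d \<in> carrier G. d \<otimes> g \<otimes> inv d = y}" for y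
  have "finite (fibre y)" for y
  proof (cases "fibre y = {}")
    case False
    then obtain e where e: "e \<in> carrier G" "e \<otimes> g \<otimes> inv e = y" by (auto simp: fibre_def)
    have "fibre y \<subseteq> (\<lambda>c. e \<otimes> c) ` {c \<in> carrier G. c \<otimes> g = g \<otimes> c}"
    proof
      fix d assume "d \<in> fibre y"
      then have d: "d \<in> carrier G" "d \<otimes> g \<otimes> inv d = e \<otimes> g \<otimes> inv e" using e by (auto simp: fibre_def)
      have "d \<otimes> g = (d \<otimes> g \<otimes> inv d) \<otimes> d" using d(1) g by (simp add: m_assoc)
      also have "\<dots> = e \<otimes> (g \<otimes> (inv e \<otimes> d))" unfolding d(2) using d(1) g e(1) by (simp add: m_assoc)
      finally have dg: "d \<otimes> g = e \<otimes> (g \<otimes> (inv e \<otimes> d))" .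
      have "(inv e \<otimes> d) \<otimes> g = inv e \<otimes> (d \<otimes> g)" using d(1) g e(1) by (simp add: m_assoc)
      also have "\<dots> = g \<otimes> (inv e \<otimes> d)" unfolding dg using d(1) g e(1) by (simp add: inv_mult_cancel)
      finally have mem: "inv e \<otimes> d \<in> {c \<in> carrier G. c \<otimes> g = g \<otimes> c}" using d(1) e(1) by simp
      have eq: "e \<otimes> (inv e \<otimes> d) = d" using d(1) e(1) by (simp add: m_assoc[symmetric])
      show "d \<in> (\<lambda>c. e \<otimes> c) ` {c \<in> carrier G. c \<otimes> g = g \<otimes> c}"
        using imageI[OF mem, of "\<lambda>c. e \<otimes> c"] unfolding eq .
    qed
    then show ?thesis by (rule finite_subset) (rule finite_imageI[OF fin])
  qed simp
  then have "finite (Y \<union> (\<lambda>y. y \<otimes> inv g) ` Y \<union> (\<Union>y\<in>Y. fibre y))" using Y by simp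
  then have "infinite (carrier G - (Y \<union> (\<lambda>y. y \<otimes> inv g) ` Y \<union> (\<Union>y\<in>Y. fibre y)))"
    using inf by (rule Diff_infinite_finite)
  then have "carrier G - (Y \<union> (\<lambda>y. y \<otimes> inv g) ` Y \<union> (\<Union>y\<in>Y. fibre y)) \<noteq> {}"
    by (rule infinite_imp_nonempty)
  then obtain d where d: "d \<in> carrier G" "d \<notin> Y" "d \<notin> (\<lambda>y. y \<otimes> inv g) ` Y" "d \<notin> (\<Union>y\<in>Y. fibre y)" by blast
  have dg: "(d \<otimes> g) \<otimes> inv g = d" using d(1) g by (simp add: m_assoc)
  have "d \<otimes> g \<notin> Y"
  proof
    assume "d \<otimes> g \<in> Y"
    then have "(d \<otimes> g) \<otimes> inv g \<in> (\<lambda>y. y \<otimes> inv g) ` Y" by (rule imageI)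
    then show False using d(3) unfolding dg by contradiction
  qed
  moreover have "d \<otimes> g \<otimes> inv d \<notin> Y" using d(1,4) unfolding fibre_def by blast
  ultimately show "\<exists>(u, v)\<in>(\<lambda>d. (d, d \<otimes> g)) ` carrier G. u \<notin> Y \<and> v \<notin> Y \<and> v \<otimes> inv u \<notin> Y"
    using d(2) imageI[OF d(1), of "\<lambda>d. (d, d \<otimes> g)"] by (intro bexI[of _ "(d, d \<otimes> g)"]) simp_all
qed

text \<open>
  Patterns with at most two points are the supply from which \<open>freeness_stage\<close>
  draws at every stage; they survive all refinements.
\<close>

definition admissible :: "('a \<rightharpoonup> bool) set \<Rightarrow> bool" where
  "admissible \<G> \<longleftrightarrow> (\<exists>K. pattern_family K \<G>) \<and> (\<forall>p. dom p \<subseteq> carrier G \<and> finite (dom p) \<and> card (dom p) \<le> 2 \<longrightarrow> p \<in> \<G>)"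

lemma admissible_all: "admissible {p. finite (dom p) \<and> dom p \<subseteq> carrier G}" (is "admissible ?\<G>")
proof -
  have "pattern_family {\<one>} ?\<G>"
    unfolding pattern_family_def
  proof (intro conjI ballI impI)
    show "symmetric_finite {\<one>}" by (auto simp: symmetric_finite_def)
    show "translate p s \<in> ?\<G>" if "p \<in> ?\<G>" "s \<in> carrier G" for p s
      using that by (auto simp: dom_translate)
    show "p ++ q \<in> ?\<G>" if "p \<in> ?\<G>" "q \<in> ?\<G>" for p q using that by auto
    fix p g assume p: "p \<in> ?\<G>" and g: "g \<in> carrier G"
    have "insert g (dom p) \<subseteq> {\<one>} <#> insert g (dom p)"
      by (rule subset_set_mult) (use p g in auto)
    then show "\<exists>q\<in>?\<G>. p \<subseteq>\<^sub>m q \<and> g \<in> dom q \<and> dom q \<subseteq> {\<one>} <#> insert g (dom p)"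
      using p g by (intro bexI[of _ "[g \<mapsto> True] ++ p"]) (auto simp: map_le_map_add)
  qed auto
  then show ?thesis by (auto simp: admissible_def)
qed

text \<open>
  Every pattern of the family that is defined on a large enough neighbourhood of
  \<open>h\<close> shows \<open>w\<close> at \<open>f \<otimes> h\<close> for some
  \<open>f\<close> in a finite part of \<open>R\<close> that does not depend on
  \<open>h\<close>.
\<close>

definition recurs :: "('a \<rightharpoonup> bool) set \<Rightarrow> ('a \<rightharpoonup> bool) \<Rightarrow> 'a set \<Rightarrow> bool" where
  "recurs \<G> w R \<longleftrightarrow> (\<exists>F D. finite F \<and> F \<subseteq> R \<and> finite D \<and> D \<subseteq> carrier G \<and>
     (\<forall>p\<in>\<G>. \<forall>h\<in>carrier G. (\<forall>x\<in>D. x \<otimes> h \<in> dom p) \<longrightarrow> (\<exists>f\<in>F. placed w (f \<otimes> h) p)))"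

definition moves :: "('a \<rightharpoonup> bool) set \<Rightarrow> 'a \<Rightarrow> bool" where
  "moves \<G> g \<longleftrightarrow> (\<exists>F D. finite F \<and> F \<subseteq> carrier G \<and> finite D \<and> D \<subseteq> carrier G \<and>
     (\<forall>p\<in>\<G>. \<forall>h\<in>carrier G. (\<forall>x\<in>D. x \<otimes> h \<in> dom p) \<longrightarrow>
        (\<exists>f\<in>F. p (f \<otimes> h) = Some False \<and> p (f \<otimes> g \<otimes> h) = Some True)))"

lemma admissible_subset:
  assumes "admissible \<G>" "pattern_family K' \<G>'" "\<forall>p\<in>\<G>. card (dom p) \<le> max 2 b \<longrightarrow> p \<in> \<G>'"
  shows "admissible \<G>'"
  unfolding admissible_def
proof (intro conjI allI impI)
  show "\<exists>K. pattern_family K \<G>'" using assms(2) by blast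
  fix p :: "'a \<rightharpoonup> bool" assume p: "dom p \<subseteq> carrier G \<and> finite (dom p) \<and> card (dom p) \<le> 2"
  then have "p \<in> \<G>" using assms(1) unfolding admissible_def by blast
  moreover have "card (dom p) \<le> max 2 b" using p by linarith
  ultimately show "p \<in> \<G>'" using assms(3) by blast
qed

lemma recurrence_stage:
  assumes \<G>: "admissible \<G>" and w: "w \<in> \<G>" "dom w \<noteq> {}" and R: "R \<subseteq> carrier G" "infinite R"
  obtains \<G>' where "admissible \<G>'" "\<G>' \<subseteq> \<G>" "w \<in> \<G>'" "recurs \<G>' w R"
proof -
  obtain K where K: "pattern_family K \<G>" using \<G> unfolding admissible_def by blast
  from recurrence_step[OF K w(1,1,2) plentiful_Times[OF R], where b = "max 2 (card (dom w))"]
  obtain K' \<G>' P D where step: "pattern_family K' \<G>'" "\<G>' \<subseteq> \<G>"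
    "\<forall>p\<in>\<G>. card (dom p) \<le> max 2 (card (dom w)) \<longrightarrow> p \<in> \<G>'"
    "finite P" "P \<subseteq> R \<times> R" "finite D" "D \<subseteq> carrier G"
    "\<forall>p\<in>\<G>'. \<forall>h\<in>carrier G. (\<forall>x\<in>D. x \<otimes> h \<in> dom p) \<longrightarrow>
       (\<exists>i\<in>P. placed w (fst i \<otimes> h) p \<and> placed w (snd i \<otimes> h) p)"
    by (elim exE conjE) (rule that)
  have adm: "admissible \<G>'"
    by (rule admissible_subset[OF \<G> step(1,3)])
  have mem: "w \<in> \<G>'" using step(3) w(1) by simp
  have rec: "recurs \<G>' w R"
    unfolding recurs_def
  proof (rule exI[of _ "fst ` P"], rule exI[of _ D], intro conjI ballI impI)
    show "finite (fst ` P)" using step(4) by simp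
    show "fst ` P \<subseteq> R" using step(5) by auto
    fix p h assume "p \<in> \<G>'" "h \<in> carrier G" "\<forall>x\<in>D. x \<otimes> h \<in> dom p"
    then have "\<exists>i\<in>P. placed w (fst i \<otimes> h) p \<and> placed w (snd i \<otimes> h) p" using bspec[OF bspec[OF step(8)]] by blast
    then show "\<exists>f\<in>fst ` P. placed w (f \<otimes> h) p" by blast
  qed (fact step)+
  show thesis by (rule that[OF adm step(2) mem rec])
qed

text \<open>
  Translation by \<open>g\<close> can be arranged to change colours within bounded distance of
  any point. If the centraliser of \<open>g\<close> is infinite, it serves as the set of
  return times for the two-point pattern that distinguishes \<open>\<one>\<close> from
  \<open>g\<close>: at a site \<open>f \<otimes> h\<close> with \<open>f\<close> in the
  centraliser, the points of the copy are \<open>f \<otimes> h\<close> and \<open>g \<otimes>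
  f \<otimes> h = f \<otimes> g \<otimes> h\<close>. If it is finite, the points \<open>d
  \<otimes> h\<close> and \<open>d \<otimes> g \<otimes> h\<close> are far apart for almost
  all \<open>d\<close> and can be coloured independently of each other.
\<close>

lemma freeness_stage:
  assumes \<G>: "admissible \<G>" and w: "w \<in> \<G>" and g: "g \<in> carrier G" "g \<noteq> \<one>" and inf: "infinite (carrier G)"
  obtains \<G>' where "admissible \<G>'" "\<G>' \<subseteq> \<G>" "w \<in> \<G>'" "moves \<G>' g"
proof -
  obtain K where K: "pattern_family K \<G>" using \<G> unfolding admissible_def by blast
  have small: "p \<in> \<G>" if "dom p \<subseteq> carrier G" "finite (dom p)" "card (dom p) \<le> 2" for p
    using that \<G> unfolding admissible_def by blast
  define C where "C = {c \<in> carrier G. c \<otimes> g = g \<otimes> c}"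
  obtain w0 w1 R where R: "plentiful R" and w01: "w0 \<in> \<G>" "w1 \<in> \<G>" "dom w0 \<noteq> {}"
    and hit: "\<And>i p h. i \<in> R \<Longrightarrow> h \<in> carrier G \<Longrightarrow> placed w0 (fst i \<otimes> h) p \<Longrightarrow> placed w1 (snd i \<otimes> h) p \<Longrightarrow>
      p (fst i \<otimes> h) = Some False \<and> p (fst i \<otimes> g \<otimes> h) = Some True"
  proof (cases "finite C")
    case True
    show thesis
    proof (rule that)
      show "plentiful ((\<lambda>d. (d, d \<otimes> g)) ` carrier G)"
        using True by (intro plentiful_translates g(1) inf) (simp add: C_def)
      show "[\<one> \<mapsto> False] \<in> \<G>" "[\<one> \<mapsto> True] \<in> \<G>" by (auto intro!: small split: if_splits)
      show "dom [\<one> \<mapsto> False] \<noteq> {}" by simp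
      fix i p h assume "i \<in> (\<lambda>d. (d, d \<otimes> g)) ` carrier G" "h \<in> carrier G"
        "placed [\<one> \<mapsto> False] (fst i \<otimes> h) p" "placed [\<one> \<mapsto> True] (snd i \<otimes> h) p"
      then show "p (fst i \<otimes> h) = Some False \<and> p (fst i \<otimes> g \<otimes> h) = Some True"
        using g(1) by (auto simp: placed_def)
    qed
  next
    case False
    let ?w = "[\<one> \<mapsto> False, g \<mapsto> True]"
    show thesis
    proof (rule that)
      show "plentiful (C \<times> C)" by (rule plentiful_Times) (use False in \<open>auto simp: C_def\<close>)
      show "?w \<in> \<G>" "?w \<in> \<G>" by (auto intro!: small simp: g card_insert_if split: if_splits)
      show "dom ?w \<noteq> {}" by simp
      fix i p h assume *: "i \<in> C \<times> C" "h \<in> carrier G" "placed ?w (fst i \<otimes> h) p"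
      then have c: "fst i \<in> carrier G" "fst i \<otimes> g = g \<otimes> fst i" by (auto simp: C_def)
      have "p (\<one> \<otimes> (fst i \<otimes> h)) = Some False" "p (g \<otimes> (fst i \<otimes> h)) = Some True"
        using *(3) g(2) by (auto simp: placed_def)
      then show "p (fst i \<otimes> h) = Some False \<and> p (fst i \<otimes> g \<otimes> h) = Some True"
        using c *(2) g(1) by (simp add: m_assoc)
    qed
  qed
  from recurrence_step[OF K w01 R, where b = "max 2 (card (dom w))"]
  obtain K' \<G>' P D where step: "pattern_family K' \<G>'" "\<G>' \<subseteq> \<G>"
    "\<forall>p\<in>\<G>. card (dom p) \<le> max 2 (card (dom w)) \<longrightarrow> p \<in> \<G>'"
    "finite P" "P \<subseteq> R" "finite D" "D \<subseteq> carrier G"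
    "\<forall>p\<in>\<G>'. \<forall>h\<in>carrier G. (\<forall>x\<in>D. x \<otimes> h \<in> dom p) \<longrightarrow>
       (\<exists>i\<in>P. placed w0 (fst i \<otimes> h) p \<and> placed w1 (snd i \<otimes> h) p)"
    by (elim exE conjE) (rule that)
  have adm: "admissible \<G>'"
    by (rule admissible_subset[OF \<G> step(1,3)])
  have mem: "w \<in> \<G>'" using step(3) w by simp
  have mov: "moves \<G>' g"
    unfolding moves_def
  proof (rule exI[of _ "fst ` P"], rule exI[of _ D], intro conjI ballI impI)
    have "R \<subseteq> carrier G \<times> carrier G" using R by (simp add: plentiful_def)
    then show "finite (fst ` P)" "fst ` P \<subseteq> carrier G" using step(4,5) by auto
    fix p h assume ph: "p \<in> \<G>'" "h \<in> carrier G" "\<forall>x\<in>D. x \<otimes> h \<in> dom p"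
    then obtain i where "i \<in> P" "placed w0 (fst i \<otimes> h) p" "placed w1 (snd i \<otimes> h) p" using step(8) by blast
    then show "\<exists>f\<in>fst ` P. p (f \<otimes> h) = Some False \<and> p (f \<otimes> g \<otimes> h) = Some True"
      using hit[of i h p] step(5) ph(2) by blast
  qed (fact step)+
  show thesis by (rule that[OF adm step(2) mem mov])
qed

lemma stage:
  assumes \<G>: "admissible \<G>" and w: "w \<in> \<G>" "dom w \<noteq> {}" and R: "R \<subseteq> carrier G" "infinite R"
    and g: "g \<in> carrier G"
  shows "\<exists>\<G>' w'. admissible \<G>' \<and> w' \<in> \<G>' \<and> \<G>' \<subseteq> \<G> \<and> w \<subseteq>\<^sub>m w' \<and> g \<in> dom w' \<and> recurs \<G>' w R \<and> (g \<noteq> \<one> \<longrightarrow> moves \<G>' g)"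
proof -
  have inf: "infinite (carrier G)" by (rule infinite_super[OF R])
  obtain \<G>1 where 1: "admissible \<G>1" "\<G>1 \<subseteq> \<G>" "w \<in> \<G>1" "recurs \<G>1 w R"
    by (rule recurrence_stage[OF \<G> w R])
  have "\<exists>\<G>2. admissible \<G>2 \<and> \<G>2 \<subseteq> \<G>1 \<and> w \<in> \<G>2 \<and> (g \<noteq> \<one> \<longrightarrow> moves \<G>2 g)"
  proof (cases "g = \<one>")
    case True
    show ?thesis by (rule exI[of _ \<G>1]) (simp add: 1(1,3) True)
  next
    case False
    obtain \<G>2 where "admissible \<G>2" "\<G>2 \<subseteq> \<G>1" "w \<in> \<G>2" "moves \<G>2 g"
      by (rule freeness_stage[OF 1(1,3) g False inf])
    then show ?thesis by (intro exI[of _ \<G>2] conjI impI)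
  qed
  then obtain \<G>2 where 2: "admissible \<G>2" "\<G>2 \<subseteq> \<G>1" "w \<in> \<G>2" "g \<noteq> \<one> \<longrightarrow> moves \<G>2 g"
    by (elim exE conjE)
  obtain F D where FD: "finite F" "F \<subseteq> R" "finite D" "D \<subseteq> carrier G"
    "\<forall>p\<in>\<G>1. \<forall>h\<in>carrier G. (\<forall>x\<in>D. x \<otimes> h \<in> dom p) \<longrightarrow> (\<exists>f\<in>F. placed w (f \<otimes> h) p)"
    using 1(4) unfolding recurs_def by (elim exE conjE)
  have "\<forall>p\<in>\<G>2. \<forall>h\<in>carrier G. (\<forall>x\<in>D. x \<otimes> h \<in> dom p) \<longrightarrow> (\<exists>f\<in>F. placed w (f \<otimes> h) p)"
    using FD(5) 2(2) by (meson subsetD)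
  then have rec: "recurs \<G>2 w R"
    unfolding recurs_def using FD(1-4) by - (rule exI[of _ F], rule exI[of _ D], intro conjI)
  obtain K where "pattern_family K \<G>2" using 2(1) unfolding admissible_def by blast
  then have "\<exists>w'\<in>\<G>2. w \<subseteq>\<^sub>m w' \<and> g \<in> dom w' \<and> dom w' \<subseteq> K <#> insert g (dom w)"
    using 2(3) g unfolding pattern_family_def by simp
  then obtain w' where w': "w' \<in> \<G>2" "w \<subseteq>\<^sub>m w'" "g \<in> dom w'" by (elim bexE conjE)
  have "\<G>2 \<subseteq> \<G>" using 1(2) 2(2) by (rule order_trans[rotated])
  then show ?thesis using 2(1,4) w' rec by - (rule exI[of _ \<G>2], rule exI[of _ w'], intro conjI)
qed

text \<open>
  Stage \<open>k\<close> makes the current pattern recur along \<open>T k\<close>, treats the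
  \<open>k\<close>-th group element in the sense of \<open>freeness_stage\<close>, and puts it
  into the domain of the next pattern. The sets \<open>R n\<close> are listed with infinite
  repetition, so that each \<open>R n\<close> is treated when the pattern already contains any
  given finite set. All later patterns stay in the families of earlier stages, so their limit
  \<open>z\<close> inherits every requirement.
\<close>

theorem recurrent_free_point:
  fixes R :: "nat \<Rightarrow> 'a set"
  assumes "countable (carrier G)" and R: "\<And>n. R n \<subseteq> carrier G" "\<And>n. infinite (R n)"
  shows "\<exists>z :: 'a \<Rightarrow> bool.
    (\<forall>n A. finite A \<longrightarrow> A \<subseteq> carrier G \<longrightarrow>
       (\<exists>F. finite F \<and> F \<subseteq> R n \<and> (\<forall>h\<in>carrier G. \<exists>f\<in>F. \<forall>a\<in>A. z (a \<otimes> (f \<otimes> h)) = z a))) \<and>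
    (\<forall>g\<in>carrier G. g \<noteq> \<one> \<longrightarrow>
       (\<exists>F. finite F \<and> F \<subseteq> carrier G \<and> (\<forall>h\<in>carrier G. \<exists>f\<in>F. z (f \<otimes> g \<otimes> h) \<noteq> z (f \<otimes> h))))"
proof -
  define e where "e = from_nat_into (carrier G)"
  have ne: "carrier G \<noteq> {}" using one_closed by blast
  have e: "e k \<in> carrier G" for k unfolding e_def by (rule from_nat_into[OF ne])
  have e_surj: "\<exists>k. e k = a" if "a \<in> carrier G" for a
    unfolding e_def using from_nat_into_surj[OF assms(1) that] .
  define T where "T k = R (fst (prod_decode k))" for k
  define Inv where "Inv = (\<lambda>(\<G>, w). admissible \<G> \<and> w \<in> \<G> \<and> dom w \<noteq> {})"
  define Step where "Step k = (\<lambda>(\<G>, w) (\<G>', w'). \<G>' \<subseteq> \<G> \<and> w \<subseteq>\<^sub>m w' \<and> e k \<in> dom w' \<and> recurs \<G>' w (T k) \<and>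
      (e k \<noteq> \<one> \<longrightarrow> moves \<G>' (e k)))" for k
  have "\<exists>s. \<forall>k::nat. Inv (s k) \<and> Step k (s k) (s (Suc k))"
  proof (rule dependent_nat_choice)
    have "Inv ({p. finite (dom p) \<and> dom p \<subseteq> carrier G}, [\<one> \<mapsto> True])"
      using admissible_all by (simp add: Inv_def)
    then show "\<exists>s. Inv s" by blast
    fix s k assume "Inv s"
    then obtain \<G> w where s: "s = (\<G>, w)" "admissible \<G>" "w \<in> \<G>" "dom w \<noteq> {}" by (auto simp: Inv_def)
    have "T k \<subseteq> carrier G" "infinite (T k)" using R by (simp_all add: T_def)
    from stage[OF s(2-4) this e[of k]]
    obtain \<G>' w' where s': "admissible \<G>'" "w' \<in> \<G>'" "\<G>' \<subseteq> \<G>" "w \<subseteq>\<^sub>m w'" "e k \<in> dom w'" "recurs \<G>' w (T k)"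
      "e k \<noteq> \<one> \<longrightarrow> moves \<G>' (e k)"
      by (elim exE conjE) (rule that)
    then show "\<exists>s'. Inv s' \<and> Step k s s'"
      unfolding s(1) by (intro exI[of _ "(\<G>', w')"]) (auto simp: Inv_def Step_def)
  qed
  then obtain s where s: "\<And>k. Inv (s k)" "\<And>k. Step k (s k) (s (Suc k))" by blast
  define \<G> where "\<G> k = fst (s k)" for k
  define w where "w k = snd (s k)" for k
  have wG: "w k \<in> \<G> k" for k using s(1)[of k] by (auto simp: Inv_def \<G>_def w_def split: prod.splits)
  have st: "\<G> (Suc k) \<subseteq> \<G> k" "w k \<subseteq>\<^sub>m w (Suc k)" "e k \<in> dom (w (Suc k))" "recurs (\<G> (Suc k)) (w k) (T k)"
    "e k \<noteq> \<one> \<Longrightarrow> moves (\<G> (Suc k)) (e k)" for k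
    using s(2)[of k] by (auto simp: Step_def \<G>_def w_def split: prod.splits)
  have anti: "\<G> l \<subseteq> \<G> k" if "k \<le> l" for k l by (rule lift_Suc_antimono_le[where f = \<G>, OF st(1) that])
  have mono: "w k \<subseteq>\<^sub>m w l" if "k \<le> l" for k l
    using that by (induction rule: dec_induct) (auto intro: map_le_trans st(2))
  define z where "z a \<longleftrightarrow> (\<exists>k. w k a = Some True)" for a
  have z: "z a = b" if "w k a = Some b" for k a b
  proof -
    have agree: "c = b" if "w l a = Some c" for l c
    proof -
      have "w (max k l) a = Some b" "w (max k l) a = Some c"
        using mono[of k "max k l"] mono[of l "max k l"] \<open>w k a = Some b\<close> that
        by (auto simp: map_le_def dom_def)
      then show ?thesis by simp
    qed
    show ?thesis
    proof
      assume "z a"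
      then obtain l where "w l a = Some True" unfolding z_def by blast
      then show b using agree by blast
    next
      assume b
      then show "z a" using that unfolding z_def by auto
    qed
  qed
  have cover: "\<exists>N. \<forall>l\<ge>N. B \<subseteq> dom (w l)" if "finite B" "B \<subseteq> carrier G" for B
    using that
  proof (induction B rule: finite_induct)
    case (insert a B)
    then obtain N where N: "\<forall>l\<ge>N. B \<subseteq> dom (w l)" by auto
    obtain k where k: "e k = a" using e_surj insert.prems by auto
    have "a \<in> dom (w l)" if "Suc k \<le> l" for l
      using map_le_implies_dom_le[OF mono[OF that]] st(3)[of k] k by blast
    then show ?case using N by (intro exI[of _ "max N (Suc k)"]) auto
  qed simp
  have late: "\<exists>l\<ge>k. \<forall>x\<in>D. x \<otimes> h \<in> dom (w l)" if D: "finite D" "D \<subseteq> carrier G" and h: "h \<in> carrier G" for D h k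
  proof -
    obtain N where N: "\<forall>l\<ge>N. (\<lambda>x. x \<otimes> h) ` D \<subseteq> dom (w l)"
      using cover[of "(\<lambda>x. x \<otimes> h) ` D"] D h by auto
    then have "(\<lambda>x. x \<otimes> h) ` D \<subseteq> dom (w (max N k))" by simp
    then have "\<forall>x\<in>D. x \<otimes> h \<in> dom (w (max N k))" by blast
    then show ?thesis by (intro exI[of _ "max N k"] conjI) simp_all
  qed
  show ?thesis
  proof (rule exI[of _ z], intro conjI allI ballI impI)
    fix n and A :: "'a set" assume A: "finite A" "A \<subseteq> carrier G"
    obtain N where N: "\<forall>l\<ge>N. A \<subseteq> dom (w l)" using cover[OF A] by blast
    define k where "k = prod_encode (n, N)"
    have k: "T k = R n" "A \<subseteq> dom (w k)" using N le_prod_encode_2[of N n] by (auto simp: T_def k_def)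
    obtain F D where FD: "finite F" "F \<subseteq> R n" "finite D" "D \<subseteq> carrier G"
      "\<forall>p\<in>\<G> (Suc k). \<forall>h\<in>carrier G. (\<forall>x\<in>D. x \<otimes> h \<in> dom p) \<longrightarrow> (\<exists>f\<in>F. placed (w k) (f \<otimes> h) p)"
      using st(4)[of k] unfolding recurs_def k(1) by (elim exE conjE)
    have "\<exists>f\<in>F. \<forall>a\<in>A. z (a \<otimes> (f \<otimes> h)) = z a" if h: "h \<in> carrier G" for h
    proof -
      obtain l where l: "Suc k \<le> l" "\<forall>x\<in>D. x \<otimes> h \<in> dom (w l)" using late[OF FD(3,4) h] by blast
      have "w l \<in> \<G> (Suc k)" by (rule subsetD[OF anti[OF l(1)] wG])
      then obtain f where f: "f \<in> F" "placed (w k) (f \<otimes> h) (w l)" using bspec[OF bspec[OF FD(5) \<open>w l \<in> \<G> (Suc k)\<close>] h] l(2) by (elim bexE impE)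
      have "z (a \<otimes> (f \<otimes> h)) = z a" if "a \<in> A" for a
      proof -
        obtain b where b: "w k a = Some b" using k(2) \<open>a \<in> A\<close> by blast
        then have "w l (a \<otimes> (f \<otimes> h)) = Some b" using f(2) domI[of "w k" a b] by (simp add: placed_def)
        then have "z (a \<otimes> (f \<otimes> h)) = b" by (rule z)
        then show ?thesis using z[OF b] by simp
      qed
      then show ?thesis using f(1) by blast
    qed
    then show "\<exists>F. finite F \<and> F \<subseteq> R n \<and> (\<forall>h\<in>carrier G. \<exists>f\<in>F. \<forall>a\<in>A. z (a \<otimes> (f \<otimes> h)) = z a)"
      using FD(1,2) by blast
  next
    fix g assume g: "g \<in> carrier G" "g \<noteq> \<one>"
    obtain k where k: "e k = g" using e_surj g by blast
    then have "moves (\<G> (Suc k)) g" using st(5)[of k] g(2) by simp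
    then obtain F D where FD: "finite F" "F \<subseteq> carrier G" "finite D" "D \<subseteq> carrier G"
      "\<forall>p\<in>\<G> (Suc k). \<forall>h\<in>carrier G. (\<forall>x\<in>D. x \<otimes> h \<in> dom p) \<longrightarrow>
        (\<exists>f\<in>F. p (f \<otimes> h) = Some False \<and> p (f \<otimes> g \<otimes> h) = Some True)"
      unfolding moves_def by (elim exE conjE)
    have "\<exists>f\<in>F. z (f \<otimes> g \<otimes> h) \<noteq> z (f \<otimes> h)" if h: "h \<in> carrier G" for h
    proof -
      obtain l where l: "Suc k \<le> l" "\<forall>x\<in>D. x \<otimes> h \<in> dom (w l)" using late[OF FD(3,4) h] by blast
      have "w l \<in> \<G> (Suc k)" by (rule subsetD[OF anti[OF l(1)] wG])
      then obtain f where "f \<in> F" "w l (f \<otimes> h) = Some False" "w l (f \<otimes> g \<otimes> h) = Some True"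
        using bspec[OF bspec[OF FD(5) \<open>w l \<in> \<G> (Suc k)\<close>] h] l(2) by (elim bexE conjE impE)
      then have "z (f \<otimes> h) = False" "z (f \<otimes> g \<otimes> h) = True" by (simp_all only: z)
      then show ?thesis using \<open>f \<in> F\<close> by auto
    qed
    then show "\<exists>F. finite F \<and> F \<subseteq> carrier G \<and> (\<forall>h\<in>carrier G. \<exists>f\<in>F. z (f \<otimes> g \<otimes> h) \<noteq> z (f \<otimes> h))"
      using FD(1,2) by blast
  qed
qed

end

section \<open>A minimal subshift disjoint from a flow without wandering points\<close>

text \<open>
  The balls of radius \<open>1 / (n + 1)\<close> around the points of a countable dense set.
\<close>

lemma polish_countable_pi_base:
  assumes "polish_top X"
  obtains \<B> where "countable \<B>" "\<And>B. B \<in> \<B> \<Longrightarrow> openin X B \<and> B \<noteq> {}"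
    "\<And>U. openin X U \<Longrightarrow> U \<noteq> {} \<Longrightarrow> \<exists>B\<in>\<B>. B \<subseteq> U"
proof -
  obtain M d where "Metric_space M d" and X: "X = Metric_space.mtopology M d"
    using assms by (auto simp: polish_top_def completely_metrizable_space_def)
  interpret Metric_space M d by fact
  obtain C where C: "countable C" "C \<subseteq> topspace X" "X closure_of C = topspace X"
    using assms by (auto simp: polish_top_def separable_space_def)
  define \<B> where "\<B> = (\<lambda>(c, n). mball c (inverse (real (Suc n)))) ` (C \<times> UNIV)"
  show thesis
  proof (rule that[of \<B>])
    show "countable \<B>" using C(1) by (auto simp: \<B>_def)
    show "openin X B \<and> B \<noteq> {}" if "B \<in> \<B>" for B
    proof -
      obtain c n where B: "c \<in> C" "B = mball c (inverse (real (Suc n)))" using \<open>B \<in> \<B>\<close> by (auto simp: \<B>_def)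
      have "c \<in> M" using B(1) C(2) X by auto
      then have "c \<in> B" using B(2) by (simp del: of_nat_Suc)
      then have "B \<noteq> {}" by blast
      moreover have "openin X B" unfolding B(2) X by (rule openin_mball)
      ultimately show ?thesis by blast
    qed
    fix U assume U: "openin X U" "U \<noteq> {}"
    then obtain x where x: "x \<in> U" by blast
    obtain r where r: "r > 0" "mball x r \<subseteq> U" using U(1) x unfolding X openin_mtopology by blast
    have xM: "x \<in> M" using openin_subset[OF U(1)] x X by auto
    obtain n where n: "inverse (real (Suc n)) < r / 2" using reals_Archimedean[of "r / 2"] r(1) by auto
    have "x \<in> X closure_of C" using C(3) xM X by simp
    moreover have "openin X (mball x (inverse (real (Suc n))))" "x \<in> mball x (inverse (real (Suc n)))"
      using X xM by auto
    ultimately obtain c where c: "c \<in> C" "c \<in> mball x (inverse (real (Suc n)))"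
      unfolding in_closure_of by blast
    have "mball c (inverse (real (Suc n))) \<subseteq> mball x r"
    proof
      fix y assume y: "y \<in> mball c (inverse (real (Suc n)))"
      have "d x y \<le> d x c + d c y" using xM c(2) y by (intro triangle) auto
      then show "y \<in> mball x r" using xM c(2) y n by auto
    qed
    moreover have "mball c (inverse (real (Suc n))) \<in> \<B>" using c(1) by (auto simp: \<B>_def)
    ultimately show "\<exists>B\<in>\<B>. B \<subseteq> U" using r(2) by blast
  qed
qed

context flow
begin

lemma openin_action_preimage:
  assumes "g \<in> carrier G" "openin X U"
  shows "openin X {x \<in> topspace X. \<phi> g x \<in> U}"
  using continuous_map_action[OF assms(1)] assms(2) by (simp add: continuous_map_def)

lemma action_inv: "g \<in> carrier G \<Longrightarrow> x \<in> topspace X \<Longrightarrow> \<phi> (inv g) (\<phi> g x) = x"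
  using group.inv_closed[OF is_group, of g] group.l_inv[OF is_group, of g] composition_rule[of x "inv g" g] action_one by metis

text \<open>
  If all points of \<open>U\<close> had finitely many return times, then \<open>U\<close>
  would be a countable union of sets on which the return times lie in a fixed finite set
  \<open>E\<close>. By Baire category one of these (closed in \<open>U\<close>) has interior,
  and an open subset of \<open>U\<close> whose return times all lie in \<open>E\<close> is
  wandering.
\<close>

lemma nonwandering_infinite_return:
  assumes "completely_metrizable_space X" and count: "countable (carrier G)" and inf: "infinite (carrier G)"
    and nw: "\<And>x. x \<in> topspace X \<Longrightarrow> \<not> wandering_point G X \<phi> x"
    and U: "openin X U" "U \<noteq> {}"
  obtains x where "x \<in> U" "infinite {g \<in> carrier G. \<phi> g x \<in> U}"
proof -
  \<comment> \<open>the closure of U keeps T E from containing the exterior of U, where the condition is void\<close>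
  define T where "T E = {x \<in> topspace X. \<forall>g\<in>carrier G - E. \<not> (x \<in> U \<and> \<phi> g x \<in> U)} \<inter> (X closure_of U)" for E
  let ?\<E> = "{E. finite E \<and> E \<subseteq> carrier G}"
  have UX: "U \<subseteq> topspace X" using U openin_subset by blast
  have "X interior_of \<Union>(T ` ?\<E>) = {}"
  proof (rule Baire_category_alt)
    show "completely_metrizable_space X \<or> locally_compact_space X \<and> regular_space X" using assms(1) by blast
    show "countable (T ` ?\<E>)" using countable_Collect_finite_subset[OF count] by simp
    fix C assume "C \<in> T ` ?\<E>"
    then obtain E where E: "finite E" "E \<subseteq> carrier G" "C = T E" by blast
    have op: "openin X (U \<inter> {x \<in> topspace X. \<phi> g x \<in> U})" if "g \<in> carrier G" for g
      using openin_action_preimage[OF that U(1)] U(1) by blast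
    have "{x \<in> topspace X. \<forall>g\<in>carrier G - E. \<not> (x \<in> U \<and> \<phi> g x \<in> U)}
        = topspace X - (\<Union>g\<in>carrier G - E. U \<inter> {x \<in> topspace X. \<phi> g x \<in> U})"
      by auto
    moreover have "openin X (\<Union>g\<in>carrier G - E. U \<inter> {x \<in> topspace X. \<phi> g x \<in> U})"
      using op by (intro openin_Union) auto
    ultimately have "closedin X C" unfolding E(3) T_def by (intro closedin_Int) auto
    moreover have "X interior_of C = {}"
    proof (rule ccontr)
      assume "X interior_of C \<noteq> {}"
      then obtain y where y: "y \<in> X interior_of C" by blast
      have sub: "X interior_of C \<subseteq> C" by (rule interior_of_subset)
      have "y \<in> X closure_of U" using y sub E(3) by (auto simp: T_def)
      then obtain x where x: "x \<in> U" "x \<in> X interior_of C"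
        using y openin_interior_of[of X C] unfolding in_closure_of by blast
      define W where "W = U \<inter> X interior_of C"
      have "{g \<in> carrier G. W \<inter> \<phi> g ` W \<noteq> {}} \<subseteq> E"
      proof
        fix g assume "g \<in> {g \<in> carrier G. W \<inter> \<phi> g ` W \<noteq> {}}"
        then obtain w where "g \<in> carrier G" "w \<in> W" "\<phi> g w \<in> W" by blast
        then show "g \<in> E" using sub E(3) by (auto simp: W_def T_def)
      qed
      then have "wandering_set G X \<phi> W"
        unfolding wandering_set_def using E(1) UX finite_subset by (auto simp: W_def)
      moreover have "openin X W" "x \<in> W" using x U(1) by (auto simp: W_def)
      ultimately have "wandering_point G X \<phi> x" unfolding wandering_point_def by blast
      then show False using nw x(1) UX by blast
    qed
    ultimately show "closedin X C \<and> X interior_of C = {}" ..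
  qed
  then have "\<not> U \<subseteq> \<Union>(T ` ?\<E>)" using U interior_of_maximal[of U "\<Union>(T ` ?\<E>)" X] by auto
  then obtain x where x: "x \<in> U" "x \<notin> \<Union>(T ` ?\<E>)" by blast
  have "infinite {g \<in> carrier G. \<phi> g x \<in> U}"
  proof
    assume "finite {g \<in> carrier G. \<phi> g x \<in> U}"
    moreover have "x \<in> T {g \<in> carrier G. \<phi> g x \<in> U}"
      using x(1) UX closure_of_subset[OF UX] by (auto simp: T_def)
    ultimately show False using x(2) by blast
  qed
  then show thesis using x(1) that by blast
qed

end

lemma topspace_shift_space: "topspace (shift_space G) = carrier G \<rightarrow>\<^sub>E UNIV"
  by (simp add: shift_space_def)

lemma openin_shift_cylinder:
  assumes "finite A" "A \<subseteq> carrier G"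
  shows "openin (shift_space G) {y \<in> topspace (shift_space G). \<forall>a\<in>A. y a = f a}"
proof -
  have "{y \<in> topspace (shift_space G). \<forall>a\<in>A. y a = f a} = (\<Pi>\<^sub>E i\<in>carrier G. if i \<in> A then {f i} else UNIV)"
    using assms(2) by (auto simp: topspace_shift_space PiE_iff extensional_def split: if_splits)
  moreover have "finite {i \<in> carrier G. (if i \<in> A then {f i} else UNIV) \<noteq> topspace (discrete_topology UNIV)}"
    by (rule finite_subset[OF _ assms(1)]) auto
  ultimately show ?thesis unfolding shift_space_def by (simp add: openin_PiE_gen)
qed

lemma shift_open_contains_cylinder:
  assumes "openin (shift_space G) W" "y \<in> W"
  shows "\<exists>A. finite A \<and> A \<subseteq> carrier G \<and>
    (\<forall>y'\<in>topspace (shift_space G). (\<forall>a\<in>A. y' a = y a) \<longrightarrow> y' \<in> W)"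
proof -
  obtain U where U: "finite {i \<in> carrier G. U i \<noteq> topspace (discrete_topology UNIV)}"
    "y \<in> Pi\<^sub>E (carrier G) U" "Pi\<^sub>E (carrier G) U \<subseteq> W"
    using assms unfolding shift_space_def openin_product_topology_alt by meson
  show ?thesis
  proof (rule exI[of _ "{i \<in> carrier G. U i \<noteq> UNIV}"], intro conjI ballI impI)
    show "finite {i \<in> carrier G. U i \<noteq> UNIV}" using U(1) by simp
    fix y' assume y': "y' \<in> topspace (shift_space G)" "\<forall>a\<in>{i \<in> carrier G. U i \<noteq> UNIV}. y' a = y a"
    have "y' i \<in> U i" if "i \<in> carrier G" for i
      using y'(2) that U(2) by (cases "U i = UNIV") (auto simp: PiE_iff)
    then have "y' \<in> Pi\<^sub>E (carrier G) U" using y'(1) by (auto simp: topspace_shift_space PiE_iff)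
    then show "y' \<in> W" using U(3) by blast
  qed auto
qed

lemma shift_action_apply:
  "y \<in> topspace (shift_space G) \<Longrightarrow> d \<in> carrier G \<Longrightarrow> shift_action G g y d = y (d \<otimes>\<^bsub>G\<^esub> g)"
  by (simp add: shift_action_def)

text \<open>
  The prescribed sets of times are all left translates of the sets \<open>Ret n\<close> of
  return times: a point of the orbit closure of \<open>z\<close> looks locally like a
  translate of \<open>z\<close> by some \<open>h0\<close>, and to see the same pattern again
  at a time \<open>r\<close> one asks \<open>z\<close> to recur along \<open>inv h0 \<otimes>
  r\<close>.
\<close>

lemma disjoint_free_minimal_subshift:
  fixes G :: "('g, 'm) monoid_scheme" (structure)
  assumes "flow G X \<phi>" "polish_top X" and count: "countable (carrier G)" and inf: "infinite (carrier G)"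
    and nw: "\<And>x. x \<in> topspace X \<Longrightarrow> \<not> wandering_point G X \<phi> x"
  shows "\<exists>Z. subflow G (shift_space G) (shift_action G) Z \<and>
    free_flow G (subtopology (shift_space G) Z) (restrict_action (shift_action G) Z) \<and>
    minimal_flow G (subtopology (shift_space G) Z) (restrict_action (shift_action G) Z) \<and>
    disjoint_flows G X \<phi> (subtopology (shift_space G) Z) (restrict_action (shift_action G) Z)"
proof -
  interpret flow G X \<phi> by fact
  interpret group G by (rule is_group)
  obtain \<B> where \<B>: "countable \<B>" "\<And>B. B \<in> \<B> \<Longrightarrow> openin X B \<and> B \<noteq> {}"
    "\<And>U. openin X U \<Longrightarrow> U \<noteq> {} \<Longrightarrow> \<exists>B\<in>\<B>. B \<subseteq> U"
    using polish_countable_pi_base[OF assms(2)] by metis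
  have \<B>_ne: "\<B> \<noteq> {}" using \<B>(3)[of "topspace X"] nonempty by auto
  define B where "B = from_nat_into \<B>"
  have B: "openin X (B n)" "B n \<noteq> {}" for n using \<B>(2) from_nat_into[OF \<B>_ne] by (auto simp: B_def)
  have "\<exists>x. x \<in> B n \<and> infinite {g \<in> carrier G. \<phi> g x \<in> B n}" for n
    using nonwandering_infinite_return[OF _ count inf nw B] assms(2) unfolding polish_top_def by metis
  then obtain x where x: "\<And>n. x n \<in> B n" "\<And>n. infinite {g \<in> carrier G. \<phi> g (x n) \<in> B n}" by metis
  have xX: "x n \<in> topspace X" for n using x(1) B(1) openin_subset by blast
  define Ret where "Ret n = {g \<in> carrier G. \<phi> g (x n) \<in> B n}" for n
  define e where "e = from_nat_into (carrier G)"
  have e: "e k \<in> carrier G" for k unfolding e_def by (rule from_nat_into) (use one_closed in blast)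
  define R where "R k = (\<lambda>r. inv (e (snd (prod_decode k))) \<otimes> r) ` Ret (fst (prod_decode k))" for k
  have R: "R k \<subseteq> carrier G" "infinite (R k)" for k
  proof -
    show "R k \<subseteq> carrier G" using e by (auto simp: R_def Ret_def)
    have "inj_on (\<lambda>r. inv (e (snd (prod_decode k))) \<otimes> r) (Ret (fst (prod_decode k)))"
      using e by (intro inj_onI) (simp add: Ret_def)
    then show "infinite (R k)" unfolding R_def using x(2) finite_imageD by (fastforce simp: Ret_def)
  qed
  from recurrent_free_point[where R = R, OF count R]
  obtain z :: "'g \<Rightarrow> bool" where
    rec: "\<forall>n A. finite A \<longrightarrow> A \<subseteq> carrier G \<longrightarrow>
       (\<exists>F. finite F \<and> F \<subseteq> R n \<and> (\<forall>h\<in>carrier G. \<exists>f\<in>F. \<forall>a\<in>A. z (a \<otimes> (f \<otimes> h)) = z a))"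
    and free: "\<forall>g\<in>carrier G. g \<noteq> \<one> \<longrightarrow>
       (\<exists>F. finite F \<and> F \<subseteq> carrier G \<and> (\<forall>h\<in>carrier G. \<exists>f\<in>F. z (f \<otimes> g \<otimes> h) \<noteq> z (f \<otimes> h)))"
    by (elim exE conjE)
  \<comment> \<open>the orbit closure of z, in terms of finite patterns\<close>
  define Z where "Z = {y \<in> topspace (shift_space G).
    \<forall>A. finite A \<longrightarrow> A \<subseteq> carrier G \<longrightarrow> (\<exists>h\<in>carrier G. \<forall>a\<in>A. y a = z (a \<otimes> h))}"
  have ZT: "y \<in> topspace (shift_space G)" if "y \<in> Z" for y using that by (simp add: Z_def)
  have ZD: "\<exists>h\<in>carrier G. \<forall>a\<in>A. y a = z (a \<otimes> h)" if "y \<in> Z" "finite A" "A \<subseteq> carrier G" for y A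
    using that by (simp add: Z_def)
  have dense: "\<exists>r\<in>Ret n. \<forall>a\<in>A. y (a \<otimes> r) = y' a"
    if y: "y \<in> Z" and y': "y' \<in> Z" and A: "finite A" "A \<subseteq> carrier G" for y y' A n
  proof -
    obtain h0 where h0: "h0 \<in> carrier G" "\<forall>a\<in>A. y' a = z (a \<otimes> h0)" using ZD[OF y' A] by blast
    obtain j where j: "e j = h0" using from_nat_into_surj[OF count h0(1)] unfolding e_def by blast
    define k where "k = prod_encode (n, j)"
    define A' where "A' = (\<lambda>a. a \<otimes> h0) ` A"
    have A': "finite A'" "A' \<subseteq> carrier G" using A h0 by (auto simp: A'_def)
    obtain F where F: "finite F" "F \<subseteq> R k" "\<forall>h\<in>carrier G. \<exists>f\<in>F. \<forall>a\<in>A'. z (a \<otimes> (f \<otimes> h)) = z a"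
      using rec A' by meson
    have FC: "F \<subseteq> carrier G" using F(2) R(1) by blast
    define C where "C = (\<lambda>(b, f). b \<otimes> f) ` (A' \<times> F)"
    have C: "finite C" "C \<subseteq> carrier G" using A' F(1) FC by (auto simp: C_def)
    obtain h where h: "h \<in> carrier G" "\<forall>c\<in>C. y c = z (c \<otimes> h)" using ZD[OF y C] by blast
    obtain f where f: "f \<in> F" "\<forall>a\<in>A'. z (a \<otimes> (f \<otimes> h)) = z a" using F(3) h(1) by blast
    obtain r where r: "r \<in> Ret n" "f = inv h0 \<otimes> r" using f(1) F(2) j by (auto simp: R_def k_def)
    have rC: "r \<in> carrier G" using r(1) by (simp add: Ret_def)
    have "y (a \<otimes> r) = y' a" if a: "a \<in> A" for a
    proof -
      have aC: "a \<in> carrier G" using a A by blast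
      have fC: "f \<in> carrier G" using f(1) FC by blast
      have ah: "a \<otimes> h0 \<in> A'" using a by (simp add: A'_def)
      have eq: "a \<otimes> r = (a \<otimes> h0) \<otimes> f" unfolding r(2) using aC h0(1) rC by (simp add: m_assoc[symmetric]) (simp add: m_assoc)
      have "(a \<otimes> h0) \<otimes> f \<in> C" unfolding C_def using ah f(1) by force
      then have "y (a \<otimes> r) = z ((a \<otimes> h0) \<otimes> f \<otimes> h)" using h(2) eq by simp
      also have "\<dots> = z ((a \<otimes> h0) \<otimes> (f \<otimes> h))" using aC h0(1) fC h(1) by (simp add: m_assoc)
      also have "\<dots> = z (a \<otimes> h0)" using f(2) ah by blast
      also have "\<dots> = y' a" using h0(2) a by simp
      finally show ?thesis .
    qed
    then show ?thesis using r(1) by blast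
  qed
  interpret S: flow G "shift_space G" "shift_action G" by (rule flow_shift[OF is_group])
  have Z_inv: "shift_action G g y \<in> Z" if y: "y \<in> Z" and g: "g \<in> carrier G" for y g
  proof -
    have "\<exists>h\<in>carrier G. \<forall>a\<in>A. shift_action G g y a = z (a \<otimes> h)" if A: "finite A" "A \<subseteq> carrier G" for A
    proof -
      have "finite ((\<lambda>a. a \<otimes> g) ` A)" "(\<lambda>a. a \<otimes> g) ` A \<subseteq> carrier G" using A g by auto
      then obtain h where h: "h \<in> carrier G" "\<forall>c\<in>(\<lambda>a. a \<otimes> g) ` A. y c = z (c \<otimes> h)" using ZD[OF y] by blast
      have "shift_action G g y a = z (a \<otimes> (g \<otimes> h))" if "a \<in> A" for a
      proof -
        have "a \<in> carrier G" using that A by blast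
        then show ?thesis using h that g ZT[OF y] by (simp add: shift_action_apply m_assoc)
      qed
      then show ?thesis using h(1) g by blast
    qed
    then show ?thesis using S.action_closed[OF g ZT[OF y]] by (simp add: Z_def)
  qed
  have closed: "closedin (shift_space G) Z"
    unfolding closedin_def
  proof (intro conjI)
    show "Z \<subseteq> topspace (shift_space G)" using ZT by blast
    show "openin (shift_space G) (topspace (shift_space G) - Z)"
    proof (subst openin_subopen, intro ballI)
      fix y assume y: "y \<in> topspace (shift_space G) - Z"
      then obtain A where A: "finite A" "A \<subseteq> carrier G" "\<not> (\<exists>h\<in>carrier G. \<forall>a\<in>A. y a = z (a \<otimes> h))"
        by (auto simp: Z_def)
      let ?T = "{y' \<in> topspace (shift_space G). \<forall>a\<in>A. y' a = y a}"
      have "?T \<inter> Z = {}"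
      proof (rule ccontr)
        assume "?T \<inter> Z \<noteq> {}"
        then obtain y' where y': "y' \<in> Z" "\<forall>a\<in>A. y' a = y a" by blast
        then show False using ZD[OF y'(1) A(1,2)] A(3) by simp
      qed
      then show "\<exists>T. openin (shift_space G) T \<and> y \<in> T \<and> T \<subseteq> topspace (shift_space G) - Z"
        using openin_shift_cylinder[OF A(1,2), of y] y by (intro exI[of _ ?T]) auto
    qed
  qed
  have ne: "Z \<noteq> {}"
  proof -
    have "restrict z (carrier G) \<in> Z"
      unfolding Z_def by (auto simp: topspace_shift_space subset_iff intro!: bexI[of _ \<one>])
    then show ?thesis by blast
  qed
  have sub: "subflow G (shift_space G) (shift_action G) Z"
    unfolding subflow_def using closed ne Z_inv by blast
  let ?Y = "subtopology (shift_space G) Z" and ?\<psi> = "restrict_action (shift_action G) Z"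
  have TY: "topspace ?Y = Z" using ZT by auto
  have \<psi>: "?\<psi> g y = shift_action G g y" if "y \<in> Z" for g y using that by (simp add: restrict_action_def)
  have ff: "free_flow G ?Y ?\<psi>"
    unfolding free_flow_def TY
  proof (intro ballI impI)
    fix y g assume y: "y \<in> Z" and g: "g \<in> carrier G" "g \<noteq> \<one>"
    obtain F where F: "finite F" "F \<subseteq> carrier G" "\<forall>h\<in>carrier G. \<exists>f\<in>F. z (f \<otimes> g \<otimes> h) \<noteq> z (f \<otimes> h)"
      using free[rule_format, OF g] by (elim exE conjE)
    have "finite (F \<union> (\<lambda>f. f \<otimes> g) ` F)" "F \<union> (\<lambda>f. f \<otimes> g) ` F \<subseteq> carrier G" using F(1,2) g(1) by auto
    then obtain h where h: "h \<in> carrier G" "\<forall>a\<in>F \<union> (\<lambda>f. f \<otimes> g) ` F. y a = z (a \<otimes> h)" using ZD[OF y] by blast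
    obtain f where f: "f \<in> F" "z (f \<otimes> g \<otimes> h) \<noteq> z (f \<otimes> h)" using F(3) h(1) by blast
    have "y (f \<otimes> g) \<noteq> y f" using h(2) f by simp
    moreover have "shift_action G g y f = y (f \<otimes> g)"
      using f(1) F(2) by (intro shift_action_apply ZT[OF y]) auto
    ultimately have neq: "shift_action G g y f \<noteq> y f" by simp
    show "?\<psi> g y \<noteq> y"
    proof
      assume "?\<psi> g y = y"
      then have "shift_action G g y = y" unfolding \<psi>[OF y] .
      then show False using neq by simp
    qed
  qed
  have return: "\<exists>r\<in>Ret n. shift_action G r y \<in> W"
    if y: "y \<in> Z" and W: "openin ?Y W" "W \<noteq> {}" for y W n
  proof -
    obtain W' where W': "openin (shift_space G) W'" "W = W' \<inter> Z" using W(1) by (auto simp: openin_subtopology)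
    obtain y0 where y0: "y0 \<in> W'" "y0 \<in> Z" using W(2) W'(2) by blast
    obtain A where A: "finite A" "A \<subseteq> carrier G"
      "\<forall>y'\<in>topspace (shift_space G). (\<forall>a\<in>A. y' a = y0 a) \<longrightarrow> y' \<in> W'"
      using shift_open_contains_cylinder[OF W'(1) y0(1)] by (elim exE conjE)
    obtain r where r: "r \<in> Ret n" "\<forall>a\<in>A. y (a \<otimes> r) = y0 a" using dense[OF y y0(2) A(1,2)] by blast
    have rC: "r \<in> carrier G" using r(1) by (simp add: Ret_def)
    have ry: "shift_action G r y \<in> Z" by (rule Z_inv[OF y rC])
    have "shift_action G r y a = y0 a" if a: "a \<in> A" for a
    proof -
      have "shift_action G r y a = y (a \<otimes> r)" using a A(2) by (intro shift_action_apply ZT[OF y]) auto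
      then show ?thesis using r(2) a by simp
    qed
    then have "shift_action G r y \<in> W'" using A(3) ZT[OF ry] by simp
    then show ?thesis using r(1) ry W'(2) by blast
  qed
  have mf: "minimal_flow G ?Y ?\<psi>"
    unfolding minimal_flow_def TY
  proof (intro allI impI)
    fix Z1 assume "subflow G ?Y ?\<psi> Z1"
    then have Z1: "closedin ?Y Z1" "Z1 \<noteq> {}" "\<And>g. g \<in> carrier G \<Longrightarrow> ?\<psi> g ` Z1 \<subseteq> Z1"
      unfolding subflow_def by blast+
    have Z1Z: "Z1 \<subseteq> Z" using closedin_subset[OF Z1(1)] TY by simp
    obtain y where y: "y \<in> Z1" using Z1(2) by blast
    have "openin ?Y (topspace ?Y - Z1)" using Z1(1) unfolding closedin_def by blast
    then have op: "openin ?Y (Z - Z1)" unfolding TY .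
    have yZ: "y \<in> Z" using y Z1Z by blast
    have "Z - Z1 = {}"
    proof (rule ccontr)
      assume "Z - Z1 \<noteq> {}"
      then obtain r where r: "r \<in> Ret 0" "shift_action G r y \<in> Z - Z1" using return[OF yZ op] by blast
      have "r \<in> carrier G" using r(1) by (simp add: Ret_def)
      then have "?\<psi> r y \<in> Z1" using Z1(3) y by blast
      then show False using r(2) unfolding \<psi>[OF yZ] by blast
    qed
    then show "Z1 = Z" using Z1Z by blast
  qed
  have df: "disjoint_flows G X \<phi> ?Y ?\<psi>"
    unfolding disjoint_flows_def TY
  proof (intro allI impI)
    fix J assume "joining G X \<phi> ?Y ?\<psi> J"
    then have J: "closedin (prod_topology X ?Y) J" "fst ` J = topspace X"
      "\<And>g. g \<in> carrier G \<Longrightarrow> diagonal_action (topspace X) \<phi> Z ?\<psi> g ` J \<subseteq> J"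
      unfolding joining_def subflow_def TY by blast+
    have JX: "J \<subseteq> topspace X \<times> Z" using closedin_subset[OF J(1)] TY by simp
    show "J = topspace X \<times> Z"
    proof (rule ccontr)
      assume "J \<noteq> topspace X \<times> Z"
      then obtain a b where ab: "a \<in> topspace X" "b \<in> Z" "(a, b) \<notin> J" using JX by blast
      have "openin (prod_topology X ?Y) (topspace X \<times> Z - J)"
        using J(1) unfolding closedin_def topspace_prod_topology TY by blast
      then obtain U W where UW: "openin X U" "openin ?Y W" "a \<in> U" "b \<in> W" "U \<times> W \<subseteq> topspace X \<times> Z - J"
        using openin_prod_topology_alt[THEN iffD1, rule_format, of X ?Y "topspace X \<times> Z - J" a b] ab by blast
      obtain B' where B': "B' \<in> \<B>" "B' \<subseteq> U" using \<B>(3)[OF UW(1)] UW(3) by blast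
      obtain n where n: "B n = B'" using from_nat_into_surj[OF \<B>(1) B'(1)] unfolding B_def by blast
      have "x n \<in> fst ` J" using J(2) xX by simp
      then obtain y where y: "(x n, y) \<in> J" by force
      have yZ: "y \<in> Z" using y JX by blast
      obtain r where r: "r \<in> Ret n" "shift_action G r y \<in> W" using return[OF yZ UW(2)] UW(4) by blast
      have rC: "r \<in> carrier G" using r(1) by (simp add: Ret_def)
      have "diagonal_action (topspace X) \<phi> Z ?\<psi> r (x n, y) \<in> J" using J(3)[OF rC] y by blast
      moreover have "diagonal_action (topspace X) \<phi> Z ?\<psi> r (x n, y) = (\<phi> r (x n), shift_action G r y)"
        unfolding diagonal_action_def using xX[of n] yZ \<psi>[OF yZ, of r] by simp
      ultimately have "(\<phi> r (x n), shift_action G r y) \<in> J" by simp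
      moreover have "\<phi> r (x n) \<in> U" using r(1) n B'(2) by (auto simp: Ret_def)
      ultimately show False using r(2) UW(5) by blast
    qed
  qed
  show ?thesis by (rule exI[of _ Z], intro conjI sub ff mf df)
qed

section \<open>Wandering points obstruct disjointness\<close>

text \<open>
  Let \<open>F\<close> be the finite set of \<open>g\<close> with \<open>V \<inter> g V
  \<noteq> {}\<close> and \<open>W\<close> the complement of \<open>F y0\<close>, which is
  nonempty because \<open>Y\<close> is infinite. The complement \<open>Z\<close> of the orbit
  of \<open>V \<times> W\<close> is closed and invariant. It projects onto \<open>X\<close>:
  if \<open>k\<close> moves \<open>a\<close> into \<open>V\<close>, all such elements lie in
  \<open>F k\<close>, so \<open>inv k\<close> applied to \<open>y0\<close> is a partner of
  \<open>a\<close>. It projects onto \<open>Y\<close>, because some point of \<open>X\<close>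
  never enters \<open>V\<close>: otherwise finitely many translates of \<open>V\<close> would
  cover \<open>X\<close> by compactness, and \<open>\<Gamma>\<close> would be finite.
\<close>

lemma wandering_not_disjoint:
  fixes G :: "('g, 'm) monoid_scheme" (structure)
  assumes "flow G X \<phi>" "flow G Y \<psi>" and inf: "infinite (carrier G)" and infY: "infinite (topspace Y)"
    and x: "x \<in> topspace X" and wand: "wandering_point G X \<phi> x"
  shows "\<not> disjoint_flows G X \<phi> Y \<psi>"
proof -
  interpret X: flow G X \<phi> by fact
  interpret Y: flow G Y \<psi> by fact
  interpret group G by (rule X.is_group)
  obtain U V where UV: "openin X V" "x \<in> V" "V \<subseteq> U" "finite {g \<in> carrier G. U \<inter> \<phi> g ` U \<noteq> {}}"
    using wand unfolding wandering_point_def wandering_set_def by blast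
  have VX: "V \<subseteq> topspace X" using UV(1) openin_subset by blast
  define F where "F = {g \<in> carrier G. V \<inter> \<phi> g ` V \<noteq> {}}"
  have F: "finite F" by (rule finite_subset[OF _ UV(4)]) (use UV(3) in \<open>auto simp: F_def\<close>)
  have returnF: "g \<in> F" if "g \<in> carrier G" "v \<in> V" "\<phi> g v \<in> V" for g v
    using that unfolding F_def by blast
  obtain y0 where y0: "y0 \<in> topspace Y" using Y.nonempty by blast
  define W where "W = topspace Y - (\<lambda>f. \<psi> f y0) ` F"
  have W: "openin Y W"
  proof -
    have "(\<lambda>f. \<psi> f y0) ` F \<subseteq> topspace Y" using y0 Y.action_closed by (auto simp: F_def)
    then have "closedin Y ((\<lambda>f. \<psi> f y0) ` F)"
      using F Y.Hausdorff by (intro closedin_Hausdorff_finite) auto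
    then show ?thesis unfolding W_def by (rule openin_diff[OF openin_topspace])
  qed
  have "W \<noteq> {}"
    unfolding W_def using F infY by (metis Diff_infinite_finite finite_imageI infinite_imp_nonempty)
  then obtain y1 where y1: "y1 \<in> W" by blast
  define D where "D = (\<Union>g\<in>carrier G. {x \<in> topspace X. \<phi> g x \<in> V} \<times> {y \<in> topspace Y. \<psi> g y \<in> W})"
  define Z where "Z = topspace X \<times> topspace Y - D"
  have ZI: "(a, b) \<in> Z" if "a \<in> topspace X" "b \<in> topspace Y" "\<And>g. g \<in> carrier G \<Longrightarrow> \<phi> g a \<in> V \<Longrightarrow> \<psi> g b \<notin> W" for a b
    using that unfolding Z_def D_def by blast
  have ZD: "\<psi> g b \<notin> W" if "(a, b) \<in> Z" "g \<in> carrier G" "\<phi> g a \<in> V" for a b g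
    using that unfolding Z_def D_def by blast
  have "openin (prod_topology X Y) D"
    unfolding D_def
  proof (intro openin_Union ballI)
    fix S assume "S \<in> (\<lambda>g. {x \<in> topspace X. \<phi> g x \<in> V} \<times> {y \<in> topspace Y. \<psi> g y \<in> W}) ` carrier G"
    then show "openin (prod_topology X Y) S"
      using X.openin_action_preimage[OF _ UV(1)] Y.openin_action_preimage[OF _ W]
      by (auto simp: openin_prod_Times_iff)
  qed
  then have closedZ: "closedin (prod_topology X Y) Z"
    unfolding Z_def topspace_prod_topology[symmetric] by (rule closedin_diff[OF closedin_topspace])
  have sub: "Z \<subseteq> topspace X \<times> topspace Y" by (auto simp: Z_def)
  have invZ: "diagonal_action (topspace X) \<phi> (topspace Y) \<psi> k ` Z \<subseteq> Z" if k: "k \<in> carrier G" for k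
  proof (rule image_subsetI)
    fix q assume q: "q \<in> Z"
    obtain a b where ab: "q = (a, b)" by fastforce
    have abT: "a \<in> topspace X" "b \<in> topspace Y" using q sub ab by auto
    have "(\<phi> k a, \<psi> k b) \<in> Z"
    proof (rule ZI)
      show "\<phi> k a \<in> topspace X" "\<psi> k b \<in> topspace Y" using abT k X.action_closed Y.action_closed by auto
      fix g assume g: "g \<in> carrier G" "\<phi> g (\<phi> k a) \<in> V"
      have "\<phi> (g \<otimes> k) a \<in> V" using g k abT X.composition_rule by simp
      then have "\<psi> (g \<otimes> k) b \<notin> W" using ZD q ab g k by blast
      then show "\<psi> g (\<psi> k b) \<notin> W" using g k abT Y.composition_rule by simp
    qed
    then show "diagonal_action (topspace X) \<phi> (topspace Y) \<psi> k q \<in> Z"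
      using abT by (simp add: ab diagonal_action_def)
  qed
  have fstZ: "fst ` Z = topspace X"
  proof
    show "fst ` Z \<subseteq> topspace X" using sub by auto
    show "topspace X \<subseteq> fst ` Z"
    proof
      fix a assume a: "a \<in> topspace X"
      have "\<exists>b. (a, b) \<in> Z"
      proof (cases "\<exists>k\<in>carrier G. \<phi> k a \<in> V")
        case True
        then obtain k where k: "k \<in> carrier G" "\<phi> k a \<in> V" by blast
        have "(a, \<psi> (inv k) y0) \<in> Z"
        proof (rule ZI[OF a])
          show "\<psi> (inv k) y0 \<in> topspace Y" using y0 k Y.action_closed by simp
          fix g assume g: "g \<in> carrier G" "\<phi> g a \<in> V"
          have "\<phi> (g \<otimes> inv k) (\<phi> k a) = \<phi> ((g \<otimes> inv k) \<otimes> k) a"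
            using g k a X.composition_rule[of a "g \<otimes> inv k" k] by simp
          also have "(g \<otimes> inv k) \<otimes> k = g" using g k by (simp add: m_assoc)
          finally have "g \<otimes> inv k \<in> F" using returnF[of "g \<otimes> inv k" "\<phi> k a"] g k by simp
          then have "\<psi> (g \<otimes> inv k) y0 \<notin> W" by (simp add: W_def)
          then show "\<psi> g (\<psi> (inv k) y0) \<notin> W" using g k y0 Y.composition_rule by simp
        qed
        then show ?thesis by blast
      next
        case False
        then show ?thesis using ZI[OF a y0] by blast
      qed
      then show "a \<in> fst ` Z" by force
    qed
  qed
  have "\<exists>a\<in>topspace X. \<forall>g\<in>carrier G. \<phi> g a \<notin> V"
  proof (rule ccontr)
    assume "\<not> ?thesis"
    then have cov: "topspace X \<subseteq> (\<Union>g\<in>carrier G. {x \<in> topspace X. \<phi> g x \<in> V})" by blast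
    have "\<forall>S\<in>(\<lambda>g. {x \<in> topspace X. \<phi> g x \<in> V}) ` carrier G. openin X S"
      using X.openin_action_preimage[OF _ UV(1)] by blast
    from X.compact[unfolded compact_space_alt, rule_format, OF conjI[OF this cov]]
    obtain \<F> where \<F>: "finite \<F>" "\<F> \<subseteq> (\<lambda>g. {x \<in> topspace X. \<phi> g x \<in> V}) ` carrier G" "topspace X \<subseteq> \<Union>\<F>"
      by (elim exE conjE)
    obtain K where K0: "K \<subseteq> carrier G" "finite K" "\<F> = (\<lambda>g. {x \<in> topspace X. \<phi> g x \<in> V}) ` K"
      using finite_subset_image[OF \<F>(1,2)] by blast
    then have K: "finite K" "K \<subseteq> carrier G" "topspace X \<subseteq> (\<Union>g\<in>K. {x \<in> topspace X. \<phi> g x \<in> V})"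
      using \<F>(3) by simp_all
    have "carrier G \<subseteq> (\<lambda>(k, f). inv k \<otimes> f) ` (K \<times> F)"
    proof
      fix h assume h: "h \<in> carrier G"
      have "\<phi> h x \<in> topspace X" using h x X.action_closed by blast
      then obtain k where k: "k \<in> K" "\<phi> k (\<phi> h x) \<in> V" using K(3) by blast
      have kC: "k \<in> carrier G" using k K by blast
      have "\<phi> (k \<otimes> h) x \<in> V" using k(2) h kC x X.composition_rule by simp
      then have "k \<otimes> h \<in> F" using returnF[of "k \<otimes> h" x] h kC UV(2) by simp
      moreover have "h = inv k \<otimes> (k \<otimes> h)" using h kC by (simp add: m_assoc[symmetric])
      ultimately show "h \<in> (\<lambda>(k, f). inv k \<otimes> f) ` (K \<times> F)"
        using k(1) by (intro image_eqI[of _ _ "(k, k \<otimes> h)"]) simp_all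
    qed
    then have "finite (carrier G)" by (rule finite_subset) (use K(1) F in simp)
    then show False using inf by contradiction
  qed
  then obtain a where a: "a \<in> topspace X" "\<forall>g\<in>carrier G. \<phi> g a \<notin> V" by blast
  have sndZ: "snd ` Z = topspace Y"
  proof
    show "snd ` Z \<subseteq> topspace Y" using sub by auto
    show "topspace Y \<subseteq> snd ` Z"
    proof
      fix b assume "b \<in> topspace Y"
      then have "(a, b) \<in> Z" using ZI a by blast
      then show "b \<in> snd ` Z" by force
    qed
  qed
  have "Z \<noteq> {}" using fstZ X.nonempty by blast
  then have joining: "joining G X \<phi> Y \<psi> Z"
    unfolding joining_def subflow_def using closedZ invZ fstZ sndZ by blast
  have y1Y: "y1 \<in> topspace Y" using y1 by (simp add: W_def)
  have "(x, y1) \<notin> Z"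
    using ZD[of x y1 \<one>] y1 UV(2) X.action_one[OF x] Y.action_one[OF y1Y] by auto
  then have "Z \<noteq> topspace X \<times> topspace Y" using x y1Y by blast
  then show ?thesis using joining unfolding disjoint_flows_def by blast
qed

lemma free_flow_infinite:
  assumes "flow G Y \<psi>" "free_flow G Y \<psi>" "infinite (carrier G)"
  shows "infinite (topspace Y)"
proof
  assume fin: "finite (topspace Y)"
  interpret flow G Y \<psi> by fact
  interpret group G by (rule is_group)
  obtain y where y: "y \<in> topspace Y" using nonempty by blast
  have "inj_on (\<lambda>g. \<psi> g y) (carrier G)"
  proof (rule inj_onI)
    fix g h assume gh: "g \<in> carrier G" "h \<in> carrier G" "\<psi> g y = \<psi> h y"
    have "\<psi> (inv\<^bsub>G\<^esub> h \<otimes>\<^bsub>G\<^esub> g) y = \<psi> (inv\<^bsub>G\<^esub> h) (\<psi> g y)" using gh y composition_rule by simp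
    also have "\<dots> = y" unfolding gh(3) using gh y by (rule_tac action_inv)
    finally have "inv\<^bsub>G\<^esub> h \<otimes>\<^bsub>G\<^esub> g = \<one>\<^bsub>G\<^esub>" using assms(2) y gh unfolding free_flow_def by (metis inv_closed m_closed)
    then show "g = h" using gh by (metis inv_equality inv_inv inv_closed)
  qed
  moreover have "(\<lambda>g. \<psi> g y) ` carrier G \<subseteq> topspace Y" using y action_closed by blast
  ultimately have "finite (carrier G)" using fin by (metis finite_imageD finite_subset)
  then show False using assms(3) by contradiction
qed

text \<open>
  Transport of a flow along a homeomorphism, used to move a subflow of the shift into another
  type.
\<close>

definition conjugate_action :: "('y \<Rightarrow> 'z) \<Rightarrow> ('z \<Rightarrow> 'y) \<Rightarrow> 'z set \<Rightarrow> ('g \<Rightarrow> 'y \<Rightarrow> 'y) \<Rightarrow> 'g \<Rightarrow> 'z \<Rightarrow> 'z" where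
  "conjugate_action f f' B \<psi> g = (\<lambda>z\<in>B. f (\<psi> g (f' z)))"

lemma flow_conjugate_action:
  assumes "flow G Y \<psi>" and hom: "homeomorphic_maps Y Y' f f'"
  shows "flow G Y' (conjugate_action f f' (topspace Y') \<psi>)"
proof -
  interpret flow G Y \<psi> by fact
  interpret group G by (rule is_group)
  let ?\<psi> = "conjugate_action f f' (topspace Y') \<psi>"
  have cont: "continuous_map Y Y' f" "continuous_map Y' Y f'"
    and inv: "\<And>y. y \<in> topspace Y \<Longrightarrow> f' (f y) = y" "\<And>z. z \<in> topspace Y' \<Longrightarrow> f (f' z) = z"
    using hom by (auto simp: homeomorphic_maps_def)
  have fT: "f y \<in> topspace Y'" if "y \<in> topspace Y" for y
    using cont(1) that unfolding continuous_map_def by blast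
  have f'T: "f' z \<in> topspace Y" if "z \<in> topspace Y'" for z
    using cont(2) that unfolding continuous_map_def by blast
  have hs: "Y homeomorphic_space Y'" using hom unfolding homeomorphic_space_def by blast
  have "group_action G (topspace Y') ?\<psi>"
  proof (rule group_actionI[OF is_group])
    fix g z assume "g \<in> carrier G" "z \<in> topspace Y'"
    then show "?\<psi> g z \<in> topspace Y'" using action_closed f'T fT by (simp add: conjugate_action_def)
  next
    fix g show "?\<psi> g \<in> extensional (topspace Y')" by (simp add: conjugate_action_def)
  next
    fix z assume "z \<in> topspace Y'"
    then show "?\<psi> \<one>\<^bsub>G\<^esub> z = z" using action_one f'T inv by (simp add: conjugate_action_def)
  next
    fix g h z assume "g \<in> carrier G" "h \<in> carrier G" "z \<in> topspace Y'"
    then show "?\<psi> (g \<otimes>\<^bsub>G\<^esub> h) z = ?\<psi> g (?\<psi> h z)"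
      using action_closed f'T fT inv composition_rule by (simp add: conjugate_action_def)
  qed
  moreover have "continuous_map Y' Y' (?\<psi> g)" if g: "g \<in> carrier G" for g
  proof -
    have "continuous_map Y' Y' (f \<circ> (\<psi> g \<circ> f'))"
      using continuous_map_compose[OF continuous_map_compose[OF cont(2) continuous_map_action[OF g]] cont(1)] .
    then show ?thesis by (rule continuous_map_eq) (simp add: conjugate_action_def)
  qed
  moreover have "topspace Y' \<noteq> {}" using nonempty fT by blast
  moreover have "compact_space Y'" using compact homeomorphic_compact_space[OF hs] by blast
  moreover have "Hausdorff_space Y'" using Hausdorff homeomorphic_Hausdorff_space[OF hs] by blast
  ultimately show ?thesis
    by (intro flow.intro flow_axioms.intro continuous_map_discrete_prod) auto
qed

lemma disjoint_flows_conjugate_action: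
  assumes "flow G X \<phi>" "flow G Y \<psi>" and hom: "homeomorphic_maps Y Y' f f'" and disj: "disjoint_flows G X \<phi> Y \<psi>"
  shows "disjoint_flows G X \<phi> Y' (conjugate_action f f' (topspace Y') \<psi>)"
  unfolding disjoint_flows_def
proof (intro allI impI)
  interpret X: flow G X \<phi> by fact
  interpret flow G Y \<psi> by fact
  let ?\<psi> = "conjugate_action f f' (topspace Y') \<psi>"
  have cont: "continuous_map Y Y' f" "continuous_map Y' Y f'"
    and inv: "\<And>y. y \<in> topspace Y \<Longrightarrow> f' (f y) = y" "\<And>z. z \<in> topspace Y' \<Longrightarrow> f (f' z) = z"
    using hom by (auto simp: homeomorphic_maps_def)
  have fT: "f y \<in> topspace Y'" if "y \<in> topspace Y" for y
    using cont(1) that unfolding continuous_map_def by blast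
  have f'T: "f' z \<in> topspace Y" if "z \<in> topspace Y'" for z
    using cont(2) that unfolding continuous_map_def by blast
  fix J assume J: "joining G X \<phi> Y' ?\<psi> J"
  have Jc: "closedin (prod_topology X Y') J" "fst ` J = topspace X" "snd ` J = topspace Y'" "J \<noteq> {}"
    and Jinv: "\<And>g. g \<in> carrier G \<Longrightarrow> diagonal_action (topspace X) \<phi> (topspace Y') ?\<psi> g ` J \<subseteq> J"
    using J unfolding joining_def subflow_def by blast+
  have JT: "J \<subseteq> topspace X \<times> topspace Y'" using closedin_subset[OF Jc(1)] by simp
  define I where "I = {p \<in> topspace (prod_topology X Y). (\<lambda>(x, y). (x, f y)) p \<in> J}"
  have I: "(a, y) \<in> I \<longleftrightarrow> a \<in> topspace X \<and> y \<in> topspace Y \<and> (a, f y) \<in> J" for a y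
    by (auto simp: I_def)
  have I': "(a, f' z) \<in> I" if "(a, z) \<in> J" for a z
    using that JT f'T inv(2)[of z] by (auto simp: I)
  have "continuous_map (prod_topology X Y) (prod_topology X Y') (\<lambda>(x, y). (x, f y))"
    using cont(1) by (simp add: continuous_map_prod_top)
  then have "closedin (prod_topology X Y) I"
    unfolding I_def using Jc(1) by (rule closedin_continuous_map_preimage)
  moreover have "I \<noteq> {}" using Jc(4) I' by fastforce
  moreover have "diagonal_action (topspace X) \<phi> (topspace Y) \<psi> g ` I \<subseteq> I" if g: "g \<in> carrier G" for g
  proof (rule image_subsetI)
    fix q assume q: "q \<in> I"
    obtain a y where ay: "q = (a, y)" by fastforce
    have T: "a \<in> topspace X" "y \<in> topspace Y" "(a, f y) \<in> J" using q I ay by auto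
    have "diagonal_action (topspace X) \<phi> (topspace Y') ?\<psi> g (a, f y) \<in> J" using Jinv[OF g] T(3) by blast
    moreover have "diagonal_action (topspace X) \<phi> (topspace Y') ?\<psi> g (a, f y) = (\<phi> g a, f (\<psi> g y))"
      using T fT inv(1) by (simp add: diagonal_action_def conjugate_action_def)
    ultimately show "diagonal_action (topspace X) \<phi> (topspace Y) \<psi> g q \<in> I"
      using T g X.action_closed action_closed by (simp add: ay I diagonal_action_def)
  qed
  moreover have "fst ` I = topspace X"
  proof
    show "fst ` I \<subseteq> topspace X" by (auto simp: I)
    show "topspace X \<subseteq> fst ` I"
    proof
      fix a assume "a \<in> topspace X"
      then obtain z where "(a, z) \<in> J" using Jc(2) by force
      from I'[OF this] show "a \<in> fst ` I" by force
    qed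
  qed
  moreover have "snd ` I = topspace Y"
  proof
    show "snd ` I \<subseteq> topspace Y" by (auto simp: I)
    show "topspace Y \<subseteq> snd ` I"
    proof
      fix y assume y: "y \<in> topspace Y"
      then have "f y \<in> snd ` J" using Jc(3) fT by blast
      then obtain a where "(a, f y) \<in> J" by force
      then have "(a, y) \<in> I" using JT y by (auto simp: I)
      then show "y \<in> snd ` I" by force
    qed
  qed
  ultimately have "joining G X \<phi> Y \<psi> I" unfolding joining_def subflow_def by blast
  then have full: "I = topspace X \<times> topspace Y" using disj unfolding disjoint_flows_def by blast
  show "J = topspace X \<times> topspace Y'"
  proof (rule subset_antisym[OF JT], rule subsetI)
    fix q assume "q \<in> topspace X \<times> topspace Y'"
    then obtain a z where q: "q = (a, z)" "a \<in> topspace X" "z \<in> topspace Y'" by blast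
    then have "(a, f' z) \<in> I" unfolding full using f'T by blast
    then show "q \<in> J" using inv(2)[OF q(3)] by (simp add: I q(1))
  qed
qed

lemma homeomorphic_maps_pullback:
  assumes inj: "\<And>y. y \<in> topspace Y \<Longrightarrow> f' (f y) = y"
  shows "homeomorphic_maps Y (pullback_topology (f ` topspace Y) f' Y) f f'"
proof -
  have T: "topspace (pullback_topology (f ` topspace Y) f' Y) = f ` topspace Y"
    using inj by (auto simp: topspace_pullback_topology)
  have "continuous_map (pullback_topology (f ` topspace Y) f' Y) Y f'"
    using continuous_map_pullback[OF continuous_map_id[of Y], where f = f' and A = "f ` topspace Y"] by (simp add: o_def)
  moreover have "continuous_map Y (pullback_topology (f ` topspace Y) f' Y) f"
  proof (rule continuous_map_pullback')
    show "continuous_map Y Y (f' \<circ> f)"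
      by (rule continuous_map_eq[OF continuous_map_id]) (simp add: inj)
    show "topspace Y \<subseteq> f -` (f ` topspace Y)" by blast
  qed
  ultimately show ?thesis using inj unfolding homeomorphic_maps_def T by auto
qed

theorem theorem1p14:
  fixes G :: "('g, 'm) monoid_scheme" (structure)
    and X :: "'x topology"
    and \<phi> :: "'g \<Rightarrow> 'x \<Rightarrow> 'x"
  assumes "group G"
    and "countable (carrier G)" and "infinite (carrier G)"
    and "flow G X \<phi>" and "polish_top X"
  shows
    "((\<exists>(Y :: ('g, 'y) flow_universe topology) \<psi>.
         flow G Y \<psi> \<and> infinite (topspace Y) \<and> disjoint_flows G X \<phi> Y \<psi>)
      \<longleftrightarrow>
      (\<exists>Z. subflow G (shift_space G) (shift_action G) Z \<and>
         (let Y = subtopology (shift_space G) Z; \<psi> = restrict_action (shift_action G) Z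
          in free_flow G Y \<psi> \<and> minimal_flow G Y \<psi> \<and> disjoint_flows G X \<phi> Y \<psi>)))
     \<and>
     ((\<exists>Z. subflow G (shift_space G) (shift_action G) Z \<and>
         (let Y = subtopology (shift_space G) Z; \<psi> = restrict_action (shift_action G) Z
          in free_flow G Y \<psi> \<and> minimal_flow G Y \<psi> \<and> disjoint_flows G X \<phi> Y \<psi>))
      \<longleftrightarrow>
      \<not> (\<exists>x\<in>topspace X. wandering_point G X \<phi> x))"
    (is "(?one \<longleftrightarrow> ?two) \<and> (?two \<longleftrightarrow> ?three)")
proof -
  have "?three" if "?one"
    using that wandering_not_disjoint[OF assms(4) _ assms(3)] by blast
  moreover have "?two" if three: "?three"
    unfolding Let_def
    by (rule disjoint_free_minimal_subshift[OF assms(4,5,2,3)]) (use three in blast)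
  moreover have "?one" if two: "?two"
  proof -
    obtain Z where Z: "subflow G (shift_space G) (shift_action G) Z"
      "free_flow G (subtopology (shift_space G) Z) (restrict_action (shift_action G) Z)"
      "disjoint_flows G X \<phi> (subtopology (shift_space G) Z) (restrict_action (shift_action G) Z)"
      using two unfolding Let_def by (elim exE conjE)
    let ?Y = "subtopology (shift_space G) Z" and ?\<psi> = "restrict_action (shift_action G) Z"
    let ?f = "Inr :: ('g \<Rightarrow> bool) \<Rightarrow> ('g, 'y) flow_universe"
    let ?f' = "projr :: ('g, 'y) flow_universe \<Rightarrow> ('g \<Rightarrow> bool)"
    let ?Y' = "pullback_topology (?f ` topspace ?Y) ?f' ?Y"
    have flow: "flow G ?Y ?\<psi>" by (rule flow_subflow[OF flow_shift[OF assms(1)] Z(1)])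
    have hom: "homeomorphic_maps ?Y ?Y' ?f ?f'" by (rule homeomorphic_maps_pullback) simp
    have "topspace ?Y' = ?f ` topspace ?Y" by (auto simp: topspace_pullback_topology)
    moreover have "infinite (topspace ?Y)" by (rule free_flow_infinite[OF flow Z(2) assms(3)])
    ultimately have "infinite (topspace ?Y')" using finite_imageD[of ?f "topspace ?Y"] by auto
    then show ?one
      using flow_conjugate_action[OF flow hom] disjoint_flows_conjugate_action[OF assms(4) flow hom Z(3)] by blast
  qed
  ultimately show ?thesis by blast
qed

end
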